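(* Assume (HJ1) and (HJ2), and let $(V_h)_{h>0}$ be finite-dimensional subspaces of $H^1_0(\Omega)$ such that $\lim_{h\to0}\inf_{v_h\in V_h}\|v-v_h\|_{H^1}=0$ for all $v\in H^1_0(\Omega)$ and $\inf_{v_h\in V_h}\|v-v_h\|_{H^1}\le\eta(h)\|v\|_{H^2}$ for all $v\in H^2(\Omega)$, where $\eta$ is increasing with $\lim_{h\to0}\eta(h)=0$. Then for any weak solution $u\in H^2(\Omega)\cap H^1_0(\Omega)$ of $-\Delta u+H(x,Du)+\lambda u=f$ in $\Omega$, $u=0$ on $\partial\Omega$, there exist $h_0>0$ and a neighborhood $\mathcal O$ of $u$ in $H^1_0(\Omega)$ such that for every $0<h\le h_0$ there is a unique $u_h\in\mathcal O\cap V_h$ satisfying $$\int_\Omega Du_h\cdot D\phi_h+H(x,Du_h)\phi_h+\lambda u_h\phi_h\,dx=\int_\Omega f\phi_h\,dx\quad\text{for all }\phi_h\in V_h,$$ and $\|u-u_h\|_{H^1}\le C\inf_{v_h\in V_h}\|u-v_h\|_{H^1}$ with $C$ independent of $h$. In particular $\|u-u_h\|_{H^1}=O(\eta(h))$.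
   Context: $\Omega\subset\mathbb R^d$ is a bounded Lipschitz domain. (HJ1): $\lambda\ge0$, $f\in L^2(\Omega)$, $H\colon\bar\Omega\times\mathbb R^d\to\mathbb R$ is continuous and there is $C_H>0$ with $|H(x,z_1)-H(x,z_2)|\le C_H|z_1-z_2|$ for all $z_1,z_2\in\mathbb R^d$, $x\in\Omega$. (HJ2): for every $g\in L^2(\Omega)$ the unique weak solution $v\in H^1_0(\Omega)$ of $-\Delta v+\lambda v=g$ in $\Omega$, $v=0$ on $\partial\Omega$, belongs to $H^2(\Omega)$ and $\|v\|_{H^2}\le K_\Omega\|g\|_{L^2}$ for some $K_\Omega>0$. *)

theory Defs
  imports "HOL-Analysis.Analysis"
begin

definition lipschitz_domain :: "(real^'d) set \<Rightarrow> bool" where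
  "lipschitz_domain \<Omega> \<longleftrightarrow> open \<Omega> \<and> connected \<Omega> \<and> \<Omega> \<noteq> {} \<and>
     (\<forall>x0\<in>frontier \<Omega>. \<exists>r>0. \<exists>(e::real^'d) (g::real^'d \<Rightarrow> real) L.
        norm e = 1 \<and> L-lipschitz_on {y. y \<bullet> e = 0} g \<and>
        \<Omega> \<inter> ball x0 r = {x \<in> ball x0 r. x \<bullet> e > g (x - (x \<bullet> e) *\<^sub>R e)})"

definition partial :: "'d::finite \<Rightarrow> (real^'d \<Rightarrow> real) \<Rightarrow> real^'d \<Rightarrow> real" where
  "partial i \<phi> x = frechet_derivative \<phi> (at x) (axis i 1)"

definition smooth_fun :: "(real^'d::finite \<Rightarrow> real) \<Rightarrow> bool" where
  "smooth_fun \<phi> \<longleftrightarrow> (\<forall>is :: 'd list. \<forall>x. (foldr partial is \<phi>) differentiable (at x))"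

definition tsupp :: "(real^'d \<Rightarrow> real) \<Rightarrow> (real^'d) set" where
  "tsupp \<phi> = closure {x. \<phi> x \<noteq> 0}"

definition test_fun :: "(real^'d::finite) set \<Rightarrow> (real^'d \<Rightarrow> real) \<Rightarrow> bool" where
  "test_fun \<Omega> \<phi> \<longleftrightarrow> smooth_fun \<phi> \<and> compact (tsupp \<phi>) \<and> tsupp \<phi> \<subseteq> \<Omega>"

definition L2 :: "(real^'d::finite) set \<Rightarrow> (real^'d \<Rightarrow> real) \<Rightarrow> bool" where
  "L2 \<Omega> u \<longleftrightarrow> u \<in> borel_measurable (lebesgue_on \<Omega>) \<and> integrable (lebesgue_on \<Omega>) (\<lambda>x. (u x)\<^sup>2)"

definition L2norm :: "(real^'d::finite) set \<Rightarrow> (real^'d \<Rightarrow> real) \<Rightarrow> real" where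
  "L2norm \<Omega> u = sqrt (integral\<^sup>L (lebesgue_on \<Omega>) (\<lambda>x. (u x)\<^sup>2))"

definition weak_partial :: "(real^'d::finite) set \<Rightarrow> 'd \<Rightarrow> (real^'d \<Rightarrow> real) \<Rightarrow> (real^'d \<Rightarrow> real) \<Rightarrow> bool" where
  "weak_partial \<Omega> i u g \<longleftrightarrow> (\<forall>\<phi>. test_fun \<Omega> \<phi> \<longrightarrow>
      integral\<^sup>L (lebesgue_on \<Omega>) (\<lambda>x. u x * partial i \<phi> x) =
      - integral\<^sup>L (lebesgue_on \<Omega>) (\<lambda>x. g x * \<phi> x))"

definition wpd :: "(real^'d::finite) set \<Rightarrow> 'd \<Rightarrow> (real^'d \<Rightarrow> real) \<Rightarrow> real^'d \<Rightarrow> real" where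
  "wpd \<Omega> i u = (SOME g. L2 \<Omega> g \<and> weak_partial \<Omega> i u g)"

definition wgrad :: "(real^'d::finite) set \<Rightarrow> (real^'d \<Rightarrow> real) \<Rightarrow> real^'d \<Rightarrow> real^'d" where
  "wgrad \<Omega> u x = (\<chi> i. wpd \<Omega> i u x)"

definition H1 :: "(real^'d::finite) set \<Rightarrow> (real^'d \<Rightarrow> real) \<Rightarrow> bool" where
  "H1 \<Omega> u \<longleftrightarrow> L2 \<Omega> u \<and> (\<forall>i. \<exists>g. L2 \<Omega> g \<and> weak_partial \<Omega> i u g)"

definition H1norm :: "(real^'d::finite) set \<Rightarrow> (real^'d \<Rightarrow> real) \<Rightarrow> real" where
  "H1norm \<Omega> u = sqrt ((L2norm \<Omega> u)\<^sup>2 + (\<Sum>i\<in>UNIV. (L2norm \<Omega> (wpd \<Omega> i u))\<^sup>2))"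

definition H2 :: "(real^'d::finite) set \<Rightarrow> (real^'d \<Rightarrow> real) \<Rightarrow> bool" where
  "H2 \<Omega> u \<longleftrightarrow> H1 \<Omega> u \<and> (\<forall>i. H1 \<Omega> (wpd \<Omega> i u))"

definition H2norm :: "(real^'d::finite) set \<Rightarrow> (real^'d \<Rightarrow> real) \<Rightarrow> real" where
  "H2norm \<Omega> u = sqrt ((L2norm \<Omega> u)\<^sup>2 + (\<Sum>i\<in>UNIV. (L2norm \<Omega> (wpd \<Omega> i u))\<^sup>2)
        + (\<Sum>i\<in>UNIV. \<Sum>j\<in>UNIV. (L2norm \<Omega> (wpd \<Omega> j (wpd \<Omega> i u)))\<^sup>2))"

definition H10 :: "(real^'d::finite) set \<Rightarrow> (real^'d \<Rightarrow> real) \<Rightarrow> bool" where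
  "H10 \<Omega> u \<longleftrightarrow> H1 \<Omega> u \<and> (\<exists>\<phi>::nat \<Rightarrow> real^'d \<Rightarrow> real. (\<forall>n. test_fun \<Omega> (\<phi> n)) \<and>
       (\<lambda>n. H1norm \<Omega> (\<lambda>x. u x - \<phi> n x)) \<longlonglongrightarrow> 0)"

definition fun_subspace :: "(real^'d::finite \<Rightarrow> real) set \<Rightarrow> bool" where
  "fun_subspace V \<longleftrightarrow> (\<lambda>x. 0) \<in> V \<and> (\<forall>v\<in>V. \<forall>w\<in>V. (\<lambda>x. v x + w x) \<in> V)
      \<and> (\<forall>c::real. \<forall>v\<in>V. (\<lambda>x. c * v x) \<in> V)"

definition fin_dim_fun_space :: "(real^'d::finite \<Rightarrow> real) set \<Rightarrow> bool" where
  "fin_dim_fun_space V \<longleftrightarrow> fun_subspace V \<and> (\<exists>B. finite B \<and> B \<subseteq> V \<and>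
      (\<forall>v\<in>V. \<exists>c. v = (\<lambda>x. \<Sum>b\<in>B. c b * b x)))"

definition best_approx :: "(real^'d::finite) set \<Rightarrow> (real^'d \<Rightarrow> real) set \<Rightarrow> (real^'d \<Rightarrow> real) \<Rightarrow> real" where
  "best_approx \<Omega> V v = (INF w\<in>V. H1norm \<Omega> (\<lambda>x. v x - w x))"

definition weak_sol_lin :: "(real^'d::finite) set \<Rightarrow> real \<Rightarrow> (real^'d \<Rightarrow> real) \<Rightarrow> (real^'d \<Rightarrow> real) \<Rightarrow> bool" where
  "weak_sol_lin \<Omega> lam g v \<longleftrightarrow> H10 \<Omega> v \<and> (\<forall>\<phi>. H10 \<Omega> \<phi> \<longrightarrow>
      integral\<^sup>L (lebesgue_on \<Omega>) (\<lambda>x. wgrad \<Omega> v x \<bullet> wgrad \<Omega> \<phi> x + lam * v x * \<phi> x)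
      = integral\<^sup>L (lebesgue_on \<Omega>) (\<lambda>x. g x * \<phi> x))"

definition HJ_form :: "(real^'d::finite) set \<Rightarrow> (real^'d \<Rightarrow> real^'d \<Rightarrow> real) \<Rightarrow> real \<Rightarrow> (real^'d \<Rightarrow> real)
     \<Rightarrow> (real^'d \<Rightarrow> real) \<Rightarrow> (real^'d \<Rightarrow> real) \<Rightarrow> bool" where
  "HJ_form \<Omega> H lam f u \<phi> \<longleftrightarrow>
      integral\<^sup>L (lebesgue_on \<Omega>) (\<lambda>x. wgrad \<Omega> u x \<bullet> wgrad \<Omega> \<phi> x + H x (wgrad \<Omega> u x) * \<phi> x + lam * u x * \<phi> x)
      = integral\<^sup>L (lebesgue_on \<Omega>) (\<lambda>x. f x * \<phi> x)"

definition weak_sol_HJ :: "(real^'d::finite) set \<Rightarrow> (real^'d \<Rightarrow> real^'d \<Rightarrow> real) \<Rightarrow> real \<Rightarrow> (real^'d \<Rightarrow> real)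
     \<Rightarrow> (real^'d \<Rightarrow> real) \<Rightarrow> bool" where
  "weak_sol_HJ \<Omega> H lam f u \<longleftrightarrow> H10 \<Omega> u \<and> (\<forall>\<phi>. H10 \<Omega> \<phi> \<longrightarrow> HJ_form \<Omega> H lam f u \<phi>)"

end

(*
The key point is stability of the discrete linearised problem, uniformly in the drift. If w in V_h
solves the equation -Laplace w + lam w = -beta with |beta| <= CH |Dw| up to a residual r, lift it to the
exact solution z of -Laplace z + lam z = -beta. By H^2 regularity w - r is a Galerkin projection of z
with small error eta(h) K |beta|, so z solves the same drift inequality up to the small term D(z - w),
and it remains to bound Dz by that term on the continuous level. This is done without compactness and
without Sobolev embeddings: z is cut into finitely many slices {k < z < k'} on sets of small measure,
and each slice is estimated by testing with the truncated function, the drift being absorbed by the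
inequality |v|_{L^2(E)} <= delta |Dv| for |E| <= eps, which follows by averaging over translations.
Uniqueness and quasi-optimality follow from the stability, and existence by continuation in the
factor t in front of the nonlinearity. The neighbourhood can be taken to be all of H^1_0.
*)

theory Submission
  imports Defs
begin

section \<open>Semi-inner product spaces of functions\<close>

text \<open>The obstacle is that the drift destroys coercivity: \<open>CH\<close> is not assumed
  small, so testing the equation with its own solution bounds nothing. Compactness plus uniqueness
  would have to be made uniform over all drifts that arise from linearising \<open>H\<close>. The
  notion \<open>drift_sol\<close> therefore names no drift and keeps only the inequality |q| <= CH
  |Dz| + |g|. One constant then serves all drifts, all discrete spaces and all factors t in front of
  the nonlinearity. Hence the continuation advances by steps of fixed length, and h only has to be
  small enough to beat a constant that is already fixed.

  Elements are honest functions, not classes modulo null sets, and \<open>wgrad\<close> is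
  determined only almost everywhere. So the Hilbert space arguments run in semi-inner product
  spaces, equations are solved up to functions of seminorm zero, and uniqueness means that a norm of
  the difference vanishes.

  Riesz representation is used at three places: to orthogonalise in finite-dimensional spans, to
  lift to z in \<open>H10\<close>, and to turn the nonlinear term into an element of the discrete
  space.\<close>

locale semi_inner_space =
  fixes X :: "('a \<Rightarrow> real) set" and ip :: "('a \<Rightarrow> real) \<Rightarrow> ('a \<Rightarrow> real) \<Rightarrow> real"
  assumes zero_closed: "(\<lambda>x. 0) \<in> X"
    and add_closed: "u \<in> X \<Longrightarrow> v \<in> X \<Longrightarrow> (\<lambda>x. u x + v x) \<in> X"
    and scale_closed: "u \<in> X \<Longrightarrow> (\<lambda>x. c * u x) \<in> X"
    and ip_sym: "u \<in> X \<Longrightarrow> v \<in> X \<Longrightarrow> ip u v = ip v u"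
    and ip_add: "u \<in> X \<Longrightarrow> v \<in> X \<Longrightarrow> w \<in> X \<Longrightarrow> ip (\<lambda>x. u x + v x) w = ip u w + ip v w"
    and ip_scale: "u \<in> X \<Longrightarrow> w \<in> X \<Longrightarrow> ip (\<lambda>x. c * u x) w = c * ip u w"
    and ip_nonneg: "u \<in> X \<Longrightarrow> ip u u \<ge> 0"
begin

definition nrm :: "('a \<Rightarrow> real) \<Rightarrow> real" where
  "nrm u = sqrt (ip u u)"

text \<open>Depends on \<open>ip\<close> but not on \<open>X\<close>, so it is literally the same
  notion in every subspace carrying the same form. Limits are determined only up to seminorm
  zero.\<close>

definition complete_on :: "('a \<Rightarrow> real) set \<Rightarrow> bool" where
  "complete_on S \<longleftrightarrow> (\<forall>s. (\<forall>n. s n \<in> S) \<and>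
      (\<forall>e>0. \<exists>N::nat. \<forall>m\<ge>N. \<forall>n\<ge>N. nrm (\<lambda>x. s m x - s n x) < e) \<longrightarrow>
      (\<exists>l\<in>S. (\<lambda>n. nrm (\<lambda>x. s n x - l x)) \<longlonglongrightarrow> 0))"

lemma diff_closed: "u \<in> X \<Longrightarrow> v \<in> X \<Longrightarrow> (\<lambda>x. u x - v x) \<in> X"
  using add_closed[OF _ scale_closed[of v "-1"], of u] by simp

lemma ip_diff: "u \<in> X \<Longrightarrow> v \<in> X \<Longrightarrow> w \<in> X \<Longrightarrow> ip (\<lambda>x. u x - v x) w = ip u w - ip v w"
  using ip_add[OF _ scale_closed[of v "-1"], of u w] ip_scale[of v w "-1"] by simp

lemma ip_add2: "u \<in> X \<Longrightarrow> v \<in> X \<Longrightarrow> w \<in> X \<Longrightarrow> ip w (\<lambda>x. u x + v x) = ip w u + ip w v"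
  using ip_add[of u v w] by (simp add: ip_sym[of w] add_closed)

lemma ip_scale2: "u \<in> X \<Longrightarrow> w \<in> X \<Longrightarrow> ip w (\<lambda>x. c * u x) = c * ip w u"
  using ip_scale[of u w c] by (simp add: ip_sym[of w] scale_closed)

lemma ip_diff2: "u \<in> X \<Longrightarrow> v \<in> X \<Longrightarrow> w \<in> X \<Longrightarrow> ip w (\<lambda>x. u x - v x) = ip w u - ip w v"
  using ip_diff[of u v w] by (simp add: ip_sym[of w] diff_closed)

lemma ip_zero: "w \<in> X \<Longrightarrow> ip (\<lambda>x. 0) w = 0"
  using ip_scale[of "\<lambda>x. 0" w 0] zero_closed by simp

lemma nrm_nonneg [simp]: "u \<in> X \<Longrightarrow> nrm u \<ge> 0"
  by (simp add: nrm_def ip_nonneg)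

lemma nrm_sq: "u \<in> X \<Longrightarrow> (nrm u)\<^sup>2 = ip u u"
  by (simp add: nrm_def ip_nonneg)

lemma nrm_zero [simp]: "nrm (\<lambda>x. 0) = 0"
  using ip_zero[OF zero_closed] by (simp add: nrm_def)

lemma nrm_scale: "u \<in> X \<Longrightarrow> nrm (\<lambda>x. c * u x) = \<bar>c\<bar> * nrm u"
  by (simp add: nrm_def ip_scale ip_scale2 scale_closed real_sqrt_mult
      flip: mult.assoc power2_eq_square)

lemma nrm_diff_commute: "u \<in> X \<Longrightarrow> v \<in> X \<Longrightarrow> nrm (\<lambda>x. u x - v x) = nrm (\<lambda>x. v x - u x)"
  using nrm_scale[OF diff_closed, of u v "-1"] by simp

lemma nrm_sq_add_scale:
  assumes "u \<in> X" "v \<in> X"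
  shows "(nrm (\<lambda>x. u x + t * v x))\<^sup>2 = (nrm u)\<^sup>2 + 2 * t * ip u v + t\<^sup>2 * (nrm v)\<^sup>2"
proof -
  have "(nrm (\<lambda>x. u x + t * v x))\<^sup>2 = ip u u + t * ip u v + t * (ip v u + t * ip v v)"
    using assms by (simp only: nrm_sq ip_add ip_add2 ip_scale ip_scale2 add_closed scale_closed)
      (simp add: algebra_simps)
  then show ?thesis
    using nrm_sq[OF assms(1)] nrm_sq[OF assms(2)] ip_sym[OF assms]
    by (simp add: power2_eq_square algebra_simps)
qed

lemma Cauchy_Schwarz:
  assumes "u \<in> X" "v \<in> X"
  shows "\<bar>ip u v\<bar> \<le> nrm u * nrm v"
proof -
  have quad: "0 \<le> (nrm u)\<^sup>2 + 2 * t * ip u v + t\<^sup>2 * (nrm v)\<^sup>2" for t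
    using nrm_sq_add_scale[OF assms, of t] zero_le_power2 by metis
  have "(ip u v)\<^sup>2 \<le> (nrm u)\<^sup>2 * (nrm v)\<^sup>2"
  proof (cases "nrm v = 0")
    case True
    \<comment> \<open>Seminorm zero does not make \<open>v\<close> the zero function. Without its
      quadratic term the expression is affine in t and bounded below, hence constant; the t chosen
      here would give it the value -1.\<close>
    have "ip u v = 0"
    proof (rule ccontr)
      assume ne: "ip u v \<noteq> 0"
      have "0 \<le> (nrm u)\<^sup>2 + 2 * (- ((nrm u)\<^sup>2 + 1) / (2 * ip u v)) * ip u v"
        using quad[of "- ((nrm u)\<^sup>2 + 1) / (2 * ip u v)"] True by simp
      also have "\<dots> = - 1" using ne by (simp add: field_simps)
      finally show False by simp
    qed
    then show ?thesis by simp
  next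
    case False
    then have pos: "(nrm v)\<^sup>2 > 0" by simp
    have "0 \<le> (nrm u)\<^sup>2 + 2 * (- ip u v / (nrm v)\<^sup>2) * ip u v + (- ip u v / (nrm v)\<^sup>2)\<^sup>2 * (nrm v)\<^sup>2"
      by (rule quad)
    also have "\<dots> = (nrm u)\<^sup>2 - (ip u v)\<^sup>2 / (nrm v)\<^sup>2"
      using pos by (simp add: field_simps power2_eq_square)
    finally show ?thesis using pos by (simp add: field_simps)
  qed
  then have "(\<bar>ip u v\<bar>)\<^sup>2 \<le> (nrm u * nrm v)\<^sup>2" by (simp add: power_mult_distrib)
  then show ?thesis using assms by (auto intro: power2_le_imp_le)
qed

lemma nrm_triangle:
  assumes "u \<in> X" "v \<in> X"
  shows "nrm (\<lambda>x. u x + v x) \<le> nrm u + nrm v"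
proof -
  have "(nrm (\<lambda>x. u x + v x))\<^sup>2 = (nrm u)\<^sup>2 + 2 * ip u v + (nrm v)\<^sup>2"
    using nrm_sq_add_scale[OF assms, of 1] by simp
  also have "\<dots> \<le> (nrm u + nrm v)\<^sup>2"
    using Cauchy_Schwarz[OF assms] by (simp add: power2_sum)
  finally show ?thesis using assms by (auto intro: power2_le_imp_le)
qed

lemma nrm_triangle_diff:
  assumes "u \<in> X" "v \<in> X" "w \<in> X"
  shows "nrm (\<lambda>x. u x - w x) \<le> nrm (\<lambda>x. u x - v x) + nrm (\<lambda>x. v x - w x)"
  using nrm_triangle[of "\<lambda>x. u x - v x" "\<lambda>x. v x - w x"] assms diff_closed by simp

lemma nrm_le_add_diff:
  assumes "u \<in> X" "v \<in> X"
  shows "nrm u \<le> nrm v + nrm (\<lambda>x. u x - v x)"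
  using nrm_triangle[OF assms(2) diff_closed[OF assms]] by simp

lemma tendsto_nrm:
  assumes "\<And>n. s n \<in> X" "l \<in> X" "(\<lambda>n. nrm (\<lambda>x. s n x - l x)) \<longlonglongrightarrow> 0"
  shows "(\<lambda>n. nrm (s n)) \<longlonglongrightarrow> nrm l"
proof (rule Lim_transform_bound[THEN LIM_zero_cancel])
  show "\<forall>\<^sub>F n in sequentially. norm (nrm (s n) - nrm l) \<le> norm (nrm (\<lambda>x. s n x - l x))"
  proof (rule always_eventually, rule allI)
    fix n
    show "norm (nrm (s n) - nrm l) \<le> norm (nrm (\<lambda>x. s n x - l x))"
      using nrm_le_add_diff[OF assms(1)[of n] assms(2)] nrm_le_add_diff[OF assms(2) assms(1)[of n]]
        nrm_diff_commute[OF assms(1)[of n] assms(2)] by (simp add: abs_le_iff)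
  qed
qed (use assms in auto)

lemma parallelogram:
  assumes "u \<in> X" "v \<in> X"
  shows "(nrm (\<lambda>x. u x - v x))\<^sup>2 = 2 * (nrm u)\<^sup>2 + 2 * (nrm v)\<^sup>2 - 4 * (nrm (\<lambda>x. (1/2) * (u x + v x)))\<^sup>2"
  using assms by (simp only: nrm_sq ip_add ip_add2 ip_scale ip_scale2 ip_diff ip_diff2 add_closed
      scale_closed diff_closed) (simp add: algebra_simps)

text \<open>The representer is the limit of a minimising sequence of \<open>\<parallel>v\<parallel>\<^sup>2 - 2 F v\<close>, which is a
  Cauchy sequence by the parallelogram law.\<close>

theorem Riesz_representation:
  assumes complete: "complete_on X"
    and F_add: "\<And>u v. u \<in> X \<Longrightarrow> v \<in> X \<Longrightarrow> F (\<lambda>x. u x + v x) = F u + F v"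
    and F_scale: "\<And>c u. u \<in> X \<Longrightarrow> F (\<lambda>x. c * u x) = c * F u"
    and F_bound: "\<And>u. u \<in> X \<Longrightarrow> \<bar>F u\<bar> \<le> C * nrm u"
  obtains z where "z \<in> X" "\<And>v. v \<in> X \<Longrightarrow> ip z v = F v"
proof -
  define J where "J v = (nrm v)\<^sup>2 - 2 * F v" for v
  define m where "m = (INF v\<in>X. J v)"
  \<comment> \<open>Since F v is at most C * nrm v, the value is at least (nrm v - C)^2 -
    C^2.\<close>
  have J_ge: "J v \<ge> - C\<^sup>2" if "v \<in> X" for v
  proof -
    have "0 \<le> (nrm v - C)\<^sup>2" by simp
    then show ?thesis using F_bound[OF that] by (auto simp: J_def power2_diff algebra_simps)
  qed
  have bdd: "bdd_below (J ` X)" using J_ge by (auto intro!: bdd_belowI[of _ "- C\<^sup>2"])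
  have ne: "X \<noteq> {}" using zero_closed by auto
  have m_le: "m \<le> J v" if "v \<in> X" for v
    unfolding m_def using bdd that by (rule cINF_lower)
  have "\<exists>v\<in>X. J v < m + 1 / Suc n" for n
    using cINF_less_iff[OF ne bdd, of "m + 1 / Suc n"] unfolding m_def by simp
  then obtain s where s: "\<And>n. s n \<in> X" "\<And>n. J (s n) < m + 1 / Suc n" by metis
  have F_diff: "F (\<lambda>x. u x - v x) = F u - F v" if "u \<in> X" "v \<in> X" for u v
    using F_add[OF that(1) scale_closed[OF that(2), of "-1"]] F_scale[OF that(2), of "-1"] by simp
  have Cau: "(nrm (\<lambda>x. s i x - s j x))\<^sup>2 \<le> 2 / Suc i + 2 / Suc j" for i j
  proof -
    let ?h = "\<lambda>x. (1/2) * (s i x + s j x)"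
    have h: "?h \<in> X" using s by (intro scale_closed add_closed)
    have "F ?h = (F (s i) + F (s j)) / 2"
      using F_scale[OF add_closed[OF s(1)[of i] s(1)[of j]], of "1/2"] F_add[OF s(1)[of i] s(1)[of j]]
      by simp
    then have "(nrm (\<lambda>x. s i x - s j x))\<^sup>2 = 2 * J (s i) + 2 * J (s j) - 4 * J ?h"
      unfolding parallelogram[OF s(1) s(1)] J_def by simp
    also have "\<dots> \<le> 2 * (m + 1 / Suc i) + 2 * (m + 1 / Suc j) - 4 * m"
      by (intro diff_mono add_mono mult_left_mono less_imp_le[OF s(2)] m_le[OF h]) auto
    finally show ?thesis by simp
  qed
  have "\<exists>N::nat. \<forall>i\<ge>N. \<forall>j\<ge>N. nrm (\<lambda>x. s i x - s j x) < e" if e: "e > 0" for e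
  proof -
    obtain N where N: "inverse (real (Suc N)) < e\<^sup>2 / 4"
      using reals_Archimedean[of "e\<^sup>2/4"] e by auto
    have "nrm (\<lambda>x. s i x - s j x) < e" if "i \<ge> N" "j \<ge> N" for i j
    proof -
      have "1 / Suc i \<le> 1 / Suc N" "1 / Suc j \<le> 1 / Suc N" using that by (auto simp: field_simps)
      then have "(nrm (\<lambda>x. s i x - s j x))\<^sup>2 < e\<^sup>2"
        using Cau[of i j] N by (simp add: inverse_eq_divide)
      then show ?thesis using e by (simp add: power_less_imp_less_base)
    qed
    then show ?thesis by blast
  qed
  then obtain z where z: "z \<in> X" "(\<lambda>n. nrm (\<lambda>x. s n x - z x)) \<longlonglongrightarrow> 0"
    using complete s(1) unfolding complete_on_def by blast
  have "(\<lambda>n. F (s n) - F z) \<longlonglongrightarrow> 0"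
  proof (rule Lim_null_comparison)
    show "\<forall>\<^sub>F n in sequentially. norm (F (s n) - F z) \<le> C * nrm (\<lambda>x. s n x - z x)"
      using F_bound[OF diff_closed[OF s(1) z(1)]] F_diff[OF s(1) z(1)]
      by (intro always_eventually allI) simp
    show "(\<lambda>n. C * nrm (\<lambda>x. s n x - z x)) \<longlonglongrightarrow> 0"
      using tendsto_mult_left[OF z(2), of C] by simp
  qed
  then have "(\<lambda>n. F (s n)) \<longlonglongrightarrow> F z" by (rule LIM_zero_cancel)
  then have "(\<lambda>n. J (s n)) \<longlonglongrightarrow> J z"
    unfolding J_def by (intro tendsto_intros tendsto_nrm s z)
  moreover have "(\<lambda>n. m + 1 / real (Suc n)) \<longlonglongrightarrow> m + 0"
    by (intro tendsto_intros LIMSEQ_Suc[OF lim_1_over_n])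
  ultimately have Jz: "J z \<le> m"
    using s(2) by (intro LIMSEQ_le[of "\<lambda>n. J (s n)" "J z" "\<lambda>n. m + 1 / real (Suc n)"])
      (auto intro!: exI[of _ 0] less_imp_le)
  have "ip z v = F v" if v: "v \<in> X" for v
  proof (rule ccontr)
    assume neq: "ip z v \<noteq> F v"
    define a where "a = ip z v - F v"
    have ineq: "0 \<le> 2 * t * a + t\<^sup>2 * (nrm v)\<^sup>2" for t
    proof -
      have "J (\<lambda>x. z x + t * v x) = J z + 2 * t * a + t\<^sup>2 * (nrm v)\<^sup>2"
        unfolding J_def nrm_sq_add_scale[OF z(1) v] a_def
        using F_add[OF z(1) scale_closed[OF v]] F_scale[OF v] by (simp add: algebra_simps)
      then show ?thesis using m_le[OF add_closed[OF z(1) scale_closed[OF v, of t]]] Jz by simp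
    qed
    \<comment> \<open>Plays the role of the squared norm in the minimising t = - a / b; the added 1
      covers the case that \<open>v\<close> has seminorm zero.\<close>
    define b where "b = (nrm v)\<^sup>2 + 1"
    have b: "b > 0" by (simp add: b_def add_nonneg_pos)
    have "2 * (- a / b) * a + (- a / b)\<^sup>2 * (nrm v)\<^sup>2 \<le> 2 * (- a / b) * a + (- a / b)\<^sup>2 * b"
      by (intro add_left_mono mult_left_mono) (auto simp: b_def)
    also have "\<dots> = - (a\<^sup>2 / b)" using b by (simp add: field_simps power2_eq_square)
    also have "\<dots> < 0" using neq b by (simp add: a_def)
    finally show False using ineq[of "- a / b"] by simp
  qed
  with z(1) show thesis by (rule that)
qed

text \<open>Continuity method: solvability of \<open>v + t R v = y\<close> propagates from \<open>t\<close> to \<open>t + \<delta>\<close> by a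
  fixed point iteration, with a step \<open>\<delta>\<close> that depends only on the constants of \<open>R\<close>.\<close>

lemma continuity_method_step:
  assumes complete: "complete_on X"
    and R: "\<And>v. v \<in> X \<Longrightarrow> R v \<in> X"
    and Lip: "\<And>v w. v \<in> X \<Longrightarrow> w \<in> X \<Longrightarrow> nrm (\<lambda>x. R v x - R w x) \<le> M * nrm (\<lambda>x. v x - w x)"
    and inj: "\<And>v w. v \<in> X \<Longrightarrow> w \<in> X \<Longrightarrow>
          nrm (\<lambda>x. v x - w x) \<le> C * nrm (\<lambda>x. (v x + t * R v x) - (w x + t * R w x))"
    and onto: "\<And>y. y \<in> X \<Longrightarrow> \<exists>v\<in>X. nrm (\<lambda>x. (v x + t * R v x) - y x) = 0"
    and M: "M \<ge> 0" and C: "C \<ge> 0" and \<delta>: "\<delta> \<ge> 0" "C * (\<delta> * M) \<le> 1/2"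
    and y: "y \<in> X"
  shows "\<exists>v\<in>X. nrm (\<lambda>x. (v x + (t + \<delta>) * R v x) - y x) = 0"
proof -
  define G where "G v = (\<lambda>x. v x + t * R v x)" for v
  have G: "G v \<in> X" if "v \<in> X" for v
    unfolding G_def using that R by (intro add_closed scale_closed)
  have "\<exists>w\<in>X. nrm (\<lambda>x. G w x - (y x - \<delta> * R v x)) = 0" if "v \<in> X" for v
    unfolding G_def using onto[OF diff_closed[OF y scale_closed[OF R[OF that]]]] .
  \<comment> \<open>One step of the iteration: \<open>S v\<close> solves the equation at parameter t
    with \<delta> * R v moved to the right-hand side. The choice matters only up to seminorm zero,
    which the contraction estimate does not see.\<close>
  then obtain S where S: "\<And>v. v \<in> X \<Longrightarrow> S v \<in> X"
      "\<And>v. v \<in> X \<Longrightarrow> nrm (\<lambda>x. G (S v) x - (y x - \<delta> * R v x)) = 0" by metis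
  have R_scaled: "nrm (\<lambda>x. \<delta> * R v x - \<delta> * R w x) \<le> \<delta> * (M * nrm (\<lambda>x. v x - w x))"
    if "v \<in> X" "w \<in> X" for v w
  proof -
    have "(\<lambda>x. \<delta> * R v x - \<delta> * R w x) = (\<lambda>x. \<delta> * (R v x - R w x))"
      by (simp add: algebra_simps)
    then show ?thesis using nrm_scale[OF diff_closed[OF R R], of v w \<delta>] Lip[of v w] \<delta>(1) that
      by (simp add: mult_left_mono)
  qed
  have contr: "nrm (\<lambda>x. S v x - S w x) \<le> (1/2) * nrm (\<lambda>x. v x - w x)" if v: "v \<in> X" and w: "w \<in> X" for v w
  proof -
    let ?a = "\<lambda>x. y x - \<delta> * R v x" and ?b = "\<lambda>x. y x - \<delta> * R w x"
    have ab: "?a \<in> X" "?b \<in> X" using v w y R by (auto intro!: diff_closed scale_closed)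
    have GS: "G (S v) \<in> X" "G (S w) \<in> X" using v w G S by auto
    have eq: "(\<lambda>x. ?a x - ?b x) = (\<lambda>x. \<delta> * R w x - \<delta> * R v x)" by auto
    have "nrm (\<lambda>x. G (S v) x - G (S w) x) \<le> nrm (\<lambda>x. G (S v) x - ?a x) + nrm (\<lambda>x. ?a x - G (S w) x)"
      by (rule nrm_triangle_diff) (use GS ab in auto)
    also have "nrm (\<lambda>x. ?a x - G (S w) x) \<le> nrm (\<lambda>x. ?a x - ?b x) + nrm (\<lambda>x. ?b x - G (S w) x)"
      by (rule nrm_triangle_diff) (use GS ab in auto)
    also have "nrm (\<lambda>x. ?b x - G (S w) x) = 0"
      using nrm_diff_commute[OF ab(2) GS(2)] S(2)[OF w] by simp
    also have "nrm (\<lambda>x. G (S v) x - ?a x) = 0" by (rule S(2)[OF v])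
    also have "nrm (\<lambda>x. ?a x - ?b x) \<le> \<delta> * (M * nrm (\<lambda>x. v x - w x))"
      unfolding eq using R_scaled[OF w v] nrm_diff_commute[OF w v] by simp
    finally have GG: "nrm (\<lambda>x. G (S v) x - G (S w) x) \<le> \<delta> * (M * nrm (\<lambda>x. v x - w x))" by simp
    have "nrm (\<lambda>x. S v x - S w x) \<le> C * nrm (\<lambda>x. G (S v) x - G (S w) x)"
      unfolding G_def by (rule inj) (use S v w in auto)
    also have "\<dots> \<le> C * (\<delta> * (M * nrm (\<lambda>x. v x - w x)))"
      using GG C by (rule mult_left_mono)
    also have "\<dots> = (C * (\<delta> * M)) * nrm (\<lambda>x. v x - w x)" by simp
    also have "\<dots> \<le> (1/2) * nrm (\<lambda>x. v x - w x)"
      using \<delta>(2) nrm_nonneg[OF diff_closed[OF v w]] by (rule mult_right_mono)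
    finally show ?thesis .
  qed
  define s where "s n = (S ^^ n) (\<lambda>x. 0)" for n
  have s: "s n \<in> X" for n unfolding s_def by (induction n) (auto simp: zero_closed S)
  have sS: "s (Suc n) = S (s n)" for n by (simp add: s_def)
  define d where "d = nrm (\<lambda>x. s 0 x - s 1 x)"
  have d0: "d \<ge> 0" unfolding d_def by (intro nrm_nonneg diff_closed s)
  have step: "nrm (\<lambda>x. s n x - s (Suc n) x) \<le> d * (1/2)^n" for n
  proof (induction n)
    case (Suc n)
    then show ?case using contr[OF s[of n] s[of "Suc n"]] unfolding sS by simp
  qed (simp add: d_def)
  \<comment> \<open>The bound is the geometric sum in closed form; keeping the subtracted term is
    what lets the induction close.\<close>
  have tail: "nrm (\<lambda>x. s n x - s (n + k) x) \<le> 2 * d * (1/2)^n - 2 * d * (1/2)^(n+k)" for n k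
  proof (induction k)
    case (Suc k)
    have "nrm (\<lambda>x. s n x - s (n + Suc k) x)
        \<le> nrm (\<lambda>x. s n x - s (n + k) x) + nrm (\<lambda>x. s (n+k) x - s (Suc (n + k)) x)"
      using nrm_triangle_diff[OF s[of n] s[of "n+k"] s[of "Suc (n+k)"]] by simp
    also have "\<dots> \<le> 2 * d * (1/2)^n - 2 * d * (1/2)^(n+k) + d * (1/2)^(n+k)"
      using Suc step[of "n+k"] by linarith
    finally show ?case by simp
  qed simp
  have tail': "nrm (\<lambda>x. s m x - s n x) \<le> 2 * d * (1/2)^N" if "m \<ge> N" "n \<ge> N" for m n N
  proof -
    have le: "nrm (\<lambda>x. s i x - s j x) \<le> 2 * d * (1/2)^N" if "i \<ge> N" "j \<ge> i" for i j
    proof -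
      have "nrm (\<lambda>x. s i x - s j x) \<le> 2 * d * (1/2)^i - 2 * d * (1/2)^j"
        using tail[of i "j - i"] that by simp
      also have "\<dots> \<le> 2 * d * (1/2)^i" using d0 by simp
      also have "\<dots> \<le> 2 * d * (1/2)^N"
        using d0 that by (intro mult_left_mono power_decreasing) auto
      finally show ?thesis .
    qed
    show ?thesis using le[of m n] le[of n m] that nrm_diff_commute[OF s s, of m n] by linarith
  qed
  have "\<exists>N::nat. \<forall>m\<ge>N. \<forall>n\<ge>N. nrm (\<lambda>x. s m x - s n x) < e" if e: "e > 0" for e
  proof -
    have "(\<lambda>N. 2 * d * (1/2)^N) \<longlonglongrightarrow> 2 * d * 0"
      by (intro tendsto_intros LIMSEQ_power_zero) auto
    then obtain N where "2 * d * (1/2)^N < e"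
      using order_tendstoD(2)[of _ 0 sequentially e] e by (auto simp: eventually_sequentially)
    then show ?thesis using tail'[of N] by (meson order_le_less_trans)
  qed
  then obtain v where v: "v \<in> X" "(\<lambda>n. nrm (\<lambda>x. s n x - v x)) \<longlonglongrightarrow> 0"
    using complete s unfolding complete_on_def by blast
  have Sv: "nrm (\<lambda>x. S v x - v x) \<le> 0"
  proof (rule LIMSEQ_le_const)
    show "(\<lambda>n. (1/2) * nrm (\<lambda>x. s n x - v x) + nrm (\<lambda>x. s (Suc n) x - v x)) \<longlonglongrightarrow> 0"
      using tendsto_add[OF tendsto_mult_left[OF v(2), of "1/2"] LIMSEQ_Suc[OF v(2)]] by simp
    have "nrm (\<lambda>x. S v x - v x) \<le> (1/2) * nrm (\<lambda>x. s n x - v x) + nrm (\<lambda>x. s (Suc n) x - v x)" for n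
      using nrm_triangle_diff[OF S(1)[OF v(1)] s[of "Suc n"] v(1)] contr[OF v(1) s[of n]]
        nrm_diff_commute[OF v(1) s[of n]] unfolding sS by linarith
    then show "\<exists>N. \<forall>n\<ge>N. nrm (\<lambda>x. S v x - v x) \<le> (1/2) * nrm (\<lambda>x. s n x - v x) + nrm (\<lambda>x. s (Suc n) x - v x)"
      by blast
  qed
  \<comment> \<open>The limit is a fixed point only up to seminorm zero. The Lipschitz bound carries
    this through \<open>R\<close> and then through \<open>G\<close>, after which the equation solved
    by \<open>S v\<close> also holds for \<open>v\<close>.\<close>
  have Sv0: "nrm (\<lambda>x. S v x - v x) = 0"
    using Sv nrm_nonneg[OF diff_closed[OF S(1)[OF v(1)] v(1)]] by linarith
  have vS0: "nrm (\<lambda>x. v x - S v x) = 0"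
    using Sv0 nrm_diff_commute[OF v(1) S(1)[OF v(1)]] by simp
  have "nrm (\<lambda>x. R v x - R (S v) x) \<le> 0" using Lip[OF v(1) S(1)[OF v(1)]] vS0 by simp
  then have Rv: "nrm (\<lambda>x. t * (R v x - R (S v) x)) = 0"
    using nrm_nonneg[OF diff_closed[OF R[OF v(1)] R[OF S(1)[OF v(1)]]]]
      nrm_scale[OF diff_closed[OF R[OF v(1)] R[OF S(1)[OF v(1)]]]] by simp
  have "(\<lambda>x. G v x - G (S v) x) = (\<lambda>x. (v x - S v x) + t * (R v x - R (S v) x))"
    by (simp add: G_def algebra_simps)
  then have "nrm (\<lambda>x. G v x - G (S v) x) \<le> nrm (\<lambda>x. v x - S v x) + nrm (\<lambda>x. t * (R v x - R (S v) x))"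
    using nrm_triangle[OF diff_closed[OF v(1) S(1)[OF v(1)]]
        scale_closed[OF diff_closed[OF R[OF v(1)] R[OF S(1)[OF v(1)]]], of t]] by simp
  then have GG: "nrm (\<lambda>x. G v x - G (S v) x) \<le> 0" using vS0 Rv by simp
  have "nrm (\<lambda>x. G v x - (y x - \<delta> * R v x)) \<le> nrm (\<lambda>x. G v x - G (S v) x) + nrm (\<lambda>x. G (S v) x - (y x - \<delta> * R v x))"
    using v(1) S(1) R y G by (intro nrm_triangle_diff diff_closed scale_closed) auto
  then have "nrm (\<lambda>x. G v x - (y x - \<delta> * R v x)) \<le> 0" using GG S(2)[OF v(1)] by simp
  moreover have "0 \<le> nrm (\<lambda>x. G v x - (y x - \<delta> * R v x))"
    using v(1) R y G by (intro nrm_nonneg diff_closed scale_closed) auto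
  moreover have "(\<lambda>x. G v x - (y x - \<delta> * R v x)) = (\<lambda>x. (v x + (t + \<delta>) * R v x) - y x)"
    by (simp add: G_def algebra_simps)
  ultimately show ?thesis using v(1) by auto
qed

theorem continuity_method:
  assumes complete: "complete_on X"
    and R: "\<And>v. v \<in> X \<Longrightarrow> R v \<in> X"
    and Lip: "\<And>v w. v \<in> X \<Longrightarrow> w \<in> X \<Longrightarrow> nrm (\<lambda>x. R v x - R w x) \<le> M * nrm (\<lambda>x. v x - w x)"
    and inj: "\<And>t v w. 0 \<le> t \<Longrightarrow> t \<le> 1 \<Longrightarrow> v \<in> X \<Longrightarrow> w \<in> X \<Longrightarrow>
          nrm (\<lambda>x. v x - w x) \<le> C * nrm (\<lambda>x. (v x + t * R v x) - (w x + t * R w x))"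
    and M: "M \<ge> 0" and C: "C \<ge> 0" and y: "y \<in> X"
  shows "\<exists>v\<in>X. nrm (\<lambda>x. (v x + R v x) - y x) = 0"
proof -
  \<comment> \<open>With at least 2 C M steps, a step of length 1/n satisfies C * (1/n * M) \<le>
    1/2. The successor keeps n positive when C M = 0.\<close>
  obtain n0 :: nat where n0: "real n0 \<ge> 2 * C * M" using real_arch_simple by blast
  define n where "n = Suc n0"
  have n: "n > 0" "real n \<ge> 2 * C * M" using n0 by (auto simp: n_def)
  have "\<forall>y\<in>X. \<exists>v\<in>X. nrm (\<lambda>x. (v x + (real k / real n) * R v x) - y x) = 0" if "k \<le> n" for k
    using that
  proof (induction k)
    case 0
    then show ?case by (auto intro!: bexI)
  next
    case (Suc k)
    have onto: "\<exists>v\<in>X. nrm (\<lambda>x. (v x + (real k / real n) * R v x) - y x) = 0" if "y \<in> X" for y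
      using Suc that by auto
    have "C * (1 / real n * M) \<le> 1/2" using n by (simp add: field_simps)
    then have "\<exists>v\<in>X. nrm (\<lambda>x. (v x + (real k / real n + 1 / real n) * R v x) - y x) = 0" if "y \<in> X" for y
      using Suc.prems M C that
      by (intro continuity_method_step[OF complete R Lip inj onto]) (auto simp: field_simps)
    then show ?case by (simp add: add_divide_distrib add.commute)
  qed
  from this[of n] y n(1) show ?thesis by auto
qed

text \<open>Allows Riesz representation and the continuity method to be run inside a discrete space,
  with unchanged form and seminorm.\<close>

lemma subspace_semi_inner_space:
  assumes "S \<subseteq> X" "(\<lambda>x. 0) \<in> S" "\<And>u v. u \<in> S \<Longrightarrow> v \<in> S \<Longrightarrow> (\<lambda>x. u x + v x) \<in> S"
    and "\<And>c u. u \<in> S \<Longrightarrow> (\<lambda>x. c * u x) \<in> S"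
  shows "semi_inner_space S ip"
proof
  fix u v w :: "'a \<Rightarrow> real" and c :: real
  show "(\<lambda>x. 0) \<in> S" by fact
  show "u \<in> S \<Longrightarrow> v \<in> S \<Longrightarrow> (\<lambda>x. u x + v x) \<in> S" by fact
  show "u \<in> S \<Longrightarrow> (\<lambda>x. c * u x) \<in> S" by fact
  show "u \<in> S \<Longrightarrow> v \<in> S \<Longrightarrow> ip u v = ip v u" using assms(1) by (intro ip_sym) auto
  show "u \<in> S \<Longrightarrow> v \<in> S \<Longrightarrow> w \<in> S \<Longrightarrow> ip (\<lambda>x. u x + v x) w = ip u w + ip v w"
    using assms(1) by (intro ip_add) auto
  show "u \<in> S \<Longrightarrow> w \<in> S \<Longrightarrow> ip (\<lambda>x. c * u x) w = c * ip u w"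
    using assms(1) by (intro ip_scale) auto
  show "u \<in> S \<Longrightarrow> ip u u \<ge> 0" using assms(1) by (intro ip_nonneg) auto
qed

section \<open>Completeness of finite-dimensional spans\<close>

definition fspan :: "('a \<Rightarrow> real) set \<Rightarrow> ('a \<Rightarrow> real) set" where
  "fspan B = range (\<lambda>c x. \<Sum>b\<in>B. c b * b x)"

lemma fspan_zero: "(\<lambda>x. 0) \<in> fspan B"
  unfolding fspan_def by (rule range_eqI[of _ _ "\<lambda>b. 0"]) simp

lemma fspan_add:
  assumes "u \<in> fspan B" "v \<in> fspan B"
  shows "(\<lambda>x. u x + v x) \<in> fspan B"
proof -
  obtain c d where "u = (\<lambda>x. \<Sum>b\<in>B. c b * b x)" "v = (\<lambda>x. \<Sum>b\<in>B. d b * b x)"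
    using assms unfolding fspan_def by auto
  then show ?thesis unfolding fspan_def
    by (intro range_eqI[of _ _ "\<lambda>b. c b + d b"]) (simp add: sum.distrib distrib_right)
qed

lemma fspan_scale:
  assumes "u \<in> fspan B"
  shows "(\<lambda>x. c * u x) \<in> fspan B"
proof -
  obtain d where "u = (\<lambda>x. \<Sum>b\<in>B. d b * b x)"
    using assms unfolding fspan_def by auto
  then show ?thesis unfolding fspan_def
    by (intro range_eqI[of _ _ "\<lambda>b. c * d b"]) (simp add: sum_distrib_left mult.assoc)
qed

lemma fspan_insert:
  assumes "finite B" "b \<notin> B" "v \<in> fspan (insert b B)"
  obtains c s where "s \<in> fspan B" "v = (\<lambda>x. c * b x + s x)"
proof -
  obtain d where "v = (\<lambda>x. \<Sum>b\<in>insert b B. d b * b x)"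
    using assms(3) unfolding fspan_def by auto
  then have "v = (\<lambda>x. d b * b x + (\<Sum>b\<in>B. d b * b x))" using assms by simp
  then show thesis using that unfolding fspan_def by blast
qed

lemma fspan_insertI:
  assumes "finite B" "b \<notin> B" "s \<in> fspan B"
  shows "(\<lambda>x. c * b x + s x) \<in> fspan (insert b B)"
proof -
  obtain d where s: "s = (\<lambda>x. \<Sum>b\<in>B. d b * b x)"
    using assms(3) unfolding fspan_def by auto
  have "(\<Sum>b'\<in>insert b B. (d(b := c)) b' * b' x) = c * b x + s x" for x
    using assms(1,2) by (auto simp: s intro!: sum.cong)
  then show ?thesis unfolding fspan_def by (intro range_eqI[of _ _ "d(b := c)"]) auto
qed

lemma fspan_subset:
  assumes "finite B" "B \<subseteq> X"
  shows "fspan B \<subseteq> X"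
  using assms
proof (induction B)
  case empty
  then show ?case by (auto simp: fspan_def zero_closed)
next
  case (insert b B)
  then show ?case by (auto elim!: fspan_insert intro!: add_closed scale_closed)
qed

text \<open>Induction along a Gram-Schmidt step: the smaller span is complete, so Riesz
  representation provides the projection \<open>p\<close> of the new generator onto it. By
  Pythagoras the orthogonal coordinate and the remainder of a Cauchy sequence are Cauchy separately.
  The generators need not be independent.\<close>

lemma complete_on_fspan:
  assumes "finite B" "B \<subseteq> X"
  shows "complete_on (fspan B)"
  using assms
proof (induction B)
  case empty
  then show ?case by (auto simp: complete_on_def fspan_def)
next
  case (insert b B)
  let ?S = "fspan B"
  have SX: "?S \<subseteq> X" using insert by (intro fspan_subset) auto
  have b: "b \<in> X" using insert by auto
  interpret S: semi_inner_space ?S ip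
    by (rule subspace_semi_inner_space) (use SX fspan_zero fspan_add fspan_scale in auto)
  have comp: "complete_on ?S" using insert by auto
  obtain p where p: "p \<in> ?S" "\<And>v. v \<in> ?S \<Longrightarrow> ip p v = ip b v"
  proof (rule S.Riesz_representation[of "\<lambda>v. ip b v" "nrm b"])
    show "S.complete_on ?S" using comp .
    show "\<bar>ip b u\<bar> \<le> nrm b * S.nrm u" if "u \<in> ?S" for u
      using Cauchy_Schwarz[OF b] SX that by auto
  qed (use SX b ip_add2 ip_scale2 in \<open>auto simp: subset_iff\<close>)
  define b' where "b' = (\<lambda>x. b x - p x)"
  have b': "b' \<in> X" unfolding b'_def using b p(1) SX by (intro diff_closed) auto
  have orth: "ip b' v = 0" if "v \<in> ?S" for v
    using p that SX b by (auto simp: b'_def ip_diff subset_iff)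
  have pyth: "(nrm (\<lambda>x. c * b' x + v x))\<^sup>2 = c\<^sup>2 * (nrm b')\<^sup>2 + (nrm v)\<^sup>2" if "v \<in> ?S" for c v
    using nrm_sq_add_scale[of v b' c] orth[OF that] that SX b' ip_sym[of v b']
    by (auto simp: add.commute)
  show ?case unfolding complete_on_def
  proof (intro allI impI, elim conjE)
    fix s assume sV: "\<forall>n. s n \<in> fspan (insert b B)"
      and Cau: "\<forall>e>0. \<exists>N::nat. \<forall>m\<ge>N. \<forall>n\<ge>N. nrm (\<lambda>x. s m x - s n x) < e"
    have "\<exists>c r. r \<in> ?S \<and> s n = (\<lambda>x. c * b' x + r x)" for n
    proof -
      obtain c r where r: "r \<in> ?S" "s n = (\<lambda>x. c * b x + r x)"
        using fspan_insert[OF insert(1,2)] sV by metis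
      have "s n = (\<lambda>x. c * b' x + (r x + c * p x))"
        unfolding r(2) b'_def by (simp add: algebra_simps)
      moreover have "(\<lambda>x. r x + c * p x) \<in> ?S" by (intro fspan_add fspan_scale r p)
      ultimately show ?thesis by blast
    qed
    then obtain c r where r: "\<And>n. r n \<in> ?S" "\<And>n. s n = (\<lambda>x. c n * b' x + r n x)" by metis
    have rX: "r n \<in> X" for n using r(1) SX by auto
    have rdiff: "(\<lambda>x. r m x - r n x) \<in> ?S" for m n by (rule S.diff_closed[OF r(1) r(1)])
    have pd: "(nrm (\<lambda>x. s m x - s n x))\<^sup>2
        = (c m - c n)\<^sup>2 * (nrm b')\<^sup>2 + (nrm (\<lambda>x. r m x - r n x))\<^sup>2" for m n
    proof -
      have "(\<lambda>x. s m x - s n x) = (\<lambda>x. (c m - c n) * b' x + (r m x - r n x))"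
        by (simp add: r(2) algebra_simps)
      then show ?thesis using pyth[OF rdiff] by simp
    qed
    have sX: "(\<lambda>x. s m x - s n x) \<in> X" for m n
      unfolding r(2) by (intro diff_closed add_closed scale_closed b' rX)
    have rle: "nrm (\<lambda>x. r m x - r n x) \<le> nrm (\<lambda>x. s m x - s n x)" for m n
      by (rule power2_le_imp_le[OF _ nrm_nonneg[OF sX]]) (simp add: pd)
    have cle: "\<bar>c m - c n\<bar> * nrm b' \<le> nrm (\<lambda>x. s m x - s n x)" for m n
      by (rule power2_le_imp_le[OF _ nrm_nonneg[OF sX]]) (simp add: pd power_mult_distrib)
    have "\<forall>e>0. \<exists>N::nat. \<forall>m\<ge>N. \<forall>n\<ge>N. nrm (\<lambda>x. r m x - r n x) < e"
    proof (intro allI impI)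
      fix e :: real assume "e > 0"
      then obtain N where "\<forall>m\<ge>N. \<forall>n\<ge>N. nrm (\<lambda>x. s m x - s n x) < e" using Cau by blast
      then show "\<exists>N::nat. \<forall>m\<ge>N. \<forall>n\<ge>N. nrm (\<lambda>x. r m x - r n x) < e"
        using rle order_le_less_trans by blast
    qed
    then obtain l where l: "l \<in> ?S" "(\<lambda>n. nrm (\<lambda>x. r n x - l x)) \<longlonglongrightarrow> 0"
      using comp r(1) unfolding complete_on_def by blast
    \<comment> \<open>If the new generator lies in the old span up to seminorm zero, its coordinate
      may behave arbitrarily but carries no weight, so any \<open>k\<close> will do.\<close>
    obtain k where k: "(\<lambda>n. \<bar>c n - k\<bar> * nrm b') \<longlonglongrightarrow> 0"
    proof (cases "nrm b' = 0")
      case True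
      then show ?thesis using that by simp
    next
      case False
      then have pos: "nrm b' > 0" using nrm_nonneg[OF b'] by linarith
      have "Cauchy c"
      proof (rule metric_CauchyI)
        fix e :: real assume "e > 0"
        then obtain N where N: "\<forall>m\<ge>N. \<forall>n\<ge>N. nrm (\<lambda>x. s m x - s n x) < e * nrm b'"
          using Cau mult_pos_pos[OF _ pos] by blast
        have "dist (c m) (c n) < e" if "m \<ge> N" "n \<ge> N" for m n
        proof -
          have "\<bar>c m - c n\<bar> * nrm b' < e * nrm b'" using cle[of m n] N that by fastforce
          then show ?thesis using pos by (simp add: dist_real_def)
        qed
        then show "\<exists>M. \<forall>m\<ge>M. \<forall>n\<ge>M. dist (c m) (c n) < e" by blast
      qed
      then obtain k where "c \<longlonglongrightarrow> k" using Cauchy_convergent_iff convergent_def by blast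
      then have "(\<lambda>n. \<bar>c n - k\<bar> * nrm b') \<longlonglongrightarrow> \<bar>k - k\<bar> * nrm b'" by (intro tendsto_intros)
      then show ?thesis using that by simp
    qed
    let ?L = "\<lambda>x. k * b' x + l x"
    have lX: "l \<in> X" using l SX by auto
    have "?L = (\<lambda>x. k * b x + (l x + (- k) * p x))" by (simp add: b'_def algebra_simps)
    also have "\<dots> \<in> fspan (insert b B)"
      by (intro fspan_insertI insert fspan_add fspan_scale l p)
    finally have L: "?L \<in> fspan (insert b B)" .
    have "(\<lambda>n. nrm (\<lambda>x. s n x - ?L x)) \<longlonglongrightarrow> 0"
    proof (rule Lim_null_comparison)
      show "(\<lambda>n. \<bar>c n - k\<bar> * nrm b' + nrm (\<lambda>x. r n x - l x)) \<longlonglongrightarrow> 0"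
        using tendsto_add[OF k l(2)] by simp
      show "\<forall>\<^sub>F n in sequentially. norm (nrm (\<lambda>x. s n x - ?L x)) \<le> \<bar>c n - k\<bar> * nrm b' + nrm (\<lambda>x. r n x - l x)"
      proof (intro always_eventually allI)
        fix n
        have eq: "(\<lambda>x. s n x - ?L x) = (\<lambda>x. (c n - k) * b' x + (r n x - l x))"
          by (simp add: r(2) algebra_simps)
        have rl: "(\<lambda>x. r n x - l x) \<in> X" by (intro diff_closed rX lX)
        have "nrm (\<lambda>x. (c n - k) * b' x + (r n x - l x)) \<le> \<bar>c n - k\<bar> * nrm b' + nrm (\<lambda>x. r n x - l x)"
          using nrm_triangle[OF scale_closed[OF b'] rl, of "c n - k"] nrm_scale[OF b'] by simp
        moreover have "nrm (\<lambda>x. (c n - k) * b' x + (r n x - l x)) \<ge> 0"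
          by (intro nrm_nonneg add_closed scale_closed b' rl)
        ultimately show "norm (nrm (\<lambda>x. s n x - ?L x)) \<le> \<bar>c n - k\<bar> * nrm b' + nrm (\<lambda>x. r n x - l x)"
          unfolding eq by simp
      qed
    qed
    then show "\<exists>l\<in>fspan (insert b B). (\<lambda>n. nrm (\<lambda>x. s n x - l x)) \<longlonglongrightarrow> 0"
      by (rule bexI[OF _ L])
  qed
qed

end

section \<open>Square integrable functions\<close>

definition L2ip :: "(real^'d::finite) set \<Rightarrow> (real^'d \<Rightarrow> real) \<Rightarrow> (real^'d \<Rightarrow> real) \<Rightarrow> real" where
  "L2ip \<Omega> u v = integral\<^sup>L (lebesgue_on \<Omega>) (\<lambda>x. u x * v x)"

lemma L2_measurable [measurable_dest]: "L2 \<Omega> u \<Longrightarrow> u \<in> borel_measurable (lebesgue_on \<Omega>)"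
  by (simp add: L2_def)

lemma L2_AE_bound:
  assumes "u \<in> borel_measurable (lebesgue_on \<Omega>)" "L2 \<Omega> v"
    and "AE x in lebesgue_on \<Omega>. \<bar>u x\<bar> \<le> \<bar>v x\<bar>"
  shows "L2 \<Omega> u"
  unfolding L2_def
proof
  show "integrable (lebesgue_on \<Omega>) (\<lambda>x. (u x)\<^sup>2)"
  proof (rule Bochner_Integration.integrable_bound)
    show "integrable (lebesgue_on \<Omega>) (\<lambda>x. (v x)\<^sup>2)" using assms(2) by (simp add: L2_def)
    show "AE x in lebesgue_on \<Omega>. norm ((u x)\<^sup>2) \<le> norm ((v x)\<^sup>2)"
      using assms(3) by (auto simp: abs_le_square_iff)
  qed (use assms(1) in measurable)
qed fact

lemma L2_mult_integrable:
  assumes "L2 \<Omega> u" "L2 \<Omega> v"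
  shows "integrable (lebesgue_on \<Omega>) (\<lambda>x. u x * v x)"
proof (rule Bochner_Integration.integrable_bound)
  show "integrable (lebesgue_on \<Omega>) (\<lambda>x. (u x)\<^sup>2 + (v x)\<^sup>2)"
    using assms by (simp add: L2_def)
  show "AE x in lebesgue_on \<Omega>. norm (u x * v x) \<le> norm ((u x)\<^sup>2 + (v x)\<^sup>2)"
  proof (intro AE_I2)
    fix x
    have "2 * \<bar>u x * v x\<bar> \<le> (u x)\<^sup>2 + (v x)\<^sup>2"
      using zero_le_power2[of "\<bar>u x\<bar> - \<bar>v x\<bar>"] by (simp add: power2_diff abs_mult)
    then show "norm (u x * v x) \<le> norm ((u x)\<^sup>2 + (v x)\<^sup>2)" by simp
  qed
qed (use assms in measurable)

lemma L2_zero [simp]: "L2 \<Omega> (\<lambda>x. 0)"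
  by (simp add: L2_def)

lemma L2_scale: "L2 \<Omega> u \<Longrightarrow> L2 \<Omega> (\<lambda>x. c * u x)"
  by (auto simp: L2_def power_mult_distrib)

lemma L2_add:
  assumes "L2 \<Omega> u" "L2 \<Omega> v"
  shows "L2 \<Omega> (\<lambda>x. u x + v x)"
  unfolding L2_def
proof
  show "integrable (lebesgue_on \<Omega>) (\<lambda>x. (u x + v x)\<^sup>2)"
    using assms L2_mult_integrable[OF assms] unfolding power2_sum
    by (auto simp: L2_def mult.assoc)
qed (use assms in measurable)

interpretation L2: semi_inner_space "{u. L2 \<Omega> u}" "L2ip \<Omega>" for \<Omega> :: "(real^'d::finite) set"
proof
  fix u v w :: "real^'d \<Rightarrow> real" and c :: real
  show "L2ip \<Omega> (\<lambda>x. u x + v x) w = L2ip \<Omega> u w + L2ip \<Omega> v w"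
    if "u \<in> {u. L2 \<Omega> u}" "v \<in> {u. L2 \<Omega> u}" "w \<in> {u. L2 \<Omega> u}"
    using that by (simp add: L2ip_def distrib_right L2_mult_integrable)
next
  fix u v :: "real^'d \<Rightarrow> real"
  show "L2ip \<Omega> u v = L2ip \<Omega> v u" by (simp add: L2ip_def mult.commute)
qed (auto simp: L2_add L2_scale L2ip_def mult.assoc)

lemma L2norm_eq_nrm: "L2norm \<Omega> u = L2.nrm \<Omega> u"
  by (simp add: L2norm_def L2.nrm_def L2ip_def power2_eq_square)

lemma L2_diff: "L2 \<Omega> u \<Longrightarrow> L2 \<Omega> v \<Longrightarrow> L2 \<Omega> (\<lambda>x. u x - v x)"
  using L2.diff_closed[of u \<Omega> v] by simp

lemma L2norm_nonneg [simp]: "L2norm \<Omega> u \<ge> 0"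
  by (simp add: L2norm_def integral_nonneg_AE)

lemma L2norm_sq: "(L2norm \<Omega> u)\<^sup>2 = integral\<^sup>L (lebesgue_on \<Omega>) (\<lambda>x. (u x)\<^sup>2)"
  by (simp add: L2norm_def integral_nonneg_AE)

lemma L2_Cauchy_Schwarz: "L2 \<Omega> u \<Longrightarrow> L2 \<Omega> v \<Longrightarrow> \<bar>L2ip \<Omega> u v\<bar> \<le> L2norm \<Omega> u * L2norm \<Omega> v"
  using L2.Cauchy_Schwarz[of u \<Omega> v] by (simp add: L2norm_eq_nrm)

lemma L2norm_triangle: "L2 \<Omega> u \<Longrightarrow> L2 \<Omega> v \<Longrightarrow> L2norm \<Omega> (\<lambda>x. u x + v x) \<le> L2norm \<Omega> u + L2norm \<Omega> v"
  using L2.nrm_triangle[of u \<Omega> v] by (simp add: L2norm_eq_nrm)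

lemma L2norm_scale: "L2norm \<Omega> (\<lambda>x. c * u x) = \<bar>c\<bar> * L2norm \<Omega> u"
  by (simp add: L2norm_def power_mult_distrib real_sqrt_mult)

lemma L2norm_minus_commute: "L2norm \<Omega> (\<lambda>x. u x - v x) = L2norm \<Omega> (\<lambda>x. v x - u x)"
  by (simp add: L2norm_def power2_commute)

lemma L2norm_AE_mono:
  assumes "L2 \<Omega> u" "L2 \<Omega> v" "AE x in lebesgue_on \<Omega>. \<bar>u x\<bar> \<le> \<bar>v x\<bar>"
  shows "L2norm \<Omega> u \<le> L2norm \<Omega> v"
  unfolding L2norm_def
  using assms by (intro real_sqrt_le_mono integral_mono_AE) (auto simp: L2_def abs_le_square_iff)

lemma L2_cong_AE:
  assumes "L2 \<Omega> u" "v \<in> borel_measurable (lebesgue_on \<Omega>)" "AE x in lebesgue_on \<Omega>. u x = v x"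
  shows "L2 \<Omega> v"
  using assms(3) by (intro L2_AE_bound[OF assms(2,1)]) auto

lemma L2norm_cong_AE:
  assumes "L2 \<Omega> u" "L2 \<Omega> v" "AE x in lebesgue_on \<Omega>. u x = v x"
  shows "L2norm \<Omega> u = L2norm \<Omega> v"
  using assms(3) by (intro antisym L2norm_AE_mono assms(1,2)) auto

lemma L2_abs: "L2 \<Omega> u \<Longrightarrow> L2 \<Omega> (\<lambda>x. \<bar>u x\<bar>)"
  by (auto simp: L2_def)

lemma tendsto_L2norm:
  assumes "\<And>n. L2 \<Omega> (s n)" "L2 \<Omega> l" "(\<lambda>n. L2norm \<Omega> (\<lambda>x. s n x - l x)) \<longlonglongrightarrow> 0"
  shows "(\<lambda>n. L2norm \<Omega> (s n)) \<longlonglongrightarrow> L2norm \<Omega> l"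
  using L2.tendsto_nrm[of s \<Omega> l] assms by (simp add: L2norm_eq_nrm)

lemma tendsto_L2ip:
  assumes "\<And>n. L2 \<Omega> (s n)" "L2 \<Omega> l" "(\<lambda>n. L2norm \<Omega> (\<lambda>x. s n x - l x)) \<longlonglongrightarrow> 0" "L2 \<Omega> w"
  shows "(\<lambda>n. L2ip \<Omega> (s n) w) \<longlonglongrightarrow> L2ip \<Omega> l w"
proof (rule Lim_transform_bound[THEN LIM_zero_cancel])
  have "norm (L2ip \<Omega> (s n) w - L2ip \<Omega> l w) \<le> norm (L2norm \<Omega> (\<lambda>x. s n x - l x) * L2norm \<Omega> w)" for n
    using L2_Cauchy_Schwarz[OF L2_diff[OF assms(1)[of n] assms(2)] assms(4)]
      L2.ip_diff[of "s n" \<Omega> l w] assms by simp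
  then show "\<forall>\<^sub>F n in sequentially. norm (L2ip \<Omega> (s n) w - L2ip \<Omega> l w)
      \<le> norm (L2norm \<Omega> (\<lambda>x. s n x - l x) * L2norm \<Omega> w)" by simp
  show "(\<lambda>n. L2norm \<Omega> (\<lambda>x. s n x - l x) * L2norm \<Omega> w) \<longlonglongrightarrow> 0"
    using tendsto_mult_right[OF assms(3), of "L2norm \<Omega> w"] by simp
qed

lemma L2_dominated_convergence:
  assumes "\<And>n. L2 \<Omega> (s n)" "L2 \<Omega> l" "L2 \<Omega> g"
    and bound: "\<And>n. AE x in lebesgue_on \<Omega>. \<bar>s n x - l x\<bar> \<le> \<bar>g x\<bar>"
    and lim: "AE x in lebesgue_on \<Omega>. (\<lambda>n. s n x) \<longlonglongrightarrow> l x"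
  shows "(\<lambda>n. L2norm \<Omega> (\<lambda>x. s n x - l x)) \<longlonglongrightarrow> 0"
proof -
  have "(\<lambda>n. integral\<^sup>L (lebesgue_on \<Omega>) (\<lambda>x. (s n x - l x)\<^sup>2)) \<longlonglongrightarrow> integral\<^sup>L (lebesgue_on \<Omega>) (\<lambda>x. 0)"
  proof (rule integral_dominated_convergence)
    show "integrable (lebesgue_on \<Omega>) (\<lambda>x. (g x)\<^sup>2)" using assms(3) by (simp add: L2_def)
    show "AE x in lebesgue_on \<Omega>. norm ((s n x - l x)\<^sup>2) \<le> (g x)\<^sup>2" for n
      using bound[of n] by (auto simp: abs_le_square_iff)
    show "AE x in lebesgue_on \<Omega>. (\<lambda>n. (s n x - l x)\<^sup>2) \<longlonglongrightarrow> 0"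
      using lim
    proof eventually_elim
      case (elim x)
      then have "(\<lambda>n. (s n x - l x)\<^sup>2) \<longlonglongrightarrow> (l x - l x)\<^sup>2" by (intro tendsto_intros)
      then show ?case by simp
    qed
  qed (use assms in measurable)
  then have "(\<lambda>n. sqrt (integral\<^sup>L (lebesgue_on \<Omega>) (\<lambda>x. (s n x - l x)\<^sup>2))) \<longlonglongrightarrow> sqrt 0"
    by (intro tendsto_intros) simp
  then show ?thesis by (simp add: L2norm_def)
qed

text \<open>The squared differences tend to 0 in L1, which yields a subsequence converging almost
  everywhere.\<close>

lemma L2_AE_subseq:
  assumes "\<And>n. L2 \<Omega> (s n)" "L2 \<Omega> l" "(\<lambda>n. L2norm \<Omega> (\<lambda>x. s n x - l x)) \<longlonglongrightarrow> 0"
  obtains r :: "nat \<Rightarrow> nat" where "strict_mono r" "AE x in lebesgue_on \<Omega>. (\<lambda>n. s (r n) x) \<longlonglongrightarrow> l x"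
proof -
  have "(\<lambda>n. (L2norm \<Omega> (\<lambda>x. s n x - l x))\<^sup>2) \<longlonglongrightarrow> 0\<^sup>2" by (intro tendsto_intros assms)
  then have "(\<lambda>n. integral\<^sup>L (lebesgue_on \<Omega>) (\<lambda>x. norm ((s n x - l x)\<^sup>2))) \<longlonglongrightarrow> 0"
    by (simp add: L2norm_sq)
  moreover have "integrable (lebesgue_on \<Omega>) (\<lambda>x. (s n x - l x)\<^sup>2)" for n
    using L2_diff[OF assms(1)[of n] assms(2)] by (simp add: L2_def)
  ultimately obtain r :: "nat \<Rightarrow> nat" where r: "strict_mono r"
      "AE x in lebesgue_on \<Omega>. (\<lambda>n. (s (r n) x - l x)\<^sup>2) \<longlonglongrightarrow> 0"
    using tendsto_L1_AE_subseq[of "lebesgue_on \<Omega>" "\<lambda>n x. (s n x - l x)\<^sup>2"] by blast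
  have "AE x in lebesgue_on \<Omega>. (\<lambda>n. s (r n) x) \<longlonglongrightarrow> l x"
    using r(2)
  proof eventually_elim
    case (elim x)
    then have "(\<lambda>n. sqrt ((s (r n) x - l x)\<^sup>2)) \<longlonglongrightarrow> sqrt 0" by (intro tendsto_intros)
    then show ?case by (simp add: tendsto_rabs_zero_iff LIM_zero_iff)
  qed
  with r(1) show thesis by (rule that)
qed

lemma L2_const:
  assumes "\<Omega> \<in> lmeasurable"
  shows "L2 \<Omega> (\<lambda>x. c)"
proof -
  interpret finite_measure "lebesgue_on \<Omega>" using assms by (rule finite_measure_lebesgue_on)
  show ?thesis by (simp add: L2_def)
qed

text \<open>On a set of finite measure an L2-Cauchy sequence is L1-Cauchy, which gives a subsequence
  converging almost everywhere. Fatou's lemma shows that the pointwise limit is square integrable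
  and is the L2 limit of the whole sequence.\<close>

lemma L2_complete:
  assumes \<Omega>: "\<Omega> \<in> lmeasurable" and s: "\<And>n. L2 \<Omega> (s n)"
    and Cau: "\<And>e. e > 0 \<Longrightarrow> \<exists>N::nat. \<forall>m\<ge>N. \<forall>n\<ge>N. L2norm \<Omega> (\<lambda>x. s m x - s n x) < e"
  shows "\<exists>l. L2 \<Omega> l \<and> (\<lambda>n. L2norm \<Omega> (\<lambda>x. s n x - l x)) \<longlonglongrightarrow> 0"
proof -
  let ?M = "lebesgue_on \<Omega>"
  note [measurable] = s
  have one: "L2 \<Omega> (\<lambda>x. 1)" by (rule L2_const[OF \<Omega>])
  have int: "integrable ?M (s n)" for n
    using L2_mult_integrable[OF s one] by simp
  have L1: "(LINT x|?M. norm (s i x - s j x)) \<le> L2norm \<Omega> (\<lambda>x. s i x - s j x) * L2norm \<Omega> (\<lambda>x. 1)" for i j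
  proof -
    have "(LINT x|?M. norm (s i x - s j x)) \<le> L2norm \<Omega> (\<lambda>x. \<bar>s i x - s j x\<bar>) * L2norm \<Omega> (\<lambda>x. 1)"
      using L2_Cauchy_Schwarz[OF L2_abs[OF L2_diff[OF s[of i] s[of j]]] one] by (simp add: L2ip_def)
    then show ?thesis by (simp add: L2norm_def)
  qed
  have "\<exists>N. \<forall>i\<ge>N. \<forall>j\<ge>N. (LINT x|?M. norm (s i x - s j x)) < e" if e: "e > 0" for e
  proof -
    have p: "L2norm \<Omega> (\<lambda>x. 1) + 1 > 0" by (simp add: add_nonneg_pos)
    obtain N where N: "\<forall>m\<ge>N. \<forall>n\<ge>N. L2norm \<Omega> (\<lambda>x. s m x - s n x) < e / (L2norm \<Omega> (\<lambda>x. 1) + 1)"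
      using Cau[of "e / (L2norm \<Omega> (\<lambda>x. 1) + 1)"] e p by auto
    have "(LINT x|?M. norm (s i x - s j x)) < e" if "i \<ge> N" "j \<ge> N" for i j
    proof -
      have "L2norm \<Omega> (\<lambda>x. s i x - s j x) * L2norm \<Omega> (\<lambda>x. 1)
          \<le> L2norm \<Omega> (\<lambda>x. s i x - s j x) * (L2norm \<Omega> (\<lambda>x. 1) + 1)"
        by (intro mult_left_mono) auto
      also have "\<dots> < e" using N that p by (simp add: pos_less_divide_eq)
      finally show ?thesis using L1[of i j] by simp
    qed
    then show ?thesis by blast
  qed
  then obtain r where r: "strict_mono r" "AE x in ?M. Cauchy (\<lambda>i. s (r i) x)"
    using cauchy_L1_AE_cauchy_subseq[of ?M s] int by blast
  define l where "l x = lim (\<lambda>i. s (r i) x)" for x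
  have lim: "AE x in ?M. (\<lambda>i. s (r i) x) \<longlonglongrightarrow> l x"
    using r(2) by (auto simp: l_def Cauchy_convergent_iff convergent_LIMSEQ_iff)
  have [measurable]: "l \<in> borel_measurable ?M"
    unfolding l_def by (intro borel_measurable_lim_metric L2_measurable s)
  \<comment> \<open>Fatou along the subsequence \<open>r\<close>, with n held fixed.\<close>
  have fat: "(\<integral>\<^sup>+x. ennreal ((s n x - l x)\<^sup>2) \<partial>?M) \<le> ennreal (e\<^sup>2)"
    if N: "\<forall>m\<ge>N. \<forall>n\<ge>N. L2norm \<Omega> (\<lambda>x. s m x - s n x) < e" and "n \<ge> N" and e: "e > 0" for n N e
  proof -
    have "(\<integral>\<^sup>+x. ennreal ((s n x - l x)\<^sup>2) \<partial>?M)
        = (\<integral>\<^sup>+x. liminf (\<lambda>k. ennreal ((s n x - s (r k) x)\<^sup>2)) \<partial>?M)"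
    proof (rule nn_integral_cong_AE)
      show "AE x in ?M. ennreal ((s n x - l x)\<^sup>2) = liminf (\<lambda>k. ennreal ((s n x - s (r k) x)\<^sup>2))"
        using lim
      proof eventually_elim
        case (elim x)
        then have "(\<lambda>k. ennreal ((s n x - s (r k) x)\<^sup>2)) \<longlonglongrightarrow> ennreal ((s n x - l x)\<^sup>2)"
          by (intro tendsto_intros)
        then show ?case by (rule lim_imp_Liminf[OF trivial_limit_sequentially, symmetric])
      qed
    qed
    also have "\<dots> \<le> liminf (\<lambda>k. \<integral>\<^sup>+x. ennreal ((s n x - s (r k) x)\<^sup>2) \<partial>?M)"
      by (intro nn_integral_liminf) measurable
    also have "\<dots> \<le> liminf (\<lambda>k. ennreal (e\<^sup>2))"
    proof (rule Liminf_mono, rule eventually_sequentiallyI[of N])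
      fix k assume "k \<ge> N"
      then have k: "r k \<ge> N" using seq_suble[OF r(1), of k] by simp
      have "(\<integral>\<^sup>+x. ennreal ((s n x - s (r k) x)\<^sup>2) \<partial>?M) = ennreal ((L2norm \<Omega> (\<lambda>x. s n x - s (r k) x))\<^sup>2)"
        unfolding L2norm_sq using L2_diff[OF s s, of n "r k"]
        by (intro nn_integral_eq_integral) (auto simp: L2_def)
      also have "\<dots> \<le> ennreal (e\<^sup>2)"
        using N k \<open>n \<ge> N\<close> by (intro ennreal_leI power_mono[OF less_imp_le]) auto
      finally show "(\<integral>\<^sup>+x. ennreal ((s n x - s (r k) x)\<^sup>2) \<partial>?M) \<le> ennreal (e\<^sup>2)" .
    qed
    also have "\<dots> = ennreal (e\<^sup>2)" by (simp add: Liminf_const)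
    finally show ?thesis .
  qed
  have sl: "L2 \<Omega> (\<lambda>x. s n x - l x)" if "n \<ge> N" "\<forall>m\<ge>N. \<forall>n\<ge>N. L2norm \<Omega> (\<lambda>x. s m x - s n x) < e" "e > 0" for n N e
    using fat[OF that(2,1,3)] unfolding L2_def
    by (intro conjI integrableI_bounded) (auto simp: less_top[symmetric] top_unique)
  obtain N1 where N1: "\<forall>m\<ge>N1. \<forall>n\<ge>N1. L2norm \<Omega> (\<lambda>x. s m x - s n x) < 1" using Cau[of 1] by auto
  have "L2 \<Omega> (\<lambda>x. s N1 x - (s N1 x - l x))"
    by (intro L2_diff s sl[OF _ N1]) auto
  then have l: "L2 \<Omega> l" by simp
  have "(\<lambda>n. L2norm \<Omega> (\<lambda>x. s n x - l x)) \<longlonglongrightarrow> 0"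
  proof (rule LIMSEQ_I)
    fix e :: real assume e: "e > 0"
    obtain N where N: "\<forall>m\<ge>N. \<forall>n\<ge>N. L2norm \<Omega> (\<lambda>x. s m x - s n x) < e/2" using Cau[of "e/2"] e by auto
    have "L2norm \<Omega> (\<lambda>x. s n x - l x) < e" if "n \<ge> N" for n
    proof -
      have "ennreal ((L2norm \<Omega> (\<lambda>x. s n x - l x))\<^sup>2) = (\<integral>\<^sup>+x. ennreal ((s n x - l x)\<^sup>2) \<partial>?M)"
        unfolding L2norm_sq using L2_diff[OF s l, of n]
        by (intro nn_integral_eq_integral[symmetric]) (auto simp: L2_def)
      also have "\<dots> \<le> ennreal ((e/2)\<^sup>2)" using fat[OF N that] e by simp
      finally have "(L2norm \<Omega> (\<lambda>x. s n x - l x))\<^sup>2 \<le> (e/2)\<^sup>2" by simp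
      then have "L2norm \<Omega> (\<lambda>x. s n x - l x) \<le> e/2" by (rule power2_le_imp_le) (use e in simp)
      then show ?thesis using e by simp
    qed
    then show "\<exists>N. \<forall>n\<ge>N. norm (L2norm \<Omega> (\<lambda>x. s n x - l x) - 0) < e" by auto
  qed
  with l show ?thesis by blast
qed

section \<open>Smooth functions and the fundamental lemma\<close>

lemma partial_eq: "(\<phi> has_derivative D) (at x) \<Longrightarrow> partial i \<phi> x = D (axis i 1)"
  by (simp add: partial_def frechet_derivative_at[symmetric])

lemma smooth_fun_differentiable: "smooth_fun \<phi> \<Longrightarrow> \<phi> differentiable (at x)"
  unfolding smooth_fun_def using foldr.simps(1)[of partial] by (metis id_apply)

lemma smooth_fun_partial:
  assumes "smooth_fun \<phi>"
  shows "smooth_fun (partial i \<phi>)"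
  unfolding smooth_fun_def
proof (intro allI)
  fix "is" x
  have "foldr partial (is @ [i]) \<phi> differentiable (at x)"
    using assms unfolding smooth_fun_def by blast
  then show "foldr partial is (partial i \<phi>) differentiable (at x)" by simp
qed

text \<open>Smoothness quantifies over lists of indices; an invariant set of differentiable
  functions hides the induction over these lists.\<close>

lemma smooth_fun_coinduct:
  assumes "\<phi> \<in> S" "\<And>\<psi> x. \<psi> \<in> S \<Longrightarrow> \<psi> differentiable (at x)" "\<And>\<psi> i. \<psi> \<in> S \<Longrightarrow> partial i \<psi> \<in> S"
  shows "smooth_fun \<phi>"
proof -
  have "foldr partial is \<phi> \<in> S" for "is"
    using assms(1,3) by (induction "is") auto
  then show ?thesis using assms(2) by (auto simp: smooth_fun_def)
qed

text \<open>The algebra generated by \<open>G\<close> and the constants. By the sum and product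
  rules it is invariant under \<open>partial\<close> as soon as the partial derivatives of the
  generators lie in it, so it serves as the invariant set in
  \<open>smooth_fun_coinduct\<close>.\<close>

inductive_set fun_alg :: "('a \<Rightarrow> real) set \<Rightarrow> ('a \<Rightarrow> real) set" for G where
  base: "g \<in> G \<Longrightarrow> g \<in> fun_alg G"
| const: "(\<lambda>x. c) \<in> fun_alg G"
| add: "g \<in> fun_alg G \<Longrightarrow> h \<in> fun_alg G \<Longrightarrow> (\<lambda>x. g x + h x) \<in> fun_alg G"
| mult: "g \<in> fun_alg G \<Longrightarrow> h \<in> fun_alg G \<Longrightarrow> (\<lambda>x. g x * h x) \<in> fun_alg G"

lemma fun_alg_differentiable:
  assumes "\<And>g x. g \<in> G \<Longrightarrow> g differentiable (at x)" "\<phi> \<in> fun_alg G"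
  shows "\<phi> differentiable (at x)"
  using assms(2) by induction (auto intro!: assms(1) differentiable_mult)

lemma smooth_fun_alg:
  assumes diff: "\<And>g x. g \<in> G \<Longrightarrow> g differentiable (at x)"
    and part: "\<And>g i. g \<in> G \<Longrightarrow> partial i g \<in> fun_alg G"
    and "\<phi> \<in> fun_alg G"
  shows "smooth_fun \<phi>"
proof (rule smooth_fun_coinduct[OF assms(3)])
  fix \<psi> assume \<psi>: "\<psi> \<in> fun_alg G"
  show d: "\<psi> differentiable (at x)" for x
    by (rule fun_alg_differentiable[OF diff \<psi>])
  show "partial i \<psi> \<in> fun_alg G" for i
    using \<psi>
  proof induction
    case (base g)
    then show ?case by (rule part)
  next
    case (const c)
    have "partial i (\<lambda>x. c) = (\<lambda>x. 0)" by (auto intro!: ext partial_eq[THEN trans] has_derivative_const)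
    then show ?case by (simp add: fun_alg.const)
  next
    case (add g h)
    have gh: "g differentiable (at x)" "h differentiable (at x)" for x
      using add(1,2) diff by (auto intro: fun_alg_differentiable)
    have "partial i (\<lambda>x. g x + h x) = (\<lambda>x. partial i g x + partial i h x)"
    proof
      fix x
      show "partial i (\<lambda>x. g x + h x) x = partial i g x + partial i h x"
        unfolding partial_eq[OF has_derivative_add[OF frechet_derivative_works[THEN iffD1, OF gh(1)[of x]]
            frechet_derivative_works[THEN iffD1, OF gh(2)[of x]]]]
        by (simp add: partial_def)
    qed
    then show ?case using add by (simp add: fun_alg.add)
  next
    case (mult g h)
    have gh: "g differentiable (at x)" "h differentiable (at x)" for x
      using mult(1,2) diff by (auto intro: fun_alg_differentiable)
    have "partial i (\<lambda>x. g x * h x) = (\<lambda>x. g x * partial i h x + partial i g x * h x)"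
    proof
      fix x
      show "partial i (\<lambda>x. g x * h x) x = g x * partial i h x + partial i g x * h x"
        unfolding partial_eq[OF has_derivative_mult[OF frechet_derivative_works[THEN iffD1, OF gh(1)[of x]]
            frechet_derivative_works[THEN iffD1, OF gh(2)[of x]]]]
        by (simp add: partial_def)
    qed
    then show ?case using mult by (simp add: fun_alg.add fun_alg.mult)
  qed
qed

lemma smooth_fun_in_alg: "\<phi> \<in> fun_alg {g. smooth_fun g} \<Longrightarrow> smooth_fun \<phi>"
  by (rule smooth_fun_alg) (auto intro: fun_alg.base smooth_fun_partial smooth_fun_differentiable)

lemma smooth_fun_const: "smooth_fun (\<lambda>x. c)"
  by (rule smooth_fun_in_alg) (rule fun_alg.const)

lemma smooth_fun_add: "smooth_fun g \<Longrightarrow> smooth_fun h \<Longrightarrow> smooth_fun (\<lambda>x. g x + h x)"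
  by (rule smooth_fun_in_alg) (intro fun_alg.add fun_alg.base CollectI)

lemma smooth_fun_mult: "smooth_fun g \<Longrightarrow> smooth_fun h \<Longrightarrow> smooth_fun (\<lambda>x. g x * h x)"
  by (rule smooth_fun_in_alg) (intro fun_alg.mult fun_alg.base CollectI)

lemma smooth_fun_prod:
  assumes "finite I" "\<And>i. i \<in> I \<Longrightarrow> smooth_fun (g i)"
  shows "smooth_fun (\<lambda>x. \<Prod>i\<in>I. g i x)"
  using assms by (induction I) (auto simp: smooth_fun_const smooth_fun_mult)

lemma partial_compose:
  assumes "(k has_real_derivative k') (at (\<phi> x))" "\<phi> differentiable (at x)"
  shows "(\<lambda>x. k (\<phi> x)) differentiable (at x)" "partial i (\<lambda>x. k (\<phi> x)) x = k' * partial i \<phi> x"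
proof -
  have "((\<lambda>x. k (\<phi> x)) has_derivative (\<lambda>h. k' * frechet_derivative \<phi> (at x) h)) (at x)"
    using has_derivative_compose[OF frechet_derivative_works[THEN iffD1, OF assms(2)]
        assms(1)[unfolded has_field_derivative_def]] by simp
  then show "(\<lambda>x. k (\<phi> x)) differentiable (at x)" "partial i (\<lambda>x. k (\<phi> x)) x = k' * partial i \<phi> x"
    by (auto simp: differentiable_def partial_eq) (simp add: partial_def)
qed

text \<open>A scalar family whose derivatives are polynomials in the family itself is smooth. The
  two instances are \<open>flat_exp\<close> and the pair \<open>soft_trunc\<close>,
  \<open>soft_step\<close>.\<close>

lemma smooth_fun_compose:
  assumes \<phi>: "smooth_fun \<phi>" and "k \<in> K"
    and K: "\<And>k. k \<in> K \<Longrightarrow> \<exists>k'\<in>fun_alg K. \<forall>s. (k has_real_derivative k' s) (at s)"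
  shows "smooth_fun (\<lambda>x. k (\<phi> x))"
proof (rule smooth_fun_alg[where G = "{\<lambda>x. k (\<phi> x) |k. k \<in> K} \<union> {g. smooth_fun g}"])
  let ?G = "{\<lambda>x. k (\<phi> x) |k. k \<in> K} \<union> {g. smooth_fun g}"
  fix g assume g: "g \<in> ?G"
  have comp: "(\<lambda>x. k (\<phi> x)) \<in> fun_alg ?G" if "k \<in> fun_alg K" for k
    using that by induction (auto intro: fun_alg.intros)
  show "g differentiable (at x)" for x
    using g partial_compose(1)[OF _ smooth_fun_differentiable[OF \<phi>]] K smooth_fun_differentiable by blast
  show "partial i g \<in> fun_alg ?G" for i
    using g
  proof
    assume "g \<in> {\<lambda>x. k (\<phi> x) |k. k \<in> K}"
    then obtain k where k: "k \<in> K" "g = (\<lambda>x. k (\<phi> x))" by auto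
    then obtain k' where k': "k' \<in> fun_alg K" "\<And>s. (k has_real_derivative k' s) (at s)"
      using K by blast
    have "partial i g = (\<lambda>x. k' (\<phi> x) * partial i \<phi> x)"
      using partial_compose(2)[OF k'(2) smooth_fun_differentiable[OF \<phi>]] by (auto simp: k(2))
    also have "\<dots> \<in> fun_alg ?G"
      using smooth_fun_partial[OF \<phi>] by (intro fun_alg.mult comp k' fun_alg.base) auto
    finally show ?thesis .
  qed (auto intro: fun_alg.base smooth_fun_partial)
qed (use assms in \<open>auto intro: fun_alg.base\<close>)

lemma smooth_fun_affine_coord: "smooth_fun (\<lambda>x::real^'d::finite. c * x $ j + d)"
proof (rule smooth_fun_alg[where G = "{\<lambda>x. c * x $ j + d}"])
  fix g :: "real^'d \<Rightarrow> real" assume "g \<in> {\<lambda>x. c * x $ j + d}"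
  then have g: "(g has_derivative (\<lambda>h. c * h $ j)) (at x)" for x
    by (auto intro!: derivative_eq_intros bounded_linear.has_derivative[OF bounded_linear_vec_nth])
  show "g differentiable (at x)" for x using g by (auto simp: differentiable_def)
  have "partial i g = (\<lambda>x. c * axis i 1 $ j)" for i using partial_eq[OF g] by auto
  then show "partial i g \<in> fun_alg {\<lambda>x. c * x $ j + d}" for i by (simp add: fun_alg.const)
qed (simp add: fun_alg.base)

text \<open>For n = 0 this is the classical flat function exp (-1/t). The powers of t in the
  denominator make the family closed under differentiation up to linear combinations.\<close>

definition flat_exp :: "nat \<Rightarrow> real \<Rightarrow> real" where
  "flat_exp n t = (if t > 0 then exp (- (1 / t)) / t ^ n else 0)"

lemma tendsto_flat_exp: "(flat_exp n \<longlongrightarrow> 0) (at 0)"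
proof (rule filterlim_split_at)
  have "eventually (\<lambda>t. flat_exp n t = 0) (at_left 0)"
    by (auto simp: eventually_at_filter flat_exp_def)
  then show "(flat_exp n \<longlongrightarrow> 0) (at_left 0)" by (rule tendsto_eventually)
  have "((\<lambda>t. inverse t ^ n / exp (inverse t)) \<longlongrightarrow> (0::real)) (at_right 0)"
    using filterlim_compose[OF tendsto_power_div_exp_0 filterlim_inverse_at_top_right] .
  moreover have "eventually (\<lambda>t. inverse t ^ n / exp (inverse t) = flat_exp n t) (at_right 0)"
    by (auto simp: eventually_at_filter flat_exp_def exp_minus field_simps)
  ultimately show "(flat_exp n \<longlongrightarrow> 0) (at_right 0)" by (rule Lim_transform_eventually)
qed

lemma flat_exp_deriv:
  "(flat_exp n has_real_derivative (- real n * flat_exp (n + 1) t + flat_exp (n + 2) t)) (at t)"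
proof -
  consider "t < 0" | "t = 0" | "t > 0" by linarith
  then show ?thesis
  proof cases
    case 1
    have "((\<lambda>t. 0) has_real_derivative 0) (at t)" by simp
    then have "(flat_exp n has_real_derivative 0) (at t)"
      by (rule has_field_derivative_transform_within_open[of _ _ _ "{..<0}"])
        (use 1 in \<open>auto simp: flat_exp_def\<close>)
    then show ?thesis using 1 by (simp add: flat_exp_def)
  next
    case 2
    \<comment> \<open>The difference quotient of \<open>flat_exp n\<close> at 0 is
      \<open>flat_exp (Suc n)\<close>, which is known to tend to 0.\<close>
    have "((\<lambda>h. (flat_exp n (0 + h) - flat_exp n 0) / h) \<longlongrightarrow> 0) (at 0)"
    proof (rule Lim_transform_eventually[OF tendsto_flat_exp])
      show "eventually (\<lambda>t. flat_exp (Suc n) t = (flat_exp n (0 + t) - flat_exp n 0) / t) (at 0)"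
        by (auto simp: eventually_at_filter flat_exp_def)
    qed
    then show ?thesis using 2 by (simp add: DERIV_def flat_exp_def)
  next
    case 3
    have "((\<lambda>t. exp (- (1 / t)) / t ^ n) has_real_derivative
        (- real n * flat_exp (n + 1) t + flat_exp (n + 2) t)) (at t)"
      using 3 by (auto intro!: derivative_eq_intros simp: flat_exp_def field_simps power2_eq_square)
        (cases n; simp add: field_simps)
    then show ?thesis
      by (rule has_field_derivative_transform_within_open[of _ _ _ "{0<..}"])
        (use 3 in \<open>auto simp: flat_exp_def\<close>)
  qed
qed

lemma smooth_fun_flat_exp:
  assumes "smooth_fun \<phi>"
  shows "smooth_fun (\<lambda>x. flat_exp n (\<phi> x))"
proof (rule smooth_fun_compose[OF assms, of _ "range flat_exp"])
  fix k assume "k \<in> range flat_exp"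
  then obtain m where k: "k = flat_exp m" by auto
  have "(\<lambda>t. - real m * flat_exp (m + 1) t + flat_exp (m + 2) t) \<in> fun_alg (range flat_exp)"
    by (intro fun_alg.add fun_alg.mult fun_alg.const fun_alg.base rangeI)
  then show "\<exists>k'\<in>fun_alg (range flat_exp). \<forall>s. (k has_real_derivative k' s) (at s)"
    using flat_exp_deriv k by (auto intro!: bexI)
qed auto

text \<open>One flat factor for each face of the box. The factor \<open>Suc n\<close> sharpens the
  profile, so that the indicator of the open box appears in the limit; the arguments are written as
  affine functions of a coordinate to suit \<open>smooth_fun_affine_coord\<close>.\<close>

definition box_bump :: "real^'d::finite \<Rightarrow> real^'d \<Rightarrow> nat \<Rightarrow> real^'d \<Rightarrow> real" where
  "box_bump a b n x = (\<Prod>i\<in>UNIV. flat_exp 0 (Suc n * x $ i + - Suc n * a $ i)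
      * flat_exp 0 (- Suc n * x $ i + Suc n * b $ i))"

lemma box_bump_alt:
  "box_bump a b n x = (\<Prod>i\<in>UNIV. flat_exp 0 (Suc n * (x $ i - a $ i)) * flat_exp 0 (Suc n * (b $ i - x $ i)))"
  by (simp add: box_bump_def algebra_simps)

lemma box_bump_nonzero: "box_bump a b n x \<noteq> 0 \<longleftrightarrow> x \<in> box a b"
  by (auto simp: box_bump_alt flat_exp_def mem_box_cart zero_less_mult_iff simp del: of_nat_Suc)

lemma box_bump_bounds: "0 \<le> box_bump a b n x" "box_bump a b n x \<le> 1"
proof -
  have f: "0 \<le> flat_exp 0 t" "flat_exp 0 t \<le> 1" for t by (auto simp: flat_exp_def)
  show "0 \<le> box_bump a b n x" unfolding box_bump_def
    by (intro prod_nonneg mult_nonneg_nonneg f)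
  show "box_bump a b n x \<le> 1" unfolding box_bump_def
    by (intro prod_le_1 conjI mult_nonneg_nonneg mult_le_one f)
qed

lemma tendsto_box_bump: "(\<lambda>n. box_bump a b n x) \<longlonglongrightarrow> indicator (box a b) x"
proof (cases "x \<in> box a b")
  case True
  have lim: "(\<lambda>n. flat_exp 0 (Suc n * t)) \<longlonglongrightarrow> 1" if "t > 0" for t :: real
  proof -
    have "(\<lambda>n. exp (- (1 / t) * (1 / real (Suc n)))) \<longlonglongrightarrow> exp (- (1/t) * 0)"
      by (intro tendsto_intros LIMSEQ_Suc[OF lim_1_over_n])
    moreover have "flat_exp 0 (Suc n * t) = exp (- (1 / t) * (1 / real (Suc n)))" for n
      using that by (simp add: flat_exp_def zero_less_mult_iff del: of_nat_Suc)
    ultimately show ?thesis by simp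
  qed
  have "(\<lambda>n. \<Prod>i\<in>UNIV. flat_exp 0 (Suc n * (x $ i - a $ i)) * flat_exp 0 (Suc n * (b $ i - x $ i)))
      \<longlonglongrightarrow> (\<Prod>i::'a\<in>UNIV. 1 * 1)"
    using True by (intro tendsto_prod tendsto_mult lim) (auto simp: mem_box_cart)
  then show ?thesis using True by (simp add: box_bump_alt)
next
  case False
  then show ?thesis using box_bump_nonzero[of a b _ x] by simp
qed

lemma test_fun_box_bump:
  assumes "cbox a b \<subseteq> \<Omega>"
  shows "test_fun \<Omega> (box_bump a b n)"
proof -
  have sub: "tsupp (box_bump a b n) \<subseteq> cbox a b"
    unfolding tsupp_def by (rule closure_minimal) (use box_bump_nonzero box_subset_cbox in blast)+
  have "compact (tsupp (box_bump a b n))"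
    using compact_Int_closed[OF compact_cbox[of a b], of "tsupp (box_bump a b n)"] sub
    by (simp add: tsupp_def inf.absorb2)
  moreover have "smooth_fun (box_bump a b n)"
    unfolding box_bump_def by (intro smooth_fun_prod smooth_fun_mult smooth_fun_flat_exp
        smooth_fun_affine_coord) auto
  ultimately show ?thesis using sub assms by (auto simp: test_fun_def)
qed

text \<open>Open boxes are stable under intersection and generate the Borel sets, so the vanishing
  of integrals spreads to all Borel sets by induction over the Dynkin system. The total integral is
  needed for complements. The sets f > 0 and f < 0 then finish the proof.\<close>

lemma AE_zero_if_box_integrals_zero:
  fixes f :: "real^'d::finite \<Rightarrow> real"
  assumes int: "integrable lborel f" and tot: "(\<integral>x. f x \<partial>lborel) = 0"
    and box: "\<And>a b. (\<integral>x. indicator (box a b) x * f x \<partial>lborel) = 0"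
  shows "AE x in lborel. f x = 0"
proof -
  have f [measurable]: "f \<in> borel_measurable borel" using int by simp
  have setint: "integrable lborel (\<lambda>x. indicator A x * f x)" if "A \<in> sets borel" for A
    using integrable_mult_indicator[OF _ int, of A] that by simp
  have zero: "(\<integral>x. indicator A x * f x \<partial>lborel) = 0" if "A \<in> sets borel" for A
  proof -
    let ?G = "range (\<lambda>(a, b). box a b :: (real^'d) set)"
    have sb: "sets (borel :: (real^'d) measure) = sigma_sets UNIV ?G"
      by (subst borel_eq_box) simp
    have "Int_stable ?G"
    proof (rule Int_stableI)
      fix A B assume "A \<in> ?G" "B \<in> ?G"
      then obtain a b c d where "A = box a b" "B = box c d" by auto
      then show "A \<inter> B \<in> ?G" by (auto simp: box_Int_box)
    qed
    moreover have "?G \<subseteq> Pow UNIV" by simp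
    moreover have "A \<in> sigma_sets UNIV ?G" using that sb by simp
    ultimately show ?thesis
    proof (induction rule: sigma_sets_induct_disjoint)
      case (compl A)
      then have A: "A \<in> sets borel" using sb by simp
      have "(\<integral>x. indicator (UNIV - A) x * f x \<partial>lborel) = (\<integral>x. f x - indicator A x * f x \<partial>lborel)"
        by (intro Bochner_Integration.integral_cong) (auto simp: indicator_def)
      then show ?case using compl tot int setint[OF A] by simp
    next
      case (union A)
      then have A: "A i \<in> sets borel" for i using sb by (auto simp: image_subset_iff)
      have "(LINT x:(\<Union>i. A i)|lborel. f x) = (\<Sum>i. LINT x:A i|lborel. f x)"
        using A union(1) setint[of "\<Union>i. A i"]
        by (intro lebesgue_integral_countable_add)
          (auto simp: disjoint_family_on_def set_integrable_def)
      then show ?case using union(3) by (simp add: set_lebesgue_integral_def)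
    qed (use box in auto)
  qed
  have m: "{x. f x > 0} \<in> sets borel" "{x. f x < 0} \<in> sets borel" by measurable
  have "AE x in lborel. indicator {x. f x > 0} x * f x = 0"
    by (rule iffD1[OF integral_nonneg_eq_0_iff_AE[OF setint[OF m(1)]] zero[OF m(1)]])
      (auto simp: indicator_def)
  moreover have "AE x in lborel. - (indicator {x. f x < 0} x * f x) = 0"
    using zero[OF m(2)]
    by (intro iffD1[OF integral_nonneg_eq_0_iff_AE[OF integrable_minus[OF setint[OF m(2)]]]])
      (auto simp: indicator_def)
  ultimately show ?thesis by eventually_elim (auto simp: indicator_def split: if_splits)
qed

text \<open>The indicators of the boxes whose closures lie in \<open>\<Omega>\<close> are bounded pointwise limits of test functions.\<close>

lemma fundamental_lemma:
  assumes \<Omega>: "open \<Omega>" and g: "integrable (lebesgue_on \<Omega>) g"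
    and zero: "\<And>\<phi>. test_fun \<Omega> \<phi> \<Longrightarrow> (\<integral>x. g x * \<phi> x \<partial>lebesgue_on \<Omega>) = 0"
  shows "AE x in lebesgue_on \<Omega>. g x = 0"
proof -
  let ?M = "lebesgue_on \<Omega>"
  have \<Omega>m: "\<Omega> \<in> sets lebesgue" using \<Omega> by auto
  have box0: "(\<integral>x. g x * indicator (box a b) x \<partial>?M) = 0" if "cbox a b \<subseteq> \<Omega>" for a b
  proof -
    have smooth: "continuous_on UNIV (box_bump a b n)" for n
      using test_fun_box_bump[OF that, of n] smooth_fun_differentiable
      by (auto simp: test_fun_def intro!: continuous_at_imp_continuous_on differentiable_imp_continuous_within)
    have [measurable]: "box_bump a b n \<in> borel_measurable ?M" for n
      using continuous_imp_measurable_on_sets_lebesgue[OF continuous_on_subset[OF smooth] \<Omega>m] by simp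
    have [measurable]: "box a b \<in> sets lebesgue" by simp
    have bx[measurable]: "indicator (box a b) \<in> borel_measurable ?M"
      by (intro measurable_restrict_space1) measurable
    have "(\<lambda>n. \<integral>x. g x * box_bump a b n x \<partial>?M) \<longlonglongrightarrow> (\<integral>x. g x * indicator (box a b) x \<partial>?M)"
    proof (rule integral_dominated_convergence)
      show "integrable ?M (\<lambda>x. norm (g x))" using g by simp
      show "AE x in ?M. norm (g x * box_bump a b n x) \<le> norm (g x)" for n
        using box_bump_bounds[of a b n] by (auto intro!: AE_I2 mult_left_le simp: abs_mult)
      show "AE x in ?M. (\<lambda>n. g x * box_bump a b n x) \<longlonglongrightarrow> g x * indicator (box a b) x"
        by (intro AE_I2 tendsto_intros tendsto_box_bump)
    qed (use g bx in measurable)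
    then show ?thesis using zero[OF test_fun_box_bump[OF that]] by (simp add: LIMSEQ_const_iff)
  qed
  have local: "AE x in lebesgue. x \<in> box a b \<longrightarrow> g x = 0" if ab: "cbox a b \<subseteq> \<Omega>" for a b
  proof -
    let ?h = "\<lambda>x. indicator (box a b) x * (indicator \<Omega> x * g x)"
    have ig: "integrable lebesgue (\<lambda>x. indicator \<Omega> x * g x)"
      using g integrable_restrict_space[of \<Omega> lebesgue g] \<Omega>m by simp
    have ih: "integrable lebesgue ?h"
      using integrable_mult_indicator[OF _ ig, of "box a b"] by simp
    \<comment> \<open>The box criterion lives on \<open>lborel\<close>, so the Lebesgue measurable
      function is exchanged for a Borel function that agrees with it almost everywhere.\<close>
    obtain h where h [measurable]: "h \<in> borel_measurable lborel" and AEh: "AE x in lborel. ?h x = h x"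
      using completion_ex_borel_measurable_real[OF borel_measurable_integrable[OF ih]] by auto
    have AEc: "AE x in lebesgue. ?h x = h x" using AEh by (rule AE_completion)
    have hm: "h \<in> borel_measurable lebesgue" using h by (rule measurable_completion)
    have "integrable lebesgue h"
      using integrable_cong_AE[OF borel_measurable_integrable[OF ih] hm AEc] ih by simp
    then have inth: "integrable lborel h" by (simp add: integrable_completion)
    have boxh: "(\<integral>x. indicator (box c d) x * h x \<partial>lborel) = 0" if "box c d \<inter> box a b = box p q" "cbox p q \<subseteq> \<Omega>" for c d p q
    proof -
      have "(\<integral>x. indicator (box c d) x * h x \<partial>lborel) = (\<integral>x. indicator (box c d) x * h x \<partial>lebesgue)"
        by (rule integral_completion[symmetric]) measurable
      also have "\<dots> = (\<integral>x. indicator (box c d) x * ?h x \<partial>lebesgue)"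
      proof (rule integral_cong_AE)
        have ind: "indicat_real (box c d) \<in> borel_measurable lebesgue"
          by (rule measurable_completion) measurable
        show "(\<lambda>x. indicator (box c d) x * ?h x) \<in> borel_measurable lebesgue"
          by (rule borel_measurable_times[OF ind borel_measurable_integrable[OF ih]])
        show "(\<lambda>x. indicator (box c d) x * h x) \<in> borel_measurable lebesgue"
          by (rule borel_measurable_times[OF ind hm])
      qed (use AEc in auto)
      also have "\<dots> = (\<integral>x. indicator \<Omega> x *\<^sub>R (g x * indicator (box p q) x) \<partial>lebesgue)"
        unfolding that(1)[symmetric]
        by (intro Bochner_Integration.integral_cong) (auto simp: indicator_def)
      also have "\<dots> = (\<integral>x. g x * indicator (box p q) x \<partial>?M)"
        using \<Omega>m by (intro integral_restrict_space[symmetric]) simp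
      finally show ?thesis using box0[OF that(2)] by simp
    qed
    have "AE x in lborel. h x = 0"
    proof (rule AE_zero_if_box_integrals_zero[OF inth])
      have "(\<integral>x. h x \<partial>lborel) = (\<integral>x. indicator (box a b) x * h x \<partial>lborel)"
        using AEh by (intro integral_cong_AE) (auto simp: indicator_def)
      then show "(\<integral>x. h x \<partial>lborel) = 0" using boxh[of a b a b] ab by simp
      fix c d :: "real^'a"
      \<comment> \<open>Only boxes contained in the given one are controlled; cutting an arbitrary
        box down to it gives such a box, given here by its corners.\<close>
      let ?p = "\<chi> i. max (c $ i) (a $ i)" and ?q = "\<chi> i. min (d $ i) (b $ i)"
      have "box c d \<inter> box a b = box ?p ?q" by (auto simp: mem_box_cart)
      moreover have "cbox ?p ?q \<subseteq> cbox a b" by (auto simp: mem_box_cart)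
      ultimately show "(\<integral>x. indicator (box c d) x * h x \<partial>lborel) = 0" using ab by (intro boxh[where p = ?p and q = ?q]) auto
    qed
    then have "AE x in lebesgue. h x = 0" by (rule AE_completion)
    with AEc show ?thesis
    proof eventually_elim
      case (elim x)
      then show ?case using ab box_subset_cbox by (auto simp: indicator_def split: if_splits)
    qed
  qed
  \<comment> \<open>The open set is a countable union of closed boxes, and the boundary of each of
    them is a null set, so the local statements on open boxes add up.\<close>
  obtain D where D: "countable D" "D \<subseteq> Pow \<Omega>" "\<And>X. X \<in> D \<Longrightarrow> \<exists>a b. X = cbox a b" "\<Union>D = \<Omega>"
    using open_countable_Union_open_cbox[OF \<Omega>] by metis
  have "AE x in lebesgue. x \<in> X \<longrightarrow> g x = 0" if XD: "X \<in> D" for X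
  proof -
    obtain a b where X: "X = cbox a b" "cbox a b \<subseteq> \<Omega>" using D(2) D(3)[OF XD] XD by blast
    have "AE x in lebesgue. x \<notin> cbox a b - box a b"
      using negligible_frontier_interval by (intro AE_not_in) (simp add: negligible_iff_null_sets)
    with local[OF X(2)] show ?thesis unfolding X(1) by eventually_elim auto
  qed
  then have "AE x in lebesgue. \<forall>X\<in>D. x \<in> X \<longrightarrow> g x = 0"
    by (subst AE_ball_countable[OF D(1)]) blast
  then have "AE x in lebesgue. x \<in> \<Omega> \<longrightarrow> g x = 0"
    by (rule AE_mp) (use D(4) in auto)
  then show ?thesis using \<Omega>m by (subst AE_restrict_space_iff) auto
qed

section \<open>Test functions and translations\<close>

definition tgrad :: "(real^'d::finite \<Rightarrow> real) \<Rightarrow> real^'d \<Rightarrow> real^'d" where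
  "tgrad \<phi> x = (\<chi> i. partial i \<phi> x)"

lemma smooth_fun_has_derivative:
  assumes "smooth_fun \<phi>"
  shows "(\<phi> has_derivative (\<lambda>h. tgrad \<phi> x \<bullet> h)) (at x)"
proof -
  let ?D = "frechet_derivative \<phi> (at x)"
  have D: "(\<phi> has_derivative ?D) (at x)"
    using smooth_fun_differentiable[OF assms] by (rule frechet_derivative_works[THEN iffD1])
  interpret D: bounded_linear ?D using D by (rule has_derivative_bounded_linear)
  have "?D h = tgrad \<phi> x \<bullet> h" for h
  proof -
    have "?D h = ?D (\<Sum>i\<in>UNIV. (h $ i) *\<^sub>R axis i 1)"
      using basis_expansion[of h] by (simp add: scalar_mult_eq_scaleR)
    also have "\<dots> = (\<Sum>i\<in>UNIV. h $ i * partial i \<phi> x)"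
      by (simp add: D.sum D.scaleR partial_def)
    finally show ?thesis by (simp add: inner_vec_def tgrad_def mult.commute)
  qed
  then have "?D = (\<lambda>h. tgrad \<phi> x \<bullet> h)" by (rule ext)
  with D show ?thesis by simp
qed

lemma smooth_fun_continuous: "smooth_fun \<phi> \<Longrightarrow> continuous_on UNIV \<phi>"
  using smooth_fun_differentiable
  by (auto intro!: continuous_at_imp_continuous_on differentiable_imp_continuous_within)

lemma smooth_fun_borel: "smooth_fun \<phi> \<Longrightarrow> \<phi> \<in> borel_measurable borel"
  using smooth_fun_continuous by (rule borel_measurable_continuous_onI)

lemma continuous_tgrad: "smooth_fun \<phi> \<Longrightarrow> continuous_on UNIV (tgrad \<phi>)"
  unfolding tgrad_def by (intro continuous_on_vec_lambda smooth_fun_continuous smooth_fun_partial)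

lemma borel_tgrad: "smooth_fun \<phi> \<Longrightarrow> tgrad \<phi> \<in> borel_measurable borel"
  using continuous_tgrad by (rule borel_measurable_continuous_onI)

lemma test_fun_smooth: "test_fun \<Omega> \<phi> \<Longrightarrow> smooth_fun \<phi>"
  by (simp add: test_fun_def)

lemma not_in_tsupp: "x \<notin> tsupp \<phi> \<Longrightarrow> \<phi> x = 0"
  using closure_subset[of "{x. \<phi> x \<noteq> 0}"] by (auto simp: tsupp_def)

lemma test_fun_outside: "test_fun \<Omega> \<phi> \<Longrightarrow> x \<notin> \<Omega> \<Longrightarrow> \<phi> x = 0"
  using not_in_tsupp by (auto simp: test_fun_def)

lemma test_fun_tsupp_subset:
  assumes "test_fun \<Omega> \<phi>" "smooth_fun \<psi>" "\<And>x. x \<notin> tsupp \<phi> \<Longrightarrow> \<psi> x = 0"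
  shows "test_fun \<Omega> \<psi>"
proof -
  have sub: "tsupp \<psi> \<subseteq> tsupp \<phi>"
    unfolding tsupp_def[of \<psi>] by (rule closure_minimal) (use assms(3) in \<open>auto simp: tsupp_def\<close>)
  have "compact (tsupp \<psi>)"
    using compact_Int_closed[of "tsupp \<phi>" "tsupp \<psi>"] sub assms(1)
    by (simp add: test_fun_def inf.absorb2) (simp add: tsupp_def)
  then show ?thesis using sub assms(1,2) by (auto simp: test_fun_def)
qed

lemma test_fun_mult: "test_fun \<Omega> \<phi> \<Longrightarrow> smooth_fun \<psi> \<Longrightarrow> test_fun \<Omega> (\<lambda>x. \<phi> x * \<psi> x)"
  by (rule test_fun_tsupp_subset) (auto intro: smooth_fun_mult test_fun_smooth simp: not_in_tsupp)

lemma test_fun_partial: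
  assumes "test_fun \<Omega> \<phi>"
  shows "test_fun \<Omega> (partial i \<phi>)"
proof (rule test_fun_tsupp_subset[OF assms])
  show "smooth_fun (partial i \<phi>)" using assms by (simp add: smooth_fun_partial test_fun_smooth)
  fix x assume x: "x \<notin> tsupp \<phi>"
  have "((\<lambda>x. 0) has_derivative (\<lambda>h. 0)) (at x)" by simp
  moreover have "open (- tsupp \<phi>)" by (simp add: tsupp_def open_Compl)
  ultimately have "(\<phi> has_derivative (\<lambda>h. 0)) (at x)"
    by (rule has_derivative_transform_within_open) (use x in \<open>simp_all add: not_in_tsupp\<close>)
  then show "partial i \<phi> x = 0" by (simp add: partial_eq)
qed

lemma test_fun_tgrad_outside: "test_fun \<Omega> \<phi> \<Longrightarrow> x \<notin> \<Omega> \<Longrightarrow> tgrad \<phi> x = 0"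
  by (simp add: tgrad_def vec_eq_iff test_fun_outside[OF test_fun_partial])

lemma test_fun_bounded_support:
  assumes "test_fun \<Omega> \<phi>"
  obtains R where "R > 0" "\<And>x. norm x \<ge> R \<Longrightarrow> \<phi> x = 0" "\<And>x. norm x \<ge> R \<Longrightarrow> tgrad \<phi> x = 0"
proof -
  have "bounded (tsupp \<phi>)" using assms by (simp add: test_fun_def compact_imp_bounded)
  then obtain R where R: "R > 0" "\<And>x. x \<in> tsupp \<phi> \<Longrightarrow> norm x < R"
    by (auto simp: bounded_pos_less)
  have t: "test_fun (tsupp \<phi>) \<phi>" using assms by (simp add: test_fun_def)
  have "x \<notin> tsupp \<phi>" if "norm x \<ge> R" for x using R(2)[of x] that by force
  with test_fun_outside[OF t] test_fun_tgrad_outside[OF t] R(1) show thesis by (intro that) auto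
qed

lemma test_fun_tgrad_bounded:
  assumes "test_fun \<Omega> \<phi>"
  obtains B where "B \<ge> 0" "\<And>x. norm (tgrad \<phi> x) \<le> B"
proof -
  obtain R where R: "\<And>x. norm x \<ge> R \<Longrightarrow> tgrad \<phi> x = 0" "R > 0"
    using test_fun_bounded_support[OF assms] by metis
  have "compact (tgrad \<phi> ` cball 0 R)"
    using continuous_on_subset[OF continuous_tgrad[OF test_fun_smooth[OF assms]]]
    by (intro compact_continuous_image) auto
  then obtain B where B: "B > 0" "\<And>x. norm x \<le> R \<Longrightarrow> norm (tgrad \<phi> x) \<le> B"
    using compact_imp_bounded bounded_pos by (metis imageI mem_cball_0)
  show thesis
    by (rule that[of B]) (use B R(1) in \<open>auto, metis linear norm_zero less_imp_le\<close>)
qed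

lemma test_fun_Lipschitz:
  assumes "test_fun \<Omega> \<phi>" "\<And>x. norm (tgrad \<phi> x) \<le> B"
  shows "\<bar>\<phi> x - \<phi> y\<bar> \<le> B * norm (x - y)"
proof -
  have "norm (\<phi> x - \<phi> y) \<le> B * norm (x - y)"
  proof (rule differentiable_bound[of UNIV \<phi> "\<lambda>x h. tgrad \<phi> x \<bullet> h"])
    show "onorm (\<lambda>h. tgrad \<phi> x \<bullet> h) \<le> B" for x
    proof (rule onorm_le)
      fix h
      have "\<bar>tgrad \<phi> x \<bullet> h\<bar> \<le> norm (tgrad \<phi> x) * norm h" by (rule Cauchy_Schwarz_ineq2)
      also have "\<dots> \<le> B * norm h" using assms(2) by (intro mult_right_mono) auto
      finally show "norm (tgrad \<phi> x \<bullet> h) \<le> B * norm h" by simp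
    qed
  qed (use smooth_fun_has_derivative[OF test_fun_smooth[OF assms(1)]] in \<open>auto simp: has_derivative_at_withinI\<close>)
  then show ?thesis by simp
qed

lemma integrable_indicator_cball: "integrable lborel (\<lambda>x::real^'d::finite. c * indicator (cball 0 R) x :: real)"
  by (intro integrable_mult_right integrable_real_indicator emeasure_lborel_cball_finite) auto

text \<open>A dominating function that is uniform in n: the Lipschitz constant times |y| on the ball
  of radius R + |y|. Outside that ball both the point and its translate miss the support.\<close>

lemma diff_quotient_bound:
  assumes "test_fun \<Omega> \<phi>"
  obtains B R where "\<And>n x. \<bar>real (Suc n) * (\<phi> (x + y /\<^sub>R real (Suc n)) - \<phi> x)\<bar> \<le> B * indicator (cball 0 R) x"
    "B \<ge> 0"
proof -
  obtain R where R: "R > 0" "\<And>x. norm x \<ge> R \<Longrightarrow> \<phi> x = 0"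
    using test_fun_bounded_support[OF assms] by metis
  obtain B where B: "B \<ge> 0" "\<And>x. norm (tgrad \<phi> x) \<le> B" using test_fun_tgrad_bounded[OF assms] by metis
  show thesis
  proof (rule that)
    fix n x
    have small: "norm (y /\<^sub>R real (Suc n)) \<le> norm y"
      by (simp add: field_simps)
    show "\<bar>real (Suc n) * (\<phi> (x + y /\<^sub>R real (Suc n)) - \<phi> x)\<bar>
        \<le> (B * norm y) * indicator (cball 0 (R + norm y)) x"
    proof (cases "norm x \<le> R + norm y")
      case True
      have "\<bar>\<phi> (x + y /\<^sub>R real (Suc n)) - \<phi> x\<bar> \<le> B * norm (y /\<^sub>R real (Suc n))"
        using test_fun_Lipschitz[OF assms B(2), of "x + y /\<^sub>R real (Suc n)" x] by simp
      also have "\<dots> = B * norm y / real (Suc n)" by (simp add: field_simps)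
      finally have "real (Suc n) * \<bar>\<phi> (x + y /\<^sub>R real (Suc n)) - \<phi> x\<bar> \<le> B * norm y"
        by (simp add: pos_le_divide_eq mult.commute del: of_nat_Suc)
      then show ?thesis using True by (simp add: abs_mult del: of_nat_Suc)
    next
      case False
      have "norm x \<le> norm (x + y /\<^sub>R real (Suc n)) + norm (y /\<^sub>R real (Suc n))"
        using norm_triangle_ineq4[of "x + y /\<^sub>R real (Suc n)" "y /\<^sub>R real (Suc n)"] by simp
      then have "norm (x + y /\<^sub>R real (Suc n)) \<ge> R" using False small by linarith
      moreover have "norm x \<ge> R" using False norm_ge_zero[of y] by linarith
      ultimately show ?thesis using R(2) False by simp
    qed
    show "B * norm y \<ge> 0" using B by simp
  qed
qed

lemma tendsto_diff_quotient:
  assumes "smooth_fun \<phi>"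
  shows "(\<lambda>n. real (Suc n) * (\<phi> (x + y /\<^sub>R real (Suc n)) - \<phi> x)) \<longlonglongrightarrow> tgrad \<phi> x \<bullet> y"
proof -
  have "((\<lambda>t. \<phi> (x + t *\<^sub>R y)) has_derivative (\<lambda>t. tgrad \<phi> (x + 0 *\<^sub>R y) \<bullet> (t *\<^sub>R y))) (at 0)"
    by (rule has_derivative_compose[OF _ smooth_fun_has_derivative[OF assms], where f = "\<lambda>t. x + t *\<^sub>R y"])
      (auto intro!: derivative_eq_intros)
  then have "((\<lambda>t. \<phi> (x + t *\<^sub>R y)) has_real_derivative (tgrad \<phi> x \<bullet> y)) (at 0)"
    by (simp add: has_field_derivative_def mult.commute[of _ "tgrad \<phi> x \<bullet> y"] mult_commute_abs)
  then have "((\<lambda>t. (\<phi> (x + t *\<^sub>R y) - \<phi> x) / t) \<longlongrightarrow> tgrad \<phi> x \<bullet> y) (at 0)"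
    by (simp add: DERIV_def)
  moreover have "filterlim (\<lambda>n. inverse (real (Suc n))) (at 0) sequentially"
    by (intro filterlim_atI LIMSEQ_inverse_real_of_nat) auto
  ultimately have "(\<lambda>n. (\<phi> (x + inverse (real (Suc n)) *\<^sub>R y) - \<phi> x) / inverse (real (Suc n))) \<longlonglongrightarrow> tgrad \<phi> x \<bullet> y"
    by (rule filterlim_compose)
  then show ?thesis by (simp add: divide_inverse mult.commute del: of_nat_Suc)
qed

section \<open>Translation of integrals and of test functions\<close>

lemma lborel_integral_translate:
  fixes f :: "real^'d::finite \<Rightarrow> real"
  assumes [measurable]: "f \<in> borel_measurable borel"
  shows "(\<integral>x. f (x + c) \<partial>lborel) = (\<integral>x. f x \<partial>lborel)"
proof -
  have "(\<integral>x. f x \<partial>lborel) = (\<integral>x. f x \<partial>distr lborel borel ((+) c))" by (simp add: lborel_distr_plus)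
  also have "\<dots> = (\<integral>x. f (c + x) \<partial>lborel)" by (rule integral_distr) auto
  finally show ?thesis by (simp add: add.commute)
qed

lemma lborel_nn_integral_translate:
  fixes f :: "real^'d::finite \<Rightarrow> ennreal"
  assumes [measurable]: "f \<in> borel_measurable borel"
  shows "(\<integral>\<^sup>+x. f (x + c) \<partial>lborel) = (\<integral>\<^sup>+x. f x \<partial>lborel)"
proof -
  have "(\<integral>\<^sup>+x. f x \<partial>lborel) = (\<integral>\<^sup>+x. f x \<partial>distr lborel borel ((+) c))" by (simp add: lborel_distr_plus)
  also have "\<dots> = (\<integral>\<^sup>+x. f (c + x) \<partial>lborel)" by (rule nn_integral_distr) auto
  finally show ?thesis by (simp add: add.commute)
qed

lemma test_fun_integrable:
  assumes "test_fun \<Omega> \<phi>"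
  shows "integrable lborel \<phi>"
proof -
  have "integrable lborel (\<lambda>x. if x \<in> tsupp \<phi> then \<phi> x else 0)"
    unfolding indicator_scaleR_eq_if[symmetric]
    by (rule borel_integrable_compact) (use assms in \<open>auto simp: test_fun_def intro: continuous_on_subset[OF smooth_fun_continuous]\<close>)
  moreover have "(\<lambda>x. if x \<in> tsupp \<phi> then \<phi> x else 0) = \<phi>" by (auto simp: not_in_tsupp)
  ultimately show ?thesis by simp
qed

lemma integral_lebesgue_on_eq_lborel:
  fixes f :: "real^'d::finite \<Rightarrow> real"
  assumes "\<Omega> \<in> sets lebesgue" "f \<in> borel_measurable borel" "\<And>x. x \<notin> \<Omega> \<Longrightarrow> f x = 0"
  shows "(\<integral>x. f x \<partial>lebesgue_on \<Omega>) = (\<integral>x. f x \<partial>lborel)"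
    and "integrable (lebesgue_on \<Omega>) f \<longleftrightarrow> integrable lborel f"
proof -
  have eq: "(\<lambda>x. indicator \<Omega> x *\<^sub>R f x) = f" using assms(3) by (auto simp: fun_eq_iff indicator_def)
  show "(\<integral>x. f x \<partial>lebesgue_on \<Omega>) = (\<integral>x. f x \<partial>lborel)"
    using assms by (simp add: integral_restrict_space eq[unfolded real_scaleR_def] integral_completion)
  show "integrable (lebesgue_on \<Omega>) f \<longleftrightarrow> integrable lborel f"
    using assms by (simp add: integrable_restrict_space eq[unfolded real_scaleR_def] integrable_completion)
qed

lemma borel_measurable_lebesgue_on:
  assumes "f \<in> borel_measurable borel"
  shows "f \<in> borel_measurable (lebesgue_on \<Omega>)"
  using assms by (intro measurable_restrict_space1 measurable_completion) simp

lemma L2_UNIV_I: "f \<in> borel_measurable borel \<Longrightarrow> integrable lborel (\<lambda>x. (f x)\<^sup>2) \<Longrightarrow> L2 UNIV f"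
  by (auto simp: L2_def lebesgue_on_UNIV_eq integrable_completion intro: measurable_completion)

lemma L2norm_outside:
  assumes "\<Omega> \<in> sets lebesgue" "f \<in> borel_measurable borel" "\<And>x. x \<notin> \<Omega> \<Longrightarrow> f x = 0"
  shows "L2norm \<Omega> f = L2norm UNIV f"
  using integral_lebesgue_on_eq_lborel(1)[OF assms(1), of "\<lambda>x. (f x)\<^sup>2"]
    integral_lebesgue_on_eq_lborel(1)[of UNIV "\<lambda>x. (f x)\<^sup>2"] assms
  by (simp add: L2norm_def)

lemma test_fun_L2:
  assumes "test_fun \<Omega> \<phi>" "\<Omega>' \<in> sets lebesgue" "\<Omega> \<subseteq> \<Omega>'"
  shows "L2 \<Omega>' \<phi>"
proof -
  have "integrable lborel (\<lambda>x. \<phi> x * \<phi> x)"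
    using test_fun_mult[OF assms(1) test_fun_smooth[OF assms(1)]] by (rule test_fun_integrable)
  then show ?thesis
    unfolding L2_def using assms test_fun_outside[OF assms(1)] smooth_fun_borel[OF test_fun_smooth[OF assms(1)]]
    by (subst integral_lebesgue_on_eq_lborel(2)) (auto simp: power2_eq_square intro: borel_measurable_lebesgue_on)
qed

text \<open>Every difference quotient integrates to 0 by translation invariance, and dominated
  convergence passes this to the derivative.\<close>

lemma integral_partial_test_fun:
  fixes \<phi> :: "real^'a::finite \<Rightarrow> real"
  assumes "test_fun \<Omega> \<phi>"
  shows "(\<integral>x. partial i \<phi> x \<partial>lborel) = 0"
proof -
  let ?q = "\<lambda>n x. real (Suc n) * (\<phi> (x + axis i 1 /\<^sub>R real (Suc n)) - \<phi> x)"
  have sm: "smooth_fun \<phi>" using assms by (rule test_fun_smooth)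
  note [measurable] = smooth_fun_borel[OF sm] smooth_fun_borel[OF smooth_fun_partial[OF sm]]
  obtain B R where BR: "\<And>n x. \<bar>?q n x\<bar> \<le> B * indicator (cball 0 R) x"
    using diff_quotient_bound[OF assms, of "axis i 1"] by metis
  have "(\<lambda>n. \<integral>x. ?q n x \<partial>lborel) \<longlonglongrightarrow> (\<integral>x. partial i \<phi> x \<partial>lborel)"
  proof (rule integral_dominated_convergence)
    show "integrable lborel (\<lambda>x::real^'a. B * indicator (cball 0 R) x :: real)"
      by (rule integrable_indicator_cball)
    show "AE x in lborel. (\<lambda>n. ?q n x) \<longlonglongrightarrow> partial i \<phi> x"
      using tendsto_diff_quotient[OF sm, of _ "axis i 1"]
      by (intro AE_I2) (simp add: tgrad_def inner_axis)
    show "AE x in lborel. norm (?q n x) \<le> B * indicator (cball 0 R) x" for n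
      using BR by (intro AE_I2) simp
  qed measurable
  moreover have "(\<integral>x. ?q n x \<partial>lborel) = 0" for n
  proof -
    have i1: "integrable lborel \<phi>" using assms by (rule test_fun_integrable)
    have i2: "integrable lborel (\<lambda>x. \<phi> (x + c))" for c
      using integrable_distr[of "(+) c" lborel borel \<phi>] i1 by (simp add: lborel_distr_plus add.commute)
    show ?thesis using i1 i2 lborel_integral_translate[of \<phi>] by simp
  qed
  ultimately show ?thesis by (simp add: LIMSEQ_const_iff)
qed

text \<open>Integration by parts: the integral of the derivative of the product of two test
  functions vanishes.\<close>

lemma weak_partial_test_fun:
  assumes "\<Omega> \<in> sets lebesgue" "test_fun \<Omega> \<phi>"
  shows "weak_partial \<Omega> i \<phi> (partial i \<phi>)"
  unfolding weak_partial_def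
proof (intro allI impI)
  fix \<psi> assume \<psi>: "test_fun \<Omega> \<psi>"
  have sm: "smooth_fun \<phi>" "smooth_fun \<psi>" using assms(2) \<psi> test_fun_smooth by auto
  note sp = smooth_fun_partial[OF sm(1), of i] smooth_fun_partial[OF sm(2), of i]
  have t1: "test_fun \<Omega> (\<lambda>x. \<phi> x * partial i \<psi> x)" using assms(2) sp(2) by (rule test_fun_mult)
  have t2: "test_fun \<Omega> (\<lambda>x. partial i \<phi> x * \<psi> x)" using test_fun_partial[OF assms(2)] sm(2) by (rule test_fun_mult)
  have "partial i (\<lambda>x. \<phi> x * \<psi> x) x = \<phi> x * partial i \<psi> x + partial i \<phi> x * \<psi> x" for x
    unfolding partial_eq[OF has_derivative_mult[OF smooth_fun_has_derivative[OF sm(1)] smooth_fun_has_derivative[OF sm(2)]]]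
    by (simp add: tgrad_def inner_axis)
  then have "0 = (\<integral>x. \<phi> x * partial i \<psi> x + partial i \<phi> x * \<psi> x \<partial>lborel)"
    using integral_partial_test_fun[OF test_fun_mult[OF assms(2) sm(2)], of i] by simp
  also have "\<dots> = (\<integral>x. \<phi> x * partial i \<psi> x \<partial>lborel) + (\<integral>x. partial i \<phi> x * \<psi> x \<partial>lborel)"
    using test_fun_integrable[OF t1] test_fun_integrable[OF t2] by simp
  also have "\<dots> = (\<integral>x. \<phi> x * partial i \<psi> x \<partial>lebesgue_on \<Omega>) + (\<integral>x. partial i \<phi> x * \<psi> x \<partial>lebesgue_on \<Omega>)"
    using test_fun_outside[OF t1] test_fun_outside[OF t2] smooth_fun_borel[OF test_fun_smooth[OF t1]]
      smooth_fun_borel[OF test_fun_smooth[OF t2]] assms(1)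
    by (simp add: integral_lebesgue_on_eq_lborel(1))
  finally show "(\<integral>x. \<phi> x * partial i \<psi> x \<partial>lebesgue_on \<Omega>) = - (\<integral>x. partial i \<phi> x * \<psi> x \<partial>lebesgue_on \<Omega>)"
    by simp
qed

lemma test_fun_L2_translate:
  assumes "test_fun \<Omega> \<phi>"
  shows "L2 UNIV (\<lambda>x. \<phi> (x + c))"
proof -
  have [measurable]: "\<phi> \<in> borel_measurable borel"
    using assms by (intro smooth_fun_borel test_fun_smooth)
  have "integrable lborel (\<lambda>x. (\<phi> x)\<^sup>2)"
    using test_fun_integrable[OF test_fun_mult[OF assms test_fun_smooth[OF assms]]] by (simp add: power2_eq_square)
  then have "integrable lborel (\<lambda>x. (\<phi> (x + c))\<^sup>2)"
    using integrable_distr[of "(+) c" lborel borel "\<lambda>x. (\<phi> x)\<^sup>2"]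
    by (simp add: lborel_distr_plus add.commute)
  then show ?thesis by (intro L2_UNIV_I) auto
qed

lemma test_fun_L2_tgrad:
  fixes \<phi> :: "real^'a::finite \<Rightarrow> real"
  assumes "test_fun \<Omega> \<phi>"
  shows "L2 UNIV (\<lambda>x. norm (tgrad \<phi> x))"
proof -
  note [measurable] = borel_tgrad[OF test_fun_smooth[OF assms]]
  obtain R' where R': "\<And>x. norm x \<ge> R' \<Longrightarrow> tgrad \<phi> x = 0"
    using test_fun_bounded_support[OF assms] by metis
  obtain B' where B': "B' \<ge> 0" "\<And>x. norm (tgrad \<phi> x) \<le> B'" using test_fun_tgrad_bounded[OF assms] by metis
  have "integrable lborel (\<lambda>x. (norm (tgrad \<phi> x))\<^sup>2)"
  proof (rule Bochner_Integration.integrable_bound)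
      show "integrable lborel (\<lambda>x::real^'a. B'\<^sup>2 * indicator (cball 0 R') x :: real)"
      by (rule integrable_indicator_cball)
    show "AE x in lborel. norm ((norm (tgrad \<phi> x))\<^sup>2) \<le> norm (B'\<^sup>2 * indicator (cball 0 R') x)"
      using R' B' by (auto intro!: AE_I2 power_mono simp: indicator_def)
  qed measurable
  then show ?thesis using borel_tgrad[OF test_fun_smooth[OF assms]] by (intro L2_UNIV_I) auto
qed

text \<open>Telescoping over \<open>n\<close> translations by \<open>y/n\<close> bounds the left-hand side by the norm of a
  difference quotient, which converges to the directional derivative.\<close>

lemma translation_estimate:
  fixes \<phi> :: "real^'a::finite \<Rightarrow> real"
  assumes "test_fun \<Omega> \<phi>"
  shows "L2norm UNIV (\<lambda>x. \<phi> (x + y) - \<phi> x) \<le> norm y * L2norm UNIV (\<lambda>x. norm (tgrad \<phi> x))"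
proof -
  let ?q = "\<lambda>n x. real (Suc n) * (\<phi> (x + y /\<^sub>R real (Suc n)) - \<phi> x)"
  have sm: "smooth_fun \<phi>" using assms by (rule test_fun_smooth)
  note [measurable] = smooth_fun_borel[OF sm] borel_tgrad[OF sm]
  have L2\<phi>: "L2 UNIV \<phi>" by (rule test_fun_L2[OF assms]) auto
  have norm_tr: "L2norm UNIV (\<lambda>x. f (x + c)) = L2norm UNIV f" if "f \<in> borel_measurable borel" for f and c :: "real^'a"
    using lborel_integral_translate[of "\<lambda>x. (f x)\<^sup>2" c] that
    by (simp add: L2norm_def lebesgue_on_UNIV_eq integral_completion)
  note L2_tr = test_fun_L2_translate[OF assms]
  have tele: "L2norm UNIV (\<lambda>x. \<phi> (x + real k *\<^sub>R z) - \<phi> x) \<le> real k * L2norm UNIV (\<lambda>x. \<phi> (x + z) - \<phi> x)" for k z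
  proof (induction k)
    case 0
    then show ?case by (simp add: L2norm_def)
  next
    case (Suc k)
    have "L2norm UNIV (\<lambda>x. \<phi> (x + real (Suc k) *\<^sub>R z) - \<phi> x)
        = L2norm UNIV (\<lambda>x. (\<phi> ((x + real k *\<^sub>R z) + z) - \<phi> (x + real k *\<^sub>R z)) + (\<phi> (x + real k *\<^sub>R z) - \<phi> x))"
      by (simp add: algebra_simps)
    also have "\<dots> \<le> L2norm UNIV (\<lambda>x. \<phi> ((x + real k *\<^sub>R z) + z) - \<phi> (x + real k *\<^sub>R z))
        + L2norm UNIV (\<lambda>x. \<phi> (x + real k *\<^sub>R z) - \<phi> x)"
      using L2_tr[of "real k *\<^sub>R z + z"] by (intro L2norm_triangle L2_diff L2_tr L2\<phi>) (simp add: add.assoc)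
    also have "L2norm UNIV (\<lambda>x. \<phi> ((x + real k *\<^sub>R z) + z) - \<phi> (x + real k *\<^sub>R z))
        = L2norm UNIV (\<lambda>x. \<phi> (x + z) - \<phi> x)"
      by (rule norm_tr) measurable
    finally show ?case using Suc by (simp add: algebra_simps)
  qed
  have L2q: "L2 UNIV (?q n)" for n by (intro L2_scale L2_diff L2_tr L2\<phi>)
  have bnd: "L2norm UNIV (\<lambda>x. \<phi> (x + y) - \<phi> x) \<le> L2norm UNIV (?q n)" for n
    using tele[of "Suc n" "y /\<^sub>R real (Suc n)"] by (simp add: L2norm_scale del: of_nat_Suc)
  obtain B R where BR: "\<And>n x. \<bar>?q n x\<bar> \<le> B * indicator (cball 0 R) x" "B \<ge> 0"
    using diff_quotient_bound[OF assms, of y] by metis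
  have "L2 UNIV (\<lambda>x. \<Sum>i\<in>UNIV. y $ i * partial i \<phi> x)"
  proof -
    have "L2 UNIV (\<lambda>x. \<Sum>i\<in>I. y $ i * partial i \<phi> x)" if "finite I" for I
      using that by (induction I) (auto intro!: L2_add L2_scale test_fun_L2[OF test_fun_partial[OF assms]])
    then show ?thesis by simp
  qed
  moreover have gy: "(\<lambda>x. \<Sum>i\<in>UNIV. y $ i * partial i \<phi> x) = (\<lambda>x. tgrad \<phi> x \<bullet> y)"
    by (simp add: inner_vec_def tgrad_def mult.commute)
  ultimately have L2gy: "L2 UNIV (\<lambda>x. tgrad \<phi> x \<bullet> y)" by simp
  note L2g = test_fun_L2_tgrad[OF assms]
  have lim: "(\<lambda>n. L2norm UNIV (\<lambda>x. ?q n x - tgrad \<phi> x \<bullet> y)) \<longlonglongrightarrow> 0"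
  proof (rule L2_dominated_convergence[OF L2q L2gy])
    have ptw: "(\<lambda>n. ?q n x) \<longlonglongrightarrow> tgrad \<phi> x \<bullet> y" for x by (rule tendsto_diff_quotient[OF sm])
    \<comment> \<open>The limit inherits the bound of the quotients, so twice that bound dominates
      the difference.\<close>
    have gb: "\<bar>tgrad \<phi> x \<bullet> y\<bar> \<le> B * indicator (cball 0 R) x" for x
      by (rule LIMSEQ_le_const2[OF tendsto_rabs[OF ptw]]) (use BR in auto)
    have "integrable lborel (\<lambda>x::real^'a. (2 * B)\<^sup>2 * indicator (cball 0 R) x :: real)"
      by (rule integrable_indicator_cball)
    moreover have "(\<lambda>x::real^'a. (2 * B * indicator (cball 0 R) x)\<^sup>2) = (\<lambda>x. (2 * B)\<^sup>2 * indicator (cball 0 R) x)"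
      by (auto simp: indicator_def)
    ultimately have int: "integrable lborel (\<lambda>x::real^'a. (2 * B * indicator (cball 0 R) x)\<^sup>2)"
      by (simp only:)
    show "L2 UNIV (\<lambda>x::real^'a. 2 * B * indicator (cball 0 R) x)"
      by (rule L2_UNIV_I[OF _ int])
        (intro borel_measurable_times borel_measurable_const borel_measurable_indicator, simp)
    show "AE x in lebesgue_on UNIV. \<bar>?q n x - tgrad \<phi> x \<bullet> y\<bar> \<le> \<bar>2 * B * indicator (cball 0 R) x\<bar>" for n
    proof (rule AE_I2)
      fix x
      have "\<bar>?q n x - tgrad \<phi> x \<bullet> y\<bar> \<le> \<bar>?q n x\<bar> + \<bar>tgrad \<phi> x \<bullet> y\<bar>" by (rule abs_triangle_ineq4)
      also have "\<dots> \<le> B * indicator (cball 0 R) x + B * indicator (cball 0 R) x"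
        by (intro add_mono BR gb)
      finally show "\<bar>?q n x - tgrad \<phi> x \<bullet> y\<bar> \<le> \<bar>2 * B * indicator (cball 0 R) x\<bar>" by simp
    qed
    show "AE x in lebesgue_on UNIV. (\<lambda>n. ?q n x) \<longlonglongrightarrow> tgrad \<phi> x \<bullet> y" using ptw by simp
  qed
  have "L2norm UNIV (\<lambda>x. \<phi> (x + y) - \<phi> x) \<le> L2norm UNIV (\<lambda>x. tgrad \<phi> x \<bullet> y)"
    using tendsto_L2norm[OF L2q L2gy lim] by (rule LIMSEQ_le_const) (use bnd in auto)
  also have "\<dots> \<le> L2norm UNIV (\<lambda>x. norm y * norm (tgrad \<phi> x))"
    using Cauchy_Schwarz_ineq2[of "tgrad \<phi> _" y]
    by (intro L2norm_AE_mono L2gy L2_scale L2g AE_I2) (simp add: mult.commute)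
  also have "\<dots> = norm y * L2norm UNIV (\<lambda>x. norm (tgrad \<phi> x))" by (simp add: L2norm_scale)
  finally show ?thesis .
qed

section \<open>Poincare and small-set inequalities\<close>

lemma L2_UNIV_restrict:
  assumes "\<Omega> \<in> sets lebesgue" "L2 UNIV f"
  shows "L2 \<Omega> f" "L2norm \<Omega> f \<le> L2norm UNIV f"
proof -
  have int: "integrable lebesgue (\<lambda>x. (f x)\<^sup>2)" and m: "f \<in> borel_measurable lebesgue"
    using assms(2) by (auto simp: L2_def lebesgue_on_UNIV_eq)
  have int': "integrable lebesgue (\<lambda>x. indicator \<Omega> x *\<^sub>R (f x)\<^sup>2)"
    by (rule integrable_mult_indicator[OF assms(1) int])
  show "L2 \<Omega> f"
    unfolding L2_def using assms(1) m int' by (simp add: integrable_restrict_space measurable_restrict_space1)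
  have "(\<integral>x. indicator \<Omega> x *\<^sub>R (f x)\<^sup>2 \<partial>lebesgue) \<le> (\<integral>x. (f x)\<^sup>2 \<partial>lebesgue)"
    by (rule integral_mono[OF int' int]) (auto simp: indicator_def)
  then show "L2norm \<Omega> f \<le> L2norm UNIV f"
    using assms(1) by (simp add: L2norm_def integral_restrict_space lebesgue_on_UNIV_eq)
qed

lemma test_fun_tgrad_L2norm:
  assumes "test_fun \<Omega> \<phi>" "\<Omega> \<in> sets lebesgue"
  shows "L2norm UNIV (\<lambda>x. norm (tgrad \<phi> x)) = L2norm \<Omega> (\<lambda>x. norm (tgrad \<phi> x))"
  using borel_tgrad[OF test_fun_smooth[OF assms(1)]] test_fun_tgrad_outside[OF assms(1)]
  by (intro L2norm_outside[symmetric] assms(2)) auto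

text \<open>Translation by a vector of length 2R carries the domain off itself. On the domain
  \<open>\<phi>\<close> is therefore minus the difference between its translate and itself, and
  \<open>translation_estimate\<close> gives the constant 2R.\<close>

lemma Poincare_test_fun:
  assumes "bounded \<Omega>" "\<Omega> \<in> sets lebesgue"
  shows "\<exists>P>0. \<forall>\<phi>. test_fun \<Omega> \<phi> \<longrightarrow> L2norm \<Omega> \<phi> \<le> P * L2norm \<Omega> (\<lambda>x. norm (tgrad \<phi> x))"
proof -
  obtain R where R: "R > 0" "\<And>x. x \<in> \<Omega> \<Longrightarrow> norm x < R"
    using assms(1) by (auto simp: bounded_pos_less)
  \<comment> \<open>Any coordinate direction will do; \<open>undefined\<close> just names one
    index.\<close>
  let ?y = "(2 * R) *\<^sub>R axis undefined 1 :: real^'a"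
  have ny: "norm ?y = 2 * R" using R(1) by (simp add: norm_axis_1)
  have out: "x + ?y \<notin> \<Omega>" if "x \<in> \<Omega>" for x
  proof
    assume "x + ?y \<in> \<Omega>"
    moreover have "norm ?y \<le> norm (x + ?y) + norm x"
      using norm_triangle_ineq4[of "x + ?y" x] by simp
    ultimately show False using R(2)[OF that] R(2)[of "x + ?y"] ny by linarith
  qed
  have "L2norm \<Omega> \<phi> \<le> (2 * R) * L2norm \<Omega> (\<lambda>x. norm (tgrad \<phi> x))" if \<phi>: "test_fun \<Omega> \<phi>" for \<phi>
  proof -
    have "L2norm \<Omega> \<phi> = L2norm \<Omega> (\<lambda>x. \<phi> (x + ?y) - \<phi> x)"
      unfolding L2norm_def using out test_fun_outside[OF \<phi>]
      by (intro arg_cong[of _ _ sqrt] Bochner_Integration.integral_cong) auto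
    also have "\<dots> \<le> L2norm UNIV (\<lambda>x. \<phi> (x + ?y) - \<phi> x)"
      by (rule L2_UNIV_restrict(2)[OF assms(2) L2_diff[OF test_fun_L2_translate[OF \<phi>] test_fun_L2[OF \<phi>]]]) auto
    also have "\<dots> \<le> norm ?y * L2norm \<Omega> (\<lambda>x. norm (tgrad \<phi> x))"
      using translation_estimate[OF \<phi>, of ?y] by (simp only: test_fun_tgrad_L2norm[OF \<phi> assms(2)])
    finally show ?thesis unfolding ny .
  qed
  then show ?thesis using R(1) by (intro exI[of _ "2 * R"]) auto
qed

text \<open>Averaging \<open>\<phi>(x)\<^sup>2 \<le> 2 (\<phi>(x + y) - \<phi>(x))\<^sup>2 + 2 \<phi>(x + y)\<^sup>2\<close> over \<open>y\<close> in a small ball and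
  integrating over \<open>x \<in> E\<close>.\<close>

lemma averaging_estimate:
  fixes \<phi> :: "real^'d::finite \<Rightarrow> real"
  assumes \<phi>: "test_fun \<Omega> \<phi>" and E: "E \<in> sets borel" "emeasure lborel E = ennreal \<epsilon>" "\<epsilon> \<ge> 0" and r: "r > 0"
  shows "(\<integral>x. indicator E x * (\<phi> x)\<^sup>2 \<partial>lborel)
    \<le> 2 * r\<^sup>2 * (L2norm UNIV (\<lambda>x. norm (tgrad \<phi> x)))\<^sup>2
      + 2 * \<epsilon> / measure lborel (ball (0::real^'d) r) * (L2norm UNIV \<phi>)\<^sup>2"
proof -
  let ?B = "ball (0::real^'d) r"
  let ?m = "measure lborel ?B"
  let ?G = "L2norm UNIV (\<lambda>x. norm (tgrad \<phi> x))"
  let ?I = "\<integral>x. indicator E x * (\<phi> x)\<^sup>2 \<partial>lborel"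
  have ball [measurable]: "?B \<in> sets borel" by simp
  note [measurable] = smooth_fun_borel[OF test_fun_smooth[OF \<phi>]] E(1)
  have mB: "emeasure lborel ?B = ennreal ?m"
    by (rule emeasure_eq_ennreal_measure) (use emeasure_lborel_ball_finite[of "0::real^'d" r] in auto)
  have mpos: "?m > 0" using r by (simp add: content_ball_pos)
  have sq: "integrable lborel (\<lambda>x. (\<phi> x)\<^sup>2)"
    using test_fun_integrable[OF test_fun_mult[OF \<phi> test_fun_smooth[OF \<phi>]]] by (simp add: power2_eq_square)
  have nsq: "(L2norm UNIV f)\<^sup>2 = (\<integral>x. (f x)\<^sup>2 \<partial>lborel)" if "f \<in> borel_measurable borel" for f :: "real^'d \<Rightarrow> real"
    using that unfolding L2norm_sq by (simp add: lebesgue_on_UNIV_eq integral_completion)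
  have Eint: "integrable lborel (\<lambda>x. indicator E x * (\<phi> x)\<^sup>2)"
    using integrable_mult_indicator[OF _ sq, of E] by simp
  have "ennreal (?I * ?m) = (\<integral>\<^sup>+x. ennreal (indicator E x * (\<phi> x)\<^sup>2) \<partial>lborel) * emeasure lborel ?B"
    using nn_integral_eq_integral[OF Eint] mB by (simp add: ennreal_mult' integral_nonneg_AE)
  also have "\<dots> = (\<integral>\<^sup>+x. \<integral>\<^sup>+y. ennreal (indicator E x * (\<phi> x)\<^sup>2) * indicator ?B y \<partial>lborel \<partial>lborel)"
    by (subst nn_integral_cmult_indicator) (simp_all add: nn_integral_multc)
  \<comment> \<open>In the second term the indicator of the ball is dropped: the integral over all y
    is the full squared norm of \<open>\<phi>\<close>, and the x-integral contributes only the
    measure of E. In the first term the indicator of E is dropped instead.\<close>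
  also have "\<dots> \<le> (\<integral>\<^sup>+x. \<integral>\<^sup>+y. ennreal (2 * (\<phi> (x + y) - \<phi> x)\<^sup>2) * indicator ?B y
      + 2 * ennreal (indicator E x) * ennreal ((\<phi> (y + x))\<^sup>2) \<partial>lborel \<partial>lborel)"
  proof (intro nn_integral_mono)
    fix x y
    have "(\<phi> x)\<^sup>2 \<le> 2 * (\<phi> (x + y) - \<phi> x)\<^sup>2 + 2 * (\<phi> (y + x))\<^sup>2"
      \<comment> \<open>The right-hand side minus the left-hand side is exactly this square.\<close>
      using zero_le_power2[of "2 * \<phi> (x + y) - \<phi> x"] by (simp add: power2_eq_square algebra_simps)
    then have "ennreal ((\<phi> x)\<^sup>2) \<le> ennreal (2 * (\<phi> (x + y) - \<phi> x)\<^sup>2 + 2 * (\<phi> (y + x))\<^sup>2)"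
      by (rule ennreal_leI)
    also have "\<dots> = ennreal (2 * (\<phi> (x + y) - \<phi> x)\<^sup>2) + 2 * ennreal ((\<phi> (y + x))\<^sup>2)"
      by (subst ennreal_plus) (simp_all add: ennreal_mult')
    finally have "ennreal ((\<phi> x)\<^sup>2) \<le> ennreal (2 * (\<phi> (x + y) - \<phi> x)\<^sup>2) + 2 * ennreal ((\<phi> (y + x))\<^sup>2)" .
    then show "ennreal (indicator E x * (\<phi> x)\<^sup>2) * indicator ?B y \<le>
        ennreal (2 * (\<phi> (x + y) - \<phi> x)\<^sup>2) * indicator ?B y + 2 * ennreal (indicator E x) * ennreal ((\<phi> (y + x))\<^sup>2)"
      by (auto simp: indicator_def)
  qed
  also have "\<dots> = (\<integral>\<^sup>+x. \<integral>\<^sup>+y. ennreal (2 * (\<phi> (x + y) - \<phi> x)\<^sup>2) * indicator ?B y \<partial>lborel \<partial>lborel)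
      + (\<integral>\<^sup>+x. \<integral>\<^sup>+y. 2 * ennreal (indicator E x) * ennreal ((\<phi> (y + x))\<^sup>2) \<partial>lborel \<partial>lborel)"
  proof -
    have inner: "(\<integral>\<^sup>+y. ennreal (2 * (\<phi> (x + y) - \<phi> x)\<^sup>2) * indicator ?B y
        + 2 * ennreal (indicator E x) * ennreal ((\<phi> (y + x))\<^sup>2) \<partial>lborel)
      = (\<integral>\<^sup>+y. ennreal (2 * (\<phi> (x + y) - \<phi> x)\<^sup>2) * indicator ?B y \<partial>lborel)
        + (\<integral>\<^sup>+y. 2 * ennreal (indicator E x) * ennreal ((\<phi> (y + x))\<^sup>2) \<partial>lborel)" for x
      by (rule nn_integral_add) measurable
    show ?thesis unfolding inner by (rule nn_integral_add) measurable
  qed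
  also have "(\<integral>\<^sup>+x. \<integral>\<^sup>+y. 2 * ennreal (indicator E x) * ennreal ((\<phi> (y + x))\<^sup>2) \<partial>lborel \<partial>lborel)
      = ennreal (2 * \<epsilon> * (L2norm UNIV \<phi>)\<^sup>2)"
  proof -
    have "(\<integral>\<^sup>+y. ennreal ((\<phi> (y + x))\<^sup>2) \<partial>lborel) = ennreal ((L2norm UNIV \<phi>)\<^sup>2)" for x
      using lborel_nn_integral_translate[of "\<lambda>x. ennreal ((\<phi> x)\<^sup>2)" x] nn_integral_eq_integral[OF sq]
      by (simp add: nsq)
    then have "(\<integral>\<^sup>+y. 2 * ennreal (indicator E x) * ennreal ((\<phi> (y + x))\<^sup>2) \<partial>lborel)
        = ennreal (2 * (L2norm UNIV \<phi>)\<^sup>2) * indicator E x" for x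
      by (subst nn_integral_cmult) (measurable, cases "x \<in> E", simp_all add: ennreal_mult')
    then have "(\<integral>\<^sup>+x. \<integral>\<^sup>+y. 2 * ennreal (indicator E x) * ennreal ((\<phi> (y + x))\<^sup>2) \<partial>lborel \<partial>lborel)
        = (\<integral>\<^sup>+x. ennreal (2 * (L2norm UNIV \<phi>)\<^sup>2) * indicator E x \<partial>lborel)"
      by simp
    also have "\<dots> = ennreal (2 * \<epsilon> * (L2norm UNIV \<phi>)\<^sup>2)"
      using E by (subst nn_integral_cmult_indicator) (simp_all add: ennreal_mult''[symmetric] mult_ac)
    finally show ?thesis .
  qed
  \<comment> \<open>Exchanging the order makes the inner integral the squared norm of a translation
    difference with y fixed, which \<open>translation_estimate\<close> controls for |y| < r.\<close>
  also have "(\<integral>\<^sup>+x. \<integral>\<^sup>+y. ennreal (2 * (\<phi> (x + y) - \<phi> x)\<^sup>2) * indicator ?B y \<partial>lborel \<partial>lborel)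
      = (\<integral>\<^sup>+y. \<integral>\<^sup>+x. ennreal (2 * (\<phi> (x + y) - \<phi> x)\<^sup>2) * indicator ?B y \<partial>lborel \<partial>lborel)"
    by (rule lborel_pair.Fubini'[symmetric]) measurable
  also have "\<dots> \<le> (\<integral>\<^sup>+y. ennreal (2 * (r\<^sup>2 * ?G\<^sup>2)) * indicator ?B y \<partial>lborel)"
  proof (intro nn_integral_mono)
    fix y
    have L2y: "L2 UNIV (\<lambda>x. \<phi> (x + y) - \<phi> x)"
      by (intro L2_diff test_fun_L2_translate[OF \<phi>] test_fun_L2[OF \<phi>]) auto
    then have int: "integrable lborel (\<lambda>x. (\<phi> (x + y) - \<phi> x)\<^sup>2)"
      by (simp add: L2_def lebesgue_on_UNIV_eq integrable_completion)
    have "(\<integral>\<^sup>+x. ennreal (2 * (\<phi> (x + y) - \<phi> x)\<^sup>2) \<partial>lborel) \<le> ennreal (2 * (r\<^sup>2 * ?G\<^sup>2))" if "norm y < r"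
    proof -
      have "(\<integral>\<^sup>+x. ennreal (2 * (\<phi> (x + y) - \<phi> x)\<^sup>2) \<partial>lborel) = ennreal (2 * (L2norm UNIV (\<lambda>x. \<phi> (x + y) - \<phi> x))\<^sup>2)"
        using nn_integral_eq_integral[of lborel "\<lambda>x. 2 * (\<phi> (x + y) - \<phi> x)\<^sup>2"] int by (simp add: nsq)
      also have "L2norm UNIV (\<lambda>x. \<phi> (x + y) - \<phi> x) \<le> r * ?G"
        using translation_estimate[OF \<phi>, of y] mult_right_mono[of "norm y" r ?G] that by simp
      then have "ennreal (2 * (L2norm UNIV (\<lambda>x. \<phi> (x + y) - \<phi> x))\<^sup>2) \<le> ennreal (2 * (r\<^sup>2 * ?G\<^sup>2))"
        by (intro ennreal_leI mult_left_mono) (auto simp: power_mult_distrib[symmetric] intro!: power_mono)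
      finally show ?thesis .
    qed
    then show "(\<integral>\<^sup>+x. ennreal (2 * (\<phi> (x + y) - \<phi> x)\<^sup>2) * indicator ?B y \<partial>lborel) \<le> ennreal (2 * (r\<^sup>2 * ?G\<^sup>2)) * indicator ?B y"
      by (auto simp: indicator_def)
  qed
  also have "(\<integral>\<^sup>+y. ennreal (2 * (r\<^sup>2 * ?G\<^sup>2)) * indicator ?B y \<partial>lborel) = ennreal (2 * (r\<^sup>2 * ?G\<^sup>2) * ?m)"
    using mB by (simp add: nn_integral_cmult_indicator ennreal_mult'')
  finally have "ennreal (?I * ?m) \<le> ennreal (2 * (r\<^sup>2 * ?G\<^sup>2) * ?m + 2 * \<epsilon> * (L2norm UNIV \<phi>)\<^sup>2)"
    using E(3) by (simp add: ennreal_plus add_right_mono)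
  then have "?I * ?m \<le> 2 * (r\<^sup>2 * ?G\<^sup>2) * ?m + 2 * \<epsilon> * (L2norm UNIV \<phi>)\<^sup>2"
    using E(3) by (subst (asm) ennreal_le_iff) auto
  then show ?thesis using mpos by (simp add: field_simps)
qed

text \<open>The averaging estimate has a gradient term governed by the radius r and a term in the
  norm of \<open>\<phi>\<close> governed by the measure of E. Poincare turns the second into a
  gradient term; fixing r first and the measure afterwards makes both small.\<close>

lemma small_support_test_fun:
  fixes \<Omega> :: "(real^'d::finite) set"
  assumes bd: "bounded \<Omega>" and \<Omega>: "\<Omega> \<in> sets lebesgue" and \<delta>: "\<delta> > 0"
  shows "\<exists>\<epsilon>>0. \<forall>\<phi> E. test_fun \<Omega> \<phi> \<longrightarrow> E \<in> sets lebesgue \<longrightarrow> emeasure lebesgue E \<le> ennreal \<epsilon> \<longrightarrow>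
    L2norm \<Omega> (\<lambda>x. indicator E x * \<phi> x) \<le> \<delta> * L2norm \<Omega> (\<lambda>x. norm (tgrad \<phi> x))"
proof -
  obtain P where P: "P > 0" "\<And>\<phi>. test_fun \<Omega> \<phi> \<Longrightarrow> L2norm \<Omega> \<phi> \<le> P * L2norm \<Omega> (\<lambda>x. norm (tgrad \<phi> x))"
    using Poincare_test_fun[OF bd \<Omega>] by blast
  \<comment> \<open>Balanced choices: 2 r^2 = \<delta>^2 / 2, and the \<epsilon> below makes 2
    \<epsilon> P^2 / m = \<delta>^2 / 2, so the two terms add up to \<delta>^2.\<close>
  define r where "r = \<delta> / 2"
  define m where "m = measure lborel (ball (0::real^'d) r)"
  have r: "r > 0" using \<delta> by (simp add: r_def)
  have m: "m > 0" using r by (simp add: m_def content_ball_pos)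
  define \<epsilon> where "\<epsilon> = \<delta>\<^sup>2 * m / (4 * P\<^sup>2)"
  have \<epsilon>: "\<epsilon> > 0" using \<delta> m P(1) by (simp add: \<epsilon>_def)
  have "L2norm \<Omega> (\<lambda>x. indicator E x * \<phi> x) \<le> \<delta> * L2norm \<Omega> (\<lambda>x. norm (tgrad \<phi> x))"
    if \<phi>: "test_fun \<Omega> \<phi>" and E: "E \<in> sets lebesgue" "emeasure lebesgue E \<le> ennreal \<epsilon>" for \<phi> E
  proof -
    let ?G = "L2norm \<Omega> (\<lambda>x. norm (tgrad \<phi> x))"
    note [measurable] = smooth_fun_borel[OF test_fun_smooth[OF \<phi>]]
    have \<phi>m: "\<phi> \<in> borel_measurable (lebesgue_on \<Omega>)" by (rule borel_measurable_lebesgue_on) measurable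
    \<comment> \<open>The averaging estimate needs a Borel set; a Borel superset of the same measure
      only enlarges the left-hand side.\<close>
    obtain E' where E': "E \<subseteq> E'" "E' \<in> sets lborel" "emeasure lebesgue E = emeasure lborel E'"
      using completion_upper[OF E(1)] by metis
    have [measurable]: "E' \<in> sets borel" using E'(2) by simp
    define e where "e = measure lborel E'"
    have fin: "emeasure lborel E' \<le> ennreal \<epsilon>" using E(2) E'(3) by simp
    then have e: "emeasure lborel E' = ennreal e"
      unfolding e_def by (intro emeasure_eq_ennreal_measure) (auto simp: top_unique)
    have e0: "e \<ge> 0" by (simp add: e_def)
    have e\<epsilon>: "e \<le> \<epsilon>" using fin \<epsilon> unfolding e by (simp add: ennreal_le_iff)
    have L2\<phi>: "L2 \<Omega> \<phi>" by (rule test_fun_L2[OF \<phi> \<Omega>]) simp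
    have Em: "indicat_real E \<in> borel_measurable (lebesgue_on \<Omega>)"
      using E(1) by (intro measurable_restrict_space1 borel_measurable_indicator)
    have Em': "indicat_real E' \<in> borel_measurable (lebesgue_on \<Omega>)"
      by (rule borel_measurable_lebesgue_on) measurable
    have "L2norm \<Omega> (\<lambda>x. indicator E x * \<phi> x) \<le> L2norm \<Omega> (\<lambda>x. indicator E' x * \<phi> x)"
      using E'(1) by (intro L2norm_AE_mono L2_AE_bound[OF borel_measurable_times[OF Em \<phi>m] L2\<phi>]
          L2_AE_bound[OF borel_measurable_times[OF Em' \<phi>m] L2\<phi>] AE_I2) (auto simp: indicator_def)
    also have "L2norm \<Omega> (\<lambda>x. indicator E' x * \<phi> x) \<le> \<delta> * ?G"
    proof (rule power2_le_imp_le)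
      have "(L2norm \<Omega> (\<lambda>x. indicator E' x * \<phi> x))\<^sup>2 = (\<integral>x. indicator E' x * (\<phi> x)\<^sup>2 \<partial>lebesgue_on \<Omega>)"
        unfolding L2norm_sq by (intro Bochner_Integration.integral_cong) (auto simp: indicator_def)
      also have "\<dots> = (\<integral>x. indicator E' x * (\<phi> x)\<^sup>2 \<partial>lborel)"
        using test_fun_outside[OF \<phi>] by (intro integral_lebesgue_on_eq_lborel(1) \<Omega>) auto
      also have "\<dots> \<le> 2 * r\<^sup>2 * ?G\<^sup>2 + 2 * e / m * (L2norm \<Omega> \<phi>)\<^sup>2"
        using averaging_estimate[OF \<phi> _ e e0 r] test_fun_tgrad_L2norm[OF \<phi> \<Omega>]
          L2norm_outside[OF \<Omega>, of \<phi>] test_fun_outside[OF \<phi>] by (simp add: m_def)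
      also have "2 * e / m * (L2norm \<Omega> \<phi>)\<^sup>2 \<le> 2 * \<epsilon> / m * (P * ?G)\<^sup>2"
        using e\<epsilon> e0 \<epsilon> m P(2)[OF \<phi>] by (intro mult_mono divide_right_mono power_mono) auto
      also have "2 * r\<^sup>2 * ?G\<^sup>2 + 2 * \<epsilon> / m * (P * ?G)\<^sup>2 = (\<delta> * ?G)\<^sup>2"
        using m P(1) by (simp add: r_def \<epsilon>_def power2_eq_square field_simps)
      finally show "(L2norm \<Omega> (\<lambda>x. indicator E' x * \<phi> x))\<^sup>2 \<le> (\<delta> * ?G)\<^sup>2" by simp
      show "0 \<le> \<delta> * ?G" using \<delta> by simp
    qed
    finally show ?thesis .
  qed
  with \<epsilon> show ?thesis by blast
qed

section \<open>Sobolev spaces on a bounded open set\<close>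

lemma borel_measurable_vec_lambda:
  assumes "\<And>i. f i \<in> borel_measurable M"
  shows "(\<lambda>x. \<chi> i. f i x :: real^'d::finite) \<in> borel_measurable M"
proof (rule borel_measurable_euclidean_space[THEN iffD2], rule ballI)
  fix b :: "real^'d" assume "b \<in> Basis"
  then obtain i where "b = axis i 1" by (auto simp: Basis_vec_def)
  then show "(\<lambda>x. (\<chi> i. f i x) \<bullet> b) \<in> borel_measurable M" using assms by (simp add: inner_axis)
qed

locale bounded_open =
  fixes \<Omega> :: "(real^'d::finite) set"
  assumes open_dom: "open \<Omega>" and bounded_dom: "bounded \<Omega>"
begin

lemma dom_lmeasurable: "\<Omega> \<in> lmeasurable"
  using open_dom bounded_dom by (rule lmeasurable_open[rotated])

lemma dom_sets: "\<Omega> \<in> sets lebesgue"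
  using dom_lmeasurable by blast

lemma L2_integrable: "L2 \<Omega> u \<Longrightarrow> integrable (lebesgue_on \<Omega>) u"
  using L2_mult_integrable[OF _ L2_const[OF dom_lmeasurable], of u 1] by simp

lemma L2_test: "test_fun \<Omega> \<phi> \<Longrightarrow> L2 \<Omega> \<phi>"
  by (rule test_fun_L2[OF _ dom_sets order_refl])

lemma weak_partial_ip:
  "weak_partial \<Omega> i u g \<longleftrightarrow> (\<forall>\<phi>. test_fun \<Omega> \<phi> \<longrightarrow> L2ip \<Omega> u (partial i \<phi>) = - L2ip \<Omega> g \<phi>)"
  by (simp add: weak_partial_def L2ip_def)

text \<open>Makes the choice operator in \<open>wpd\<close> harmless: the chosen function is
  determined almost everywhere.\<close>

lemma weak_partial_unique:
  assumes "L2 \<Omega> g" "L2 \<Omega> h" "weak_partial \<Omega> i u g" "weak_partial \<Omega> i u h"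
  shows "AE x in lebesgue_on \<Omega>. g x = h x"
proof -
  have "AE x in lebesgue_on \<Omega>. g x - h x = 0"
  proof (rule fundamental_lemma[OF open_dom])
    show "integrable (lebesgue_on \<Omega>) (\<lambda>x. g x - h x)" by (intro L2_integrable L2_diff assms)
    fix \<phi> assume \<phi>: "test_fun \<Omega> \<phi>"
    have "L2ip \<Omega> (\<lambda>x. g x - h x) \<phi> = L2ip \<Omega> g \<phi> - L2ip \<Omega> h \<phi>"
      using assms(1,2) L2_test[OF \<phi>] by (intro L2.ip_diff) auto
    also have "\<dots> = 0" using assms(3,4) \<phi> by (simp add: weak_partial_ip)
    finally show "(\<integral>x. (g x - h x) * \<phi> x \<partial>lebesgue_on \<Omega>) = 0" by (simp add: L2ip_def)
  qed
  then show ?thesis by simp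
qed

lemma weak_partial_add:
  assumes "L2 \<Omega> u" "L2 \<Omega> v" "L2 \<Omega> g" "L2 \<Omega> h" "weak_partial \<Omega> i u g" "weak_partial \<Omega> i v h"
  shows "weak_partial \<Omega> i (\<lambda>x. u x + v x) (\<lambda>x. g x + h x)"
  using assms L2.ip_add[of u \<Omega> v] L2.ip_add[of g \<Omega> h] L2_test L2_test[OF test_fun_partial]
  by (simp add: weak_partial_ip)

lemma weak_partial_scale:
  assumes "L2 \<Omega> u" "L2 \<Omega> g" "weak_partial \<Omega> i u g"
  shows "weak_partial \<Omega> i (\<lambda>x. c * u x) (\<lambda>x. c * g x)"
  using assms L2.ip_scale[of u \<Omega>] L2.ip_scale[of g \<Omega>] L2_test L2_test[OF test_fun_partial]
  by (simp add: weak_partial_ip)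

lemma weak_partial_limit:
  assumes "\<And>n. L2 \<Omega> (s n)" "L2 \<Omega> u" "(\<lambda>n. L2norm \<Omega> (\<lambda>x. s n x - u x)) \<longlonglongrightarrow> 0"
    and "\<And>n. L2 \<Omega> (g n)" "L2 \<Omega> h" "(\<lambda>n. L2norm \<Omega> (\<lambda>x. g n x - h x)) \<longlonglongrightarrow> 0"
    and "\<And>n. weak_partial \<Omega> i (s n) (g n)"
  shows "weak_partial \<Omega> i u h"
  unfolding weak_partial_ip
proof (intro allI impI)
  fix \<phi> assume \<phi>: "test_fun \<Omega> \<phi>"
  have "(\<lambda>n. L2ip \<Omega> (s n) (partial i \<phi>)) \<longlonglongrightarrow> L2ip \<Omega> u (partial i \<phi>)"
    by (intro tendsto_L2ip assms L2_test test_fun_partial \<phi>)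
  moreover have "(\<lambda>n. - L2ip \<Omega> (g n) \<phi>) \<longlonglongrightarrow> - L2ip \<Omega> h \<phi>"
    by (intro tendsto_minus tendsto_L2ip assms L2_test \<phi>)
  moreover have "L2ip \<Omega> (s n) (partial i \<phi>) = - L2ip \<Omega> (g n) \<phi>" for n
    using assms(7) \<phi> by (simp add: weak_partial_ip)
  ultimately show "L2ip \<Omega> u (partial i \<phi>) = - L2ip \<Omega> h \<phi>"
    using LIMSEQ_unique by simp
qed

section \<open>The space H1 and its norm\<close>

lemma H1_L2: "H1 \<Omega> u \<Longrightarrow> L2 \<Omega> u"
  by (simp add: H1_def)

lemma H1_wpd:
  assumes "H1 \<Omega> u"
  shows "L2 \<Omega> (wpd \<Omega> i u)" "weak_partial \<Omega> i u (wpd \<Omega> i u)"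
proof -
  have "\<exists>g. L2 \<Omega> g \<and> weak_partial \<Omega> i u g" using assms by (simp add: H1_def)
  then have "L2 \<Omega> (wpd \<Omega> i u) \<and> weak_partial \<Omega> i u (wpd \<Omega> i u)" unfolding wpd_def by (rule someI_ex)
  then show "L2 \<Omega> (wpd \<Omega> i u)" "weak_partial \<Omega> i u (wpd \<Omega> i u)" by auto
qed

text \<open>The interface to \<open>wgrad\<close>: exhibiting any square integrable weak derivatives
  identifies the chosen gradient almost everywhere. All calculus rules below are obtained through
  it.\<close>

lemma H1_I:
  assumes "L2 \<Omega> u" "\<And>i. L2 \<Omega> (g i)" "\<And>i. weak_partial \<Omega> i u (g i)"
  shows "H1 \<Omega> u" "AE x in lebesgue_on \<Omega>. wgrad \<Omega> u x = (\<chi> i. g i x)"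
proof -
  show H: "H1 \<Omega> u" using assms by (auto simp: H1_def)
  have "AE x in lebesgue_on \<Omega>. \<forall>i\<in>UNIV. wpd \<Omega> i u x = g i x"
    by (intro AE_finite_allI weak_partial_unique[OF H1_wpd(1)[OF H] assms(2) H1_wpd(2)[OF H] assms(3)]) auto
  then show "AE x in lebesgue_on \<Omega>. wgrad \<Omega> u x = (\<chi> i. g i x)"
    by (rule AE_mp) (auto simp: wgrad_def vec_eq_iff)
qed

lemma H1_add:
  assumes "H1 \<Omega> u" "H1 \<Omega> v"
  shows "H1 \<Omega> (\<lambda>x. u x + v x)" "AE x in lebesgue_on \<Omega>. wgrad \<Omega> (\<lambda>x. u x + v x) x = wgrad \<Omega> u x + wgrad \<Omega> v x"
proof -
  have L: "L2 \<Omega> (\<lambda>x. u x + v x)" by (rule L2_add[OF H1_L2[OF assms(1)] H1_L2[OF assms(2)]])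
  have G: "L2 \<Omega> (\<lambda>x. wpd \<Omega> i u x + wpd \<Omega> i v x)" for i
    by (rule L2_add[OF H1_wpd(1)[OF assms(1)] H1_wpd(1)[OF assms(2)]])
  have W: "weak_partial \<Omega> i (\<lambda>x. u x + v x) (\<lambda>x. wpd \<Omega> i u x + wpd \<Omega> i v x)" for i
    by (rule weak_partial_add[OF H1_L2[OF assms(1)] H1_L2[OF assms(2)] H1_wpd(1)[OF assms(1)]
          H1_wpd(1)[OF assms(2)] H1_wpd(2)[OF assms(1)] H1_wpd(2)[OF assms(2)]])
  show "H1 \<Omega> (\<lambda>x. u x + v x)" by (rule H1_I(1)[OF L G W])
  have "AE x in lebesgue_on \<Omega>. wgrad \<Omega> (\<lambda>x. u x + v x) x = (\<chi> i. wpd \<Omega> i u x + wpd \<Omega> i v x)"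
    by (rule H1_I(2)[OF L G W])
  then show "AE x in lebesgue_on \<Omega>. wgrad \<Omega> (\<lambda>x. u x + v x) x = wgrad \<Omega> u x + wgrad \<Omega> v x"
    by (rule AE_mp) (auto simp: wgrad_def vec_eq_iff)
qed

lemma H1_scale:
  assumes "H1 \<Omega> u"
  shows "H1 \<Omega> (\<lambda>x. c * u x)" "AE x in lebesgue_on \<Omega>. wgrad \<Omega> (\<lambda>x. c * u x) x = c *\<^sub>R wgrad \<Omega> u x"
proof -
  have L: "L2 \<Omega> (\<lambda>x. c * u x)" by (rule L2_scale[OF H1_L2[OF assms]])
  have G: "L2 \<Omega> (\<lambda>x. c * wpd \<Omega> i u x)" for i by (rule L2_scale[OF H1_wpd(1)[OF assms]])
  have W: "weak_partial \<Omega> i (\<lambda>x. c * u x) (\<lambda>x. c * wpd \<Omega> i u x)" for i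
    by (rule weak_partial_scale[OF H1_L2[OF assms] H1_wpd(1)[OF assms] H1_wpd(2)[OF assms]])
  show "H1 \<Omega> (\<lambda>x. c * u x)" by (rule H1_I(1)[OF L G W])
  have "AE x in lebesgue_on \<Omega>. wgrad \<Omega> (\<lambda>x. c * u x) x = (\<chi> i. c * wpd \<Omega> i u x)"
    by (rule H1_I(2)[OF L G W])
  then show "AE x in lebesgue_on \<Omega>. wgrad \<Omega> (\<lambda>x. c * u x) x = c *\<^sub>R wgrad \<Omega> u x"
    by (rule AE_mp) (auto simp: wgrad_def vec_eq_iff)
qed

lemma H1_diff:
  assumes "H1 \<Omega> u" "H1 \<Omega> v"
  shows "H1 \<Omega> (\<lambda>x. u x - v x)" "AE x in lebesgue_on \<Omega>. wgrad \<Omega> (\<lambda>x. u x - v x) x = wgrad \<Omega> u x - wgrad \<Omega> v x"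
proof -
  have eq: "(\<lambda>x. u x - v x) = (\<lambda>x. u x + (-1) * v x)" by simp
  show "H1 \<Omega> (\<lambda>x. u x - v x)" unfolding eq by (rule H1_add(1)[OF assms(1) H1_scale(1)[OF assms(2)]])
  show "AE x in lebesgue_on \<Omega>. wgrad \<Omega> (\<lambda>x. u x - v x) x = wgrad \<Omega> u x - wgrad \<Omega> v x"
    using H1_add(2)[OF assms(1) H1_scale(1)[OF assms(2), of "-1"]] H1_scale(2)[OF assms(2), of "-1"]
    unfolding eq by eventually_elim simp
qed

lemma H1_zero: "H1 \<Omega> (\<lambda>x. 0)"
  by (rule H1_I(1)[of _ "\<lambda>i x. 0"]) (auto simp: weak_partial_def)

lemma H1_test:
  assumes "test_fun \<Omega> \<phi>"
  shows "H1 \<Omega> \<phi>" "AE x in lebesgue_on \<Omega>. wgrad \<Omega> \<phi> x = tgrad \<phi> x"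
  unfolding tgrad_def
  by (rule H1_I[OF L2_test[OF assms] L2_test[OF test_fun_partial[OF assms]]
        weak_partial_test_fun[OF dom_sets assms]])+

lemma wgrad_measurable: "H1 \<Omega> u \<Longrightarrow> wgrad \<Omega> u \<in> borel_measurable (lebesgue_on \<Omega>)"
  unfolding wgrad_def by (intro borel_measurable_vec_lambda L2_measurable H1_wpd)

definition gnorm :: "(real^'d \<Rightarrow> real) \<Rightarrow> real" where
  "gnorm u = L2norm \<Omega> (\<lambda>x. norm (wgrad \<Omega> u x))"

lemma L2_norm_wgrad:
  assumes "H1 \<Omega> u"
  shows "L2 \<Omega> (\<lambda>x. norm (wgrad \<Omega> u x))"
    and "(gnorm u)\<^sup>2 = (\<Sum>i\<in>UNIV. (L2norm \<Omega> (wpd \<Omega> i u))\<^sup>2)"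
proof -
  have eq: "(\<lambda>x. (norm (wgrad \<Omega> u x))\<^sup>2) = (\<lambda>x. \<Sum>i\<in>UNIV. (wpd \<Omega> i u x)\<^sup>2)"
    by (simp add: norm_vec_def L2_set_def wgrad_def sum_nonneg)
  have int: "integrable (lebesgue_on \<Omega>) (\<lambda>x. (wpd \<Omega> i u x)\<^sup>2)" for i
    using H1_wpd(1)[OF assms] by (simp add: L2_def)
  show "L2 \<Omega> (\<lambda>x. norm (wgrad \<Omega> u x))"
    unfolding L2_def eq using wgrad_measurable[OF assms] int by auto
  show "(gnorm u)\<^sup>2 = (\<Sum>i\<in>UNIV. (L2norm \<Omega> (wpd \<Omega> i u))\<^sup>2)"
    unfolding gnorm_def L2norm_sq eq using int by simp
qed

lemma gnorm_nonneg [simp]: "gnorm u \<ge> 0"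
  by (simp add: gnorm_def)

lemma H1norm_sq: "H1 \<Omega> u \<Longrightarrow> (H1norm \<Omega> u)\<^sup>2 = (L2norm \<Omega> u)\<^sup>2 + (gnorm u)\<^sup>2"
  by (simp add: H1norm_def L2_norm_wgrad(2)[symmetric])

lemma H1norm_nonneg [simp]: "H1norm \<Omega> u \<ge> 0"
  by (simp add: H1norm_def sum_nonneg)

lemma L2norm_le_H1norm: "H1 \<Omega> u \<Longrightarrow> L2norm \<Omega> u \<le> H1norm \<Omega> u"
  by (rule power2_le_imp_le) (simp_all add: H1norm_sq)

lemma gnorm_le_H1norm: "H1 \<Omega> u \<Longrightarrow> gnorm u \<le> H1norm \<Omega> u"
  by (rule power2_le_imp_le) (simp_all add: H1norm_sq)

lemma H1norm_le_sum: "H1 \<Omega> u \<Longrightarrow> H1norm \<Omega> u \<le> L2norm \<Omega> u + gnorm u"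
  by (rule power2_le_imp_le) (simp_all add: H1norm_sq power2_sum)

lemma L2_grad_inner:
  assumes "H1 \<Omega> u" "H1 \<Omega> v"
  shows "integrable (lebesgue_on \<Omega>) (\<lambda>x. wgrad \<Omega> u x \<bullet> wgrad \<Omega> v x)"
proof (rule Bochner_Integration.integrable_bound)
  show "integrable (lebesgue_on \<Omega>) (\<lambda>x. norm (wgrad \<Omega> u x) * norm (wgrad \<Omega> v x))"
    by (intro L2_mult_integrable L2_norm_wgrad assms)
  show "(\<lambda>x. wgrad \<Omega> u x \<bullet> wgrad \<Omega> v x) \<in> borel_measurable (lebesgue_on \<Omega>)"
    using assms by (intro borel_measurable_inner wgrad_measurable)
  show "AE x in lebesgue_on \<Omega>. norm (wgrad \<Omega> u x \<bullet> wgrad \<Omega> v x) \<le> norm (norm (wgrad \<Omega> u x) * norm (wgrad \<Omega> v x))"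
    using Cauchy_Schwarz_ineq2 by (intro AE_I2) auto
qed

lemma gnorm_cong_AE:
  assumes "H1 \<Omega> u" "AE x in lebesgue_on \<Omega>. wgrad \<Omega> u x = g x" "g \<in> borel_measurable (lebesgue_on \<Omega>)"
  shows "L2 \<Omega> (\<lambda>x. norm (g x))" "gnorm u = L2norm \<Omega> (\<lambda>x. norm (g x))"
proof -
  show g: "L2 \<Omega> (\<lambda>x. norm (g x))"
    using assms by (intro L2_cong_AE[OF L2_norm_wgrad(1)[OF assms(1)]]) auto
  show "gnorm u = L2norm \<Omega> (\<lambda>x. norm (g x))"
    unfolding gnorm_def using assms by (intro L2norm_cong_AE L2_norm_wgrad g) auto
qed

lemma gnorm_AE_le:
  assumes "H1 \<Omega> u" "L2 \<Omega> g" "AE x in lebesgue_on \<Omega>. norm (wgrad \<Omega> u x) \<le> g x"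
  shows "gnorm u \<le> L2norm \<Omega> g"
  unfolding gnorm_def using assms(3) by (intro L2norm_AE_mono L2_norm_wgrad assms(1,2)) auto

lemma gnorm_triangle:
  assumes "H1 \<Omega> u" "H1 \<Omega> v"
  shows "gnorm (\<lambda>x. u x + v x) \<le> gnorm u + gnorm v"
proof -
  have "AE x in lebesgue_on \<Omega>. norm (wgrad \<Omega> (\<lambda>x. u x + v x) x) \<le> norm (wgrad \<Omega> u x) + norm (wgrad \<Omega> v x)"
    using H1_add(2)[OF assms] by eventually_elim (simp add: norm_triangle_ineq)
  then have "gnorm (\<lambda>x. u x + v x) \<le> L2norm \<Omega> (\<lambda>x. norm (wgrad \<Omega> u x) + norm (wgrad \<Omega> v x))"
    by (intro gnorm_AE_le H1_add L2_add L2_norm_wgrad assms)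
  also have "\<dots> \<le> gnorm u + gnorm v"
    unfolding gnorm_def by (intro L2norm_triangle L2_norm_wgrad assms)
  finally show ?thesis .
qed

lemma gnorm_minus_commute:
  assumes "H1 \<Omega> u" "H1 \<Omega> v"
  shows "gnorm (\<lambda>x. u x - v x) = gnorm (\<lambda>x. v x - u x)"
proof -
  have "AE x in lebesgue_on \<Omega>. wgrad \<Omega> (\<lambda>x. u x - v x) x = - wgrad \<Omega> (\<lambda>x. v x - u x) x"
    using H1_diff(2)[OF assms] H1_diff(2)[OF assms(2,1)] by eventually_elim simp
  then show ?thesis
    using gnorm_cong_AE(2)[OF H1_diff(1)[OF assms], of "\<lambda>x. - wgrad \<Omega> (\<lambda>x. v x - u x) x"]
      wgrad_measurable[OF H1_diff(1)[OF assms(2,1)]] by (simp add: gnorm_def)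
qed

lemma H1norm_minus_commute:
  assumes "H1 \<Omega> u" "H1 \<Omega> v"
  shows "H1norm \<Omega> (\<lambda>x. u x - v x) = H1norm \<Omega> (\<lambda>x. v x - u x)"
  by (rule power2_eq_imp_eq)
    (simp_all add: H1norm_sq H1_diff(1) assms gnorm_minus_commute[OF assms] L2norm_minus_commute[of \<Omega> u v])

lemma H1norm_triangle:
  assumes "H1 \<Omega> u" "H1 \<Omega> v"
  shows "H1norm \<Omega> (\<lambda>x. u x + v x) \<le> H1norm \<Omega> u + H1norm \<Omega> v"
proof (rule power2_le_imp_le)
  have "(H1norm \<Omega> (\<lambda>x. u x + v x))\<^sup>2 \<le> (L2norm \<Omega> u + L2norm \<Omega> v)\<^sup>2 + (gnorm u + gnorm v)\<^sup>2"
    unfolding H1norm_sq[OF H1_add(1)[OF assms]]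
    by (intro add_mono power_mono L2norm_triangle gnorm_triangle assms H1_L2) auto
  also have "\<dots> = (H1norm \<Omega> u)\<^sup>2 + (H1norm \<Omega> v)\<^sup>2 + 2 * (L2norm \<Omega> u * L2norm \<Omega> v + gnorm u * gnorm v)"
    by (simp add: H1norm_sq assms power2_sum)
  also have "L2norm \<Omega> u * L2norm \<Omega> v + gnorm u * gnorm v \<le> H1norm \<Omega> u * H1norm \<Omega> v"
  proof (rule power2_le_imp_le)
    \<comment> \<open>Lagrange's identity: this square is the defect in the Cauchy-Schwarz
      inequality for the pairs (L2norm, gnorm) of the two functions.\<close>
    have "0 \<le> (L2norm \<Omega> u * gnorm v - L2norm \<Omega> v * gnorm u)\<^sup>2" by simp
    then show "(L2norm \<Omega> u * L2norm \<Omega> v + gnorm u * gnorm v)\<^sup>2 \<le> (H1norm \<Omega> u * H1norm \<Omega> v)\<^sup>2"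
      unfolding power_mult_distrib H1norm_sq[OF assms(1)] H1norm_sq[OF assms(2)]
      by (simp add: power2_eq_square algebra_simps)
  qed simp
  finally show "(H1norm \<Omega> (\<lambda>x. u x + v x))\<^sup>2 \<le> (H1norm \<Omega> u + H1norm \<Omega> v)\<^sup>2"
    by (simp add: power2_sum)
qed simp

lemma H1norm_triangle_diff:
  assumes "H1 \<Omega> u" "H1 \<Omega> v" "H1 \<Omega> w"
  shows "H1norm \<Omega> (\<lambda>x. u x - w x) \<le> H1norm \<Omega> (\<lambda>x. u x - v x) + H1norm \<Omega> (\<lambda>x. v x - w x)"
  using H1norm_triangle[OF H1_diff(1)[OF assms(1,2)] H1_diff(1)[OF assms(2,3)]] by simp

lemma H1norm_scale:
  assumes "H1 \<Omega> u"
  shows "H1norm \<Omega> (\<lambda>x. c * u x) = \<bar>c\<bar> * H1norm \<Omega> u"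
proof -
  have "gnorm (\<lambda>x. c * u x) = L2norm \<Omega> (\<lambda>x. norm (c *\<^sub>R wgrad \<Omega> u x))"
    using wgrad_measurable[OF assms] by (intro gnorm_cong_AE H1_scale assms) measurable
  then have "gnorm (\<lambda>x. c * u x) = \<bar>c\<bar> * gnorm u" by (simp add: L2norm_scale gnorm_def)
  then show ?thesis
    by (intro power2_eq_imp_eq[of "H1norm \<Omega> (\<lambda>x. c * u x)"])
      (simp_all add: H1norm_sq H1_scale(1) assms power_mult_distrib L2norm_scale distrib_left)
qed

section \<open>The closure of the test functions: linearity, closedness, completeness\<close>

lemma H10_H1: "H10 \<Omega> u \<Longrightarrow> H1 \<Omega> u"
  by (simp add: H10_def)

lemma H10_approx:
  assumes "H10 \<Omega> u"
  obtains \<phi> where "\<And>n::nat. test_fun \<Omega> (\<phi> n)" "(\<lambda>n. H1norm \<Omega> (\<lambda>x. u x - \<phi> n x)) \<longlonglongrightarrow> 0"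
  using assms by (auto simp: H10_def)

text \<open>A diagonal choice: for each n a test function within 1 / (n + 1) of
  \<open>s n\<close>.\<close>

lemma H10_closed:
  assumes "\<And>n. H10 \<Omega> (s n)" "H1 \<Omega> u" "(\<lambda>n. H1norm \<Omega> (\<lambda>x. u x - s n x)) \<longlonglongrightarrow> 0"
  shows "H10 \<Omega> u"
proof -
  have "\<exists>\<phi>. test_fun \<Omega> \<phi> \<and> H1norm \<Omega> (\<lambda>x. s n x - \<phi> x) < 1 / real (Suc n)" for n
  proof -
    obtain \<phi> where \<phi>: "\<And>k::nat. test_fun \<Omega> (\<phi> k)" "(\<lambda>k. H1norm \<Omega> (\<lambda>x. s n x - \<phi> k x)) \<longlonglongrightarrow> 0"
      using H10_approx[OF assms(1)[of n]] by metis
    have "\<forall>\<^sub>F k in sequentially. H1norm \<Omega> (\<lambda>x. s n x - \<phi> k x) < 1 / real (Suc n)"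
      by (rule order_tendstoD(2)[OF \<phi>(2)]) simp
    then show ?thesis using \<phi>(1) by (auto simp: eventually_sequentially)
  qed
  then obtain \<phi> where \<phi>: "\<And>n. test_fun \<Omega> (\<phi> n)" "\<And>n. H1norm \<Omega> (\<lambda>x. s n x - \<phi> n x) < 1 / real (Suc n)"
    by metis
  have "(\<lambda>n. H1norm \<Omega> (\<lambda>x. u x - \<phi> n x)) \<longlonglongrightarrow> 0"
  proof (rule Lim_null_comparison)
    show "\<forall>\<^sub>F n in sequentially. norm (H1norm \<Omega> (\<lambda>x. u x - \<phi> n x)) \<le> H1norm \<Omega> (\<lambda>x. u x - s n x) + 1 / real (Suc n)"
    proof (intro always_eventually allI)
      fix n
      show "norm (H1norm \<Omega> (\<lambda>x. u x - \<phi> n x)) \<le> H1norm \<Omega> (\<lambda>x. u x - s n x) + 1 / real (Suc n)"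
        using H1norm_triangle_diff[OF assms(2) H10_H1[OF assms(1)[of n]] H1_test(1)[OF \<phi>(1)[of n]]] \<phi>(2)[of n]
        by simp
    qed
    show "(\<lambda>n. H1norm \<Omega> (\<lambda>x. u x - s n x) + 1 / real (Suc n)) \<longlonglongrightarrow> 0"
      using tendsto_add[OF assms(3) LIMSEQ_Suc[OF lim_1_over_n]] by simp
  qed
  then show ?thesis using assms(2) \<phi>(1) by (auto simp: H10_def)
qed

lemma H10_test: "test_fun \<Omega> \<phi> \<Longrightarrow> H10 \<Omega> \<phi>"
  unfolding H10_def using H1_test(1)[of \<phi>] H1norm_scale[OF H1_zero, of 0]
  by (auto intro!: exI[of _ "\<lambda>n. \<phi>"])

lemma H10_zero: "H10 \<Omega> (\<lambda>x. 0)"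
  by (rule H10_test) (simp add: test_fun_def smooth_fun_const tsupp_def)

lemma H10_add:
  assumes "H10 \<Omega> u" "H10 \<Omega> v"
  shows "H10 \<Omega> (\<lambda>x. u x + v x)"
proof -
  obtain \<phi> where \<phi>: "\<And>n::nat. test_fun \<Omega> (\<phi> n)" "(\<lambda>n. H1norm \<Omega> (\<lambda>x. u x - \<phi> n x)) \<longlonglongrightarrow> 0"
    using H10_approx[OF assms(1)] by metis
  obtain \<psi> where \<psi>: "\<And>n::nat. test_fun \<Omega> (\<psi> n)" "(\<lambda>n. H1norm \<Omega> (\<lambda>x. v x - \<psi> n x)) \<longlonglongrightarrow> 0"
    using H10_approx[OF assms(2)] by metis
  have t: "test_fun \<Omega> (\<lambda>x. \<phi> n x + \<psi> n x)" for n
  proof -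
    have K: "tsupp (\<phi> n) \<union> tsupp (\<psi> n) \<subseteq> \<Omega>" "compact (tsupp (\<phi> n) \<union> tsupp (\<psi> n))"
      using \<phi>(1)[of n] \<psi>(1)[of n] by (auto simp: test_fun_def)
    have sub: "tsupp (\<lambda>x. \<phi> n x + \<psi> n x) \<subseteq> tsupp (\<phi> n) \<union> tsupp (\<psi> n)"
      unfolding tsupp_def[of "\<lambda>x. \<phi> n x + \<psi> n x"]
    proof (rule closure_minimal[OF _ compact_imp_closed[OF K(2)]], rule subsetI, rule ccontr)
      fix x assume "x \<in> {x. \<phi> n x + \<psi> n x \<noteq> 0}" "x \<notin> tsupp (\<phi> n) \<union> tsupp (\<psi> n)"
      then show False using not_in_tsupp[of x "\<phi> n"] not_in_tsupp[of x "\<psi> n"] by simp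
    qed
    have "compact (tsupp (\<lambda>x. \<phi> n x + \<psi> n x))"
      using compact_Int_closed[OF K(2), of "tsupp (\<lambda>x. \<phi> n x + \<psi> n x)"] sub
      by (simp add: inf.absorb2) (simp add: tsupp_def)
    then show ?thesis
      using sub K(1) smooth_fun_add[OF test_fun_smooth[OF \<phi>(1)] test_fun_smooth[OF \<psi>(1)]]
      by (auto simp: test_fun_def)
  qed
  have uv: "H1 \<Omega> u" "H1 \<Omega> v" using assms H10_H1 by auto
  have "(\<lambda>n. H1norm \<Omega> (\<lambda>x. (u x + v x) - (\<phi> n x + \<psi> n x))) \<longlonglongrightarrow> 0"
  proof (rule Lim_null_comparison)
    have "H1norm \<Omega> (\<lambda>x. (u x + v x) - (\<phi> n x + \<psi> n x)) \<le> H1norm \<Omega> (\<lambda>x. u x - \<phi> n x) + H1norm \<Omega> (\<lambda>x. v x - \<psi> n x)" for n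
      using H1norm_triangle[OF H1_diff(1)[OF uv(1) H1_test(1)[OF \<phi>(1)[of n]]] H1_diff(1)[OF uv(2) H1_test(1)[OF \<psi>(1)[of n]]]]
      by (simp add: algebra_simps)
    then show "\<forall>\<^sub>F n in sequentially. norm (H1norm \<Omega> (\<lambda>x. (u x + v x) - (\<phi> n x + \<psi> n x)))
        \<le> H1norm \<Omega> (\<lambda>x. u x - \<phi> n x) + H1norm \<Omega> (\<lambda>x. v x - \<psi> n x)" by simp
    show "(\<lambda>n. H1norm \<Omega> (\<lambda>x. u x - \<phi> n x) + H1norm \<Omega> (\<lambda>x. v x - \<psi> n x)) \<longlonglongrightarrow> 0"
      using tendsto_add[OF \<phi>(2) \<psi>(2)] by simp
  qed
  then show ?thesis
    unfolding H10_def using H1_add(1)[OF uv] t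
    by (intro conjI exI[of _ "\<lambda>n x. \<phi> n x + \<psi> n x"]) auto
qed

lemma H10_scale:
  assumes "H10 \<Omega> u"
  shows "H10 \<Omega> (\<lambda>x. c * u x)"
proof -
  obtain \<phi> where \<phi>: "\<And>n::nat. test_fun \<Omega> (\<phi> n)" "(\<lambda>n. H1norm \<Omega> (\<lambda>x. u x - \<phi> n x)) \<longlonglongrightarrow> 0"
    using H10_approx[OF assms] by metis
  have t: "test_fun \<Omega> (\<lambda>x. c * \<phi> n x)" for n
    using test_fun_mult[OF \<phi>(1)[of n] smooth_fun_const[of c]] by (simp add: mult.commute)
  have "(\<lambda>n. H1norm \<Omega> (\<lambda>x. c * u x - c * \<phi> n x)) = (\<lambda>n. \<bar>c\<bar> * H1norm \<Omega> (\<lambda>x. u x - \<phi> n x))"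
    using H1norm_scale[OF H1_diff(1)[OF H10_H1[OF assms] H1_test(1)[OF \<phi>(1)]], of c]
    by (simp add: right_diff_distrib)
  also have "\<dots> \<longlonglongrightarrow> 0" using tendsto_mult_left[OF \<phi>(2), of "\<bar>c\<bar>"] by simp
  finally show ?thesis
    unfolding H10_def using H1_scale(1)[OF H10_H1[OF assms]] t
    by (intro conjI exI[of _ "\<lambda>n x. c * \<phi> n x"]) auto
qed

lemma H10_diff: "H10 \<Omega> u \<Longrightarrow> H10 \<Omega> v \<Longrightarrow> H10 \<Omega> (\<lambda>x. u x - v x)"
  using H10_add[OF _ H10_scale[of v "-1"], of u] by simp

text \<open>The weak derivative is a closed operator, so L2 convergence of the functions and of
  their derivatives identifies the gradient of the limit and is convergence in H1. Both completeness
  and the chain rule for truncations reduce to this.\<close>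

lemma H10_limit:
  assumes s: "\<And>n. H10 \<Omega> (s n)" and u: "L2 \<Omega> u" and g: "\<And>i. L2 \<Omega> (g i)"
    and su: "(\<lambda>n. L2norm \<Omega> (\<lambda>x. s n x - u x)) \<longlonglongrightarrow> 0"
    and sg: "\<And>i. (\<lambda>n. L2norm \<Omega> (\<lambda>x. wpd \<Omega> i (s n) x - g i x)) \<longlonglongrightarrow> 0"
  shows "H10 \<Omega> u" "AE x in lebesgue_on \<Omega>. wgrad \<Omega> u x = (\<chi> i. g i x)"
    "(\<lambda>n. H1norm \<Omega> (\<lambda>x. u x - s n x)) \<longlonglongrightarrow> 0"
proof -
  have H: "H1 \<Omega> (s n)" for n using s by (rule H10_H1)
  have wp: "weak_partial \<Omega> i u (g i)" for i
    by (rule weak_partial_limit[OF H1_L2[OF H] u su H1_wpd(1)[OF H] g sg H1_wpd(2)[OF H]])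
  show AE: "AE x in lebesgue_on \<Omega>. wgrad \<Omega> u x = (\<chi> i. g i x)" by (rule H1_I(2)[OF u g wp])
  have Hu: "H1 \<Omega> u" by (rule H1_I(1)[OF u g wp])
  have "L2norm \<Omega> (wpd \<Omega> i (\<lambda>x. u x - s n x)) = L2norm \<Omega> (\<lambda>x. wpd \<Omega> i (s n) x - g i x)" for i n
  proof -
    have "L2norm \<Omega> (wpd \<Omega> i (\<lambda>x. u x - s n x)) = L2norm \<Omega> (\<lambda>x. g i x - wpd \<Omega> i (s n) x)"
    proof (intro L2norm_cong_AE H1_wpd H1_diff Hu H L2_diff g)
      show "AE x in lebesgue_on \<Omega>. wpd \<Omega> i (\<lambda>x. u x - s n x) x = g i x - wpd \<Omega> i (s n) x"
        using H1_diff(2)[OF Hu H[of n]] AE by eventually_elim (simp add: wgrad_def vec_eq_iff)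
    qed
    then show ?thesis by (simp add: L2norm_minus_commute[of \<Omega> "g i"])
  qed
  then have "H1norm \<Omega> (\<lambda>x. u x - s n x) = sqrt ((L2norm \<Omega> (\<lambda>x. s n x - u x))\<^sup>2
      + (\<Sum>i\<in>UNIV. (L2norm \<Omega> (\<lambda>x. wpd \<Omega> i (s n) x - g i x))\<^sup>2))" for n
    by (simp add: H1norm_def L2norm_minus_commute[of \<Omega> u])
  moreover have "(\<lambda>n. sqrt ((L2norm \<Omega> (\<lambda>x. s n x - u x))\<^sup>2
      + (\<Sum>i\<in>UNIV. (L2norm \<Omega> (\<lambda>x. wpd \<Omega> i (s n) x - g i x))\<^sup>2))) \<longlonglongrightarrow> sqrt (0\<^sup>2 + (\<Sum>i\<in>(UNIV::'d set). 0\<^sup>2))"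
    by (intro tendsto_intros su sg)
  ultimately show lim: "(\<lambda>n. H1norm \<Omega> (\<lambda>x. u x - s n x)) \<longlonglongrightarrow> 0" by simp
  show "H10 \<Omega> u" by (rule H10_closed[OF s Hu lim])
qed

lemma L2norm_wpd_diff_le:
  assumes "H1 \<Omega> u" "H1 \<Omega> v"
  shows "L2norm \<Omega> (\<lambda>x. wpd \<Omega> i u x - wpd \<Omega> i v x) \<le> H1norm \<Omega> (\<lambda>x. u x - v x)"
proof -
  have "L2norm \<Omega> (\<lambda>x. wpd \<Omega> i u x - wpd \<Omega> i v x) \<le> gnorm (\<lambda>x. u x - v x)"
    unfolding gnorm_def
  proof (intro L2norm_AE_mono L2_diff H1_wpd L2_norm_wgrad H1_diff assms)
    show "AE x in lebesgue_on \<Omega>. \<bar>wpd \<Omega> i u x - wpd \<Omega> i v x\<bar> \<le> \<bar>norm (wgrad \<Omega> (\<lambda>x. u x - v x) x)\<bar>"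
      using H1_diff(2)[OF assms]
    proof eventually_elim
      case (elim x)
      then have "wpd \<Omega> i u x - wpd \<Omega> i v x = wgrad \<Omega> (\<lambda>x. u x - v x) x $ i"
        by (simp add: wgrad_def)
      then show ?case using component_le_norm_cart[of "wgrad \<Omega> (\<lambda>x. u x - v x) x" i] by simp
    qed
  qed
  also have "\<dots> \<le> H1norm \<Omega> (\<lambda>x. u x - v x)" by (intro gnorm_le_H1norm H1_diff assms)
  finally show ?thesis .
qed

lemma H10_complete:
  assumes s: "\<And>n. H10 \<Omega> (s n)"
    and Cau: "\<And>e. e > 0 \<Longrightarrow> \<exists>N::nat. \<forall>m\<ge>N. \<forall>n\<ge>N. H1norm \<Omega> (\<lambda>x. s m x - s n x) < e"
  shows "\<exists>u. H10 \<Omega> u \<and> (\<lambda>n. H1norm \<Omega> (\<lambda>x. u x - s n x)) \<longlonglongrightarrow> 0"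
proof -
  have H: "H1 \<Omega> (s n)" for n using s by (rule H10_H1)
  have le0: "L2norm \<Omega> (\<lambda>x. s m x - s n x) \<le> H1norm \<Omega> (\<lambda>x. s m x - s n x)" for m n
    by (intro L2norm_le_H1norm H1_diff H)
  note lei = L2norm_wpd_diff_le[OF H H]
  have "\<exists>u. L2 \<Omega> u \<and> (\<lambda>n. L2norm \<Omega> (\<lambda>x. s n x - u x)) \<longlonglongrightarrow> 0"
  proof (rule L2_complete[OF dom_lmeasurable H1_L2[OF H]])
    fix e :: real assume "e > 0"
    then obtain N where "\<forall>m\<ge>N. \<forall>n\<ge>N. H1norm \<Omega> (\<lambda>x. s m x - s n x) < e" using Cau by blast
    then show "\<exists>N. \<forall>m\<ge>N. \<forall>n\<ge>N. L2norm \<Omega> (\<lambda>x. s m x - s n x) < e"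
      using le0 order_le_less_trans by blast
  qed
  then obtain u where u: "L2 \<Omega> u" "(\<lambda>n. L2norm \<Omega> (\<lambda>x. s n x - u x)) \<longlonglongrightarrow> 0" by blast
  have "\<exists>g. L2 \<Omega> g \<and> (\<lambda>n. L2norm \<Omega> (\<lambda>x. wpd \<Omega> i (s n) x - g x)) \<longlonglongrightarrow> 0" for i
  proof (rule L2_complete[OF dom_lmeasurable H1_wpd(1)[OF H]])
    fix e :: real assume "e > 0"
    then obtain N where "\<forall>m\<ge>N. \<forall>n\<ge>N. H1norm \<Omega> (\<lambda>x. s m x - s n x) < e" using Cau by blast
    then show "\<exists>N. \<forall>m\<ge>N. \<forall>n\<ge>N. L2norm \<Omega> (\<lambda>x. wpd \<Omega> i (s m) x - wpd \<Omega> i (s n) x) < e"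
      using lei order_le_less_trans by blast
  qed
  then have "\<exists>g. \<forall>i. L2 \<Omega> (g i) \<and> (\<lambda>n. L2norm \<Omega> (\<lambda>x. wpd \<Omega> i (s n) x - g i x)) \<longlonglongrightarrow> 0"
    by (intro choice allI)
  then obtain g where g: "\<And>i. L2 \<Omega> (g i)" "\<And>i. (\<lambda>n. L2norm \<Omega> (\<lambda>x. wpd \<Omega> i (s n) x - g i x)) \<longlonglongrightarrow> 0"
    by blast
  show ?thesis using H10_limit[OF s u(1) g(1) u(2) g(2)] by blast
qed

lemma tendsto_gnorm:
  assumes "\<And>n. H1 \<Omega> (s n)" "H1 \<Omega> u" "(\<lambda>n. H1norm \<Omega> (\<lambda>x. u x - s n x)) \<longlonglongrightarrow> 0"
  shows "(\<lambda>n. gnorm (s n)) \<longlonglongrightarrow> gnorm u"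
proof (rule Lim_transform_bound[THEN LIM_zero_cancel])
  have "norm (gnorm (s n) - gnorm u) \<le> norm (H1norm \<Omega> (\<lambda>x. u x - s n x))" for n
    using gnorm_triangle[OF assms(1)[of n] H1_diff(1)[OF assms(2) assms(1)[of n]]]
      gnorm_triangle[OF assms(2) H1_diff(1)[OF assms(1)[of n] assms(2)]]
      gnorm_minus_commute[OF assms(2) assms(1)[of n]] gnorm_le_H1norm[OF H1_diff(1)[OF assms(2) assms(1)[of n]]]
    by simp
  then show "\<forall>\<^sub>F n in sequentially. norm (gnorm (s n) - gnorm u) \<le> norm (H1norm \<Omega> (\<lambda>x. u x - s n x))" by simp
qed (rule assms)

lemma H10_L2_approx:
  assumes "H10 \<Omega> u" "\<And>n. test_fun \<Omega> (\<phi> n)" "(\<lambda>n. H1norm \<Omega> (\<lambda>x. u x - \<phi> n x)) \<longlonglongrightarrow> 0"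
  shows "(\<lambda>n. L2norm \<Omega> (\<lambda>x. \<phi> n x - u x)) \<longlonglongrightarrow> 0"
proof (rule Lim_null_comparison[OF _ assms(3)])
  have "L2norm \<Omega> (\<lambda>x. \<phi> n x - u x) \<le> H1norm \<Omega> (\<lambda>x. u x - \<phi> n x)" for n
    using L2norm_le_H1norm[OF H1_diff(1)[OF H10_H1[OF assms(1)] H1_test(1)[OF assms(2)[of n]]]]
    by (simp add: L2norm_minus_commute[of \<Omega> u])
  then show "\<forall>\<^sub>F n in sequentially. norm (L2norm \<Omega> (\<lambda>x. \<phi> n x - u x)) \<le> H1norm \<Omega> (\<lambda>x. u x - \<phi> n x)" by simp
qed

lemma gnorm_test: "test_fun \<Omega> \<phi> \<Longrightarrow> gnorm \<phi> = L2norm \<Omega> (\<lambda>x. norm (tgrad \<phi> x))"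
  by (intro gnorm_cong_AE H1_test borel_measurable_lebesgue_on borel_tgrad test_fun_smooth)

lemma Poincare: "\<exists>P>0. \<forall>u. H10 \<Omega> u \<longrightarrow> L2norm \<Omega> u \<le> P * gnorm u"
proof -
  obtain P where P: "P > 0" "\<And>\<phi>. test_fun \<Omega> \<phi> \<Longrightarrow> L2norm \<Omega> \<phi> \<le> P * L2norm \<Omega> (\<lambda>x. norm (tgrad \<phi> x))"
    using Poincare_test_fun[OF bounded_dom dom_sets] by blast
  have "L2norm \<Omega> u \<le> P * gnorm u" if u: "H10 \<Omega> u" for u
  proof -
    obtain \<phi> where \<phi>: "\<And>n::nat. test_fun \<Omega> (\<phi> n)" "(\<lambda>n. H1norm \<Omega> (\<lambda>x. u x - \<phi> n x)) \<longlonglongrightarrow> 0"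
      using H10_approx[OF u] by metis
    show ?thesis
    proof (rule LIMSEQ_le)
      show "(\<lambda>n. L2norm \<Omega> (\<phi> n)) \<longlonglongrightarrow> L2norm \<Omega> u"
        by (rule tendsto_L2norm[OF L2_test[OF \<phi>(1)] H1_L2[OF H10_H1[OF u]] H10_L2_approx[OF u \<phi>]])
      show "(\<lambda>n. P * gnorm (\<phi> n)) \<longlonglongrightarrow> P * gnorm u"
        by (intro tendsto_mult_left tendsto_gnorm H1_test \<phi> H10_H1 u)
      show "\<exists>N. \<forall>n\<ge>N. L2norm \<Omega> (\<phi> n) \<le> P * gnorm (\<phi> n)"
        using P(2)[OF \<phi>(1)] by (simp add: gnorm_test[OF \<phi>(1)])
    qed
  qed
  with P(1) show ?thesis by blast
qed

text \<open>By density of test functions: multiplication by an indicator does not increase the L2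
  norm, so both sides pass to the limit. This is the inequality that absorbs the drift on a
  slice.\<close>

lemma small_set_estimate:
  assumes \<delta>: "\<delta> > 0"
  shows "\<exists>\<epsilon>>0. \<forall>u E. H10 \<Omega> u \<longrightarrow> E \<in> sets lebesgue \<longrightarrow> emeasure lebesgue E \<le> ennreal \<epsilon> \<longrightarrow>
    L2norm \<Omega> (\<lambda>x. indicator E x * u x) \<le> \<delta> * gnorm u"
proof -
  obtain \<epsilon> where \<epsilon>: "\<epsilon> > 0" "\<And>\<phi> E. test_fun \<Omega> \<phi> \<Longrightarrow> E \<in> sets lebesgue \<Longrightarrow> emeasure lebesgue E \<le> ennreal \<epsilon> \<Longrightarrow>
      L2norm \<Omega> (\<lambda>x. indicator E x * \<phi> x) \<le> \<delta> * L2norm \<Omega> (\<lambda>x. norm (tgrad \<phi> x))"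
    using small_support_test_fun[OF bounded_dom dom_sets \<delta>] by blast
  have "L2norm \<Omega> (\<lambda>x. indicator E x * u x) \<le> \<delta> * gnorm u"
    if u: "H10 \<Omega> u" and E: "E \<in> sets lebesgue" "emeasure lebesgue E \<le> ennreal \<epsilon>" for u E
  proof -
    obtain \<phi> where \<phi>: "\<And>n::nat. test_fun \<Omega> (\<phi> n)" "(\<lambda>n. H1norm \<Omega> (\<lambda>x. u x - \<phi> n x)) \<longlonglongrightarrow> 0"
      using H10_approx[OF u] by metis
    have Em: "indicat_real E \<in> borel_measurable (lebesgue_on \<Omega>)"
      using E(1) by (intro measurable_restrict_space1 borel_measurable_indicator)
    have cut: "L2 \<Omega> (\<lambda>x. indicator E x * v x)" "L2norm \<Omega> (\<lambda>x. indicator E x * v x) \<le> L2norm \<Omega> v" if v: "L2 \<Omega> v" for v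
    proof -
      show c: "L2 \<Omega> (\<lambda>x. indicator E x * v x)"
        by (rule L2_AE_bound[OF borel_measurable_times[OF Em L2_measurable[OF v]] v]) (auto simp: indicator_def)
      show "L2norm \<Omega> (\<lambda>x. indicator E x * v x) \<le> L2norm \<Omega> v"
        by (rule L2norm_AE_mono[OF c v]) (auto simp: indicator_def)
    qed
    have L2u: "L2 \<Omega> u" by (rule H1_L2[OF H10_H1[OF u]])
    have L2d: "L2 \<Omega> (\<lambda>x. \<phi> n x - u x)" for n by (intro L2_diff L2_test \<phi> L2u)
    show ?thesis
    proof (rule LIMSEQ_le)
      show "(\<lambda>n. L2norm \<Omega> (\<lambda>x. indicator E x * \<phi> n x)) \<longlonglongrightarrow> L2norm \<Omega> (\<lambda>x. indicator E x * u x)"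
      proof (rule tendsto_L2norm[OF cut(1)[OF L2_test[OF \<phi>(1)]] cut(1)[OF L2u]])
        show "(\<lambda>n. L2norm \<Omega> (\<lambda>x. indicator E x * \<phi> n x - indicator E x * u x)) \<longlonglongrightarrow> 0"
        proof (rule Lim_null_comparison[OF _ H10_L2_approx[OF u \<phi>]])
          show "\<forall>\<^sub>F n in sequentially. norm (L2norm \<Omega> (\<lambda>x. indicator E x * \<phi> n x - indicator E x * u x))
              \<le> L2norm \<Omega> (\<lambda>x. \<phi> n x - u x)"
            using cut(2)[OF L2d] by (simp add: right_diff_distrib)
        qed
      qed
      show "(\<lambda>n. \<delta> * gnorm (\<phi> n)) \<longlonglongrightarrow> \<delta> * gnorm u"
        by (intro tendsto_mult_left tendsto_gnorm H1_test \<phi> H10_H1 u)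
      show "\<exists>N. \<forall>n\<ge>N. L2norm \<Omega> (\<lambda>x. indicator E x * \<phi> n x) \<le> \<delta> * gnorm (\<phi> n)"
        using \<epsilon>(2)[OF \<phi>(1) E] by (simp add: gnorm_test[OF \<phi>(1)])
    qed
  qed
  with \<epsilon>(1) show ?thesis by blast
qed

end

section \<open>Truncation\<close>

text \<open>Chosen because \<open>softplus\<close> has derivative \<open>logistic\<close>, and the
  derivative of \<open>logistic\<close> is a polynomial in \<open>logistic\<close>. Smooth
  truncations built from this pair thus fall under \<open>smooth_fun_compose\<close>.\<close>

definition logistic :: "real \<Rightarrow> real" where
  "logistic t = 1 / (1 + exp (- t))"

definition softplus :: "real \<Rightarrow> real" where
  "softplus t = ln (1 + exp t)"

lemma logistic_bounds: "0 < logistic t" "logistic t < 1"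
  by (simp_all add: logistic_def add_pos_pos)

lemma softplus_deriv: "(softplus has_real_derivative logistic t) (at t)"
proof -
  have "exp t / (1 + exp t) = logistic t"
    by (simp add: logistic_def exp_minus field_simps add_pos_pos)
  then show ?thesis unfolding softplus_def
    by (auto intro!: derivative_eq_intros simp: add_pos_pos)
qed

lemma logistic_deriv: "(logistic has_real_derivative logistic t * (1 - logistic t)) (at t)"
proof -
  have "1 + exp (- t) \<noteq> 0" using exp_gt_zero[of "- t"] by linarith
  then show ?thesis unfolding logistic_def
    by (auto intro!: derivative_eq_intros simp: field_simps power2_eq_square)
qed

lemma softplus_bounds: "max t 0 \<le> softplus t" "softplus t \<le> max t 0 + ln 2"
proof -
  have "ln (exp (max t 0)) \<le> ln (1 + exp t)"
    by (subst ln_le_cancel_iff) (auto simp: add_pos_pos max_def)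
  then show "max t 0 \<le> softplus t" by (simp add: softplus_def)
  have "1 + exp t \<le> exp (max t 0) * 2" by (cases "t \<ge> 0") auto
  then have "ln (1 + exp t) \<le> ln (exp (max t 0) * 2)"
    by (subst ln_le_cancel_iff) (auto simp: add_pos_pos)
  then show "softplus t \<le> max t 0 + ln 2" by (simp add: softplus_def ln_mult)
qed

text \<open>A smooth approximation of max (s - k) 0, normalised to vanish at 0 so that compositions
  with test functions keep their compact support. The shift \<open>\<theta>\<close> disappears in
  the limit of the function but not in the limit of its derivative at s = k.\<close>

definition soft_trunc :: "real \<Rightarrow> real \<Rightarrow> nat \<Rightarrow> real \<Rightarrow> real" where
  "soft_trunc \<theta> k n s = softplus (real (Suc n) * (s - k) + \<theta>) / real (Suc n) - softplus (real (Suc n) * (0 - k) + \<theta>) / real (Suc n)"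

definition soft_step :: "real \<Rightarrow> real \<Rightarrow> nat \<Rightarrow> real \<Rightarrow> real" where
  "soft_step \<theta> k n s = logistic (real (Suc n) * (s - k) + \<theta>)"

lemma soft_trunc_deriv: "(soft_trunc \<theta> k n has_real_derivative soft_step \<theta> k n s) (at s)"
  unfolding soft_trunc_def soft_step_def
  by (rule derivative_eq_intros DERIV_chain2[OF softplus_deriv] refl | simp del: of_nat_Suc)+

lemma soft_step_deriv:
  "(soft_step \<theta> k n has_real_derivative (real (Suc n) * (soft_step \<theta> k n s * (1 + - 1 * soft_step \<theta> k n s)))) (at s)"
proof -
  have lin: "((\<lambda>s. real (Suc n) * (s - k) + \<theta>) has_real_derivative real (Suc n)) (at s)"
    by (auto intro!: derivative_eq_intros)
  show ?thesis unfolding soft_step_def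
    using DERIV_chain2[OF logistic_deriv lin] by (simp add: mult_ac del: of_nat_Suc)
qed

lemma smooth_fun_soft_trunc:
  assumes "smooth_fun \<phi>"
  shows "smooth_fun (\<lambda>x. soft_trunc \<theta> k n (\<phi> x))"
proof (rule smooth_fun_compose[OF assms, of _ "{soft_trunc \<theta> k n, soft_step \<theta> k n}"])
  let ?K = "{soft_trunc \<theta> k n, soft_step \<theta> k n}"
  fix h assume "h \<in> ?K"
  then consider "h = soft_trunc \<theta> k n" | "h = soft_step \<theta> k n" by auto
  then show "\<exists>h'\<in>fun_alg ?K. \<forall>s. (h has_real_derivative h' s) (at s)"
  proof cases
    case 1
    then show ?thesis using soft_trunc_deriv by (auto intro!: bexI[of _ "soft_step \<theta> k n"] fun_alg.base)
  next
    case 2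
    have "(\<lambda>s. real (Suc n) * (soft_step \<theta> k n s * (1 + - 1 * soft_step \<theta> k n s))) \<in> fun_alg ?K"
      by (intro fun_alg.add fun_alg.mult fun_alg.const fun_alg.base) auto
    then show ?thesis using soft_step_deriv 2 by (auto intro!: bexI)
  qed
qed auto

lemma soft_trunc_0: "soft_trunc \<theta> k n 0 = 0"
  by (simp add: soft_trunc_def)

lemma soft_step_bounds: "\<bar>soft_step \<theta> k n s\<bar> \<le> 1"
  using logistic_bounds[of "real (Suc n) * (s - k) + \<theta>"] unfolding soft_step_def by linarith

lemma tendsto_softplus_scaled: "(\<lambda>n. softplus (real (Suc n) * t + \<theta>) / real (Suc n)) \<longlonglongrightarrow> max t 0"
proof (rule LIM_zero_cancel, rule Lim_null_comparison)
  have "norm (softplus (real (Suc n) * t + \<theta>) / real (Suc n) - max t 0) \<le> (ln 2 + \<bar>\<theta>\<bar>) * (1 / real (Suc n))" for n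
  proof -
    have "\<bar>softplus (a + \<theta>) - max a 0\<bar> \<le> ln 2 + \<bar>\<theta>\<bar>" for a
    proof -
      have "\<bar>max (a + \<theta>) 0 - max a 0\<bar> \<le> \<bar>\<theta>\<bar>" by (auto simp: max_def)
      then show ?thesis using softplus_bounds[of "a + \<theta>"] ln_gt_zero[of "2::real"] by linarith
    qed
    then have "\<bar>softplus (real (Suc n) * t + \<theta>) - max (real (Suc n) * t) 0\<bar> \<le> ln 2 + \<bar>\<theta>\<bar>" .
    moreover have "max (real (Suc n) * t) 0 = real (Suc n) * max t 0" by (simp add: max_def mult_le_0_iff zero_le_mult_iff del: of_nat_Suc)
    ultimately have "\<bar>softplus (real (Suc n) * t + \<theta>) - real (Suc n) * max t 0\<bar> / real (Suc n) \<le> (ln 2 + \<bar>\<theta>\<bar>) / real (Suc n)"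
      by (intro divide_right_mono) auto
    moreover have "\<bar>softplus (real (Suc n) * t + \<theta>) - real (Suc n) * max t 0\<bar> / real (Suc n) = \<bar>softplus (real (Suc n) * t + \<theta>) / real (Suc n) - max t 0\<bar>"
    proof -
      have "softplus (real (Suc n) * t + \<theta>) / real (Suc n) - max t 0
          = (softplus (real (Suc n) * t + \<theta>) - real (Suc n) * max t 0) / real (Suc n)"
        by (simp add: diff_divide_distrib del: of_nat_Suc)
      then show ?thesis by (simp add: abs_divide del: of_nat_Suc)
    qed
    ultimately show ?thesis by simp
  qed
  then show "\<forall>\<^sub>F n in sequentially. norm (softplus (real (Suc n) * t + \<theta>) / real (Suc n) - max t 0) \<le> (ln 2 + \<bar>\<theta>\<bar>) * (1 / real (Suc n))"
    by simp
  show "(\<lambda>n. (ln 2 + \<bar>\<theta>\<bar>) * (1 / real (Suc n))) \<longlonglongrightarrow> 0"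
    using tendsto_mult_left[OF LIMSEQ_Suc[OF lim_1_over_n], of "ln 2 + \<bar>\<theta>\<bar>"] by simp
qed

text \<open>The normalising term tends to max (0 - k) 0, which vanishes because k is not
  negative.\<close>

lemma tendsto_soft_trunc:
  assumes "k \<ge> 0"
  shows "(\<lambda>n. soft_trunc \<theta> k n s) \<longlonglongrightarrow> max (s - k) 0"
  using tendsto_diff[OF tendsto_softplus_scaled[of "s - k" \<theta>] tendsto_softplus_scaled[of "0 - k" \<theta>]] assms
  by (simp add: soft_trunc_def)

lemma tendsto_soft_step:
  "(\<lambda>n. soft_step \<theta> k n s) \<longlonglongrightarrow> (if s > k then 1 else if s = k then logistic \<theta> else 0)"
proof -
  have lin: "filterlim (\<lambda>n. real (Suc n) * c + d) at_top sequentially" if "c > 0" for c d :: real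
    using that by (intro filterlim_tendsto_add_at_top[OF tendsto_const, of _ _ d, unfolded add.commute[of d]]
        filterlim_at_top_mult_tendsto_pos[OF tendsto_const that] filterlim_compose[OF filterlim_real_sequentially filterlim_Suc])
  consider "s > k" | "s = k" | "s < k" by linarith
  then show ?thesis
  proof cases
    case 1
    have "filterlim (\<lambda>n. - (real (Suc n) * (s - k) + \<theta>)) at_bot sequentially"
      using lin[of "s - k" \<theta>] 1 by (simp add: filterlim_uminus_at_top del: of_nat_Suc)
    then have "(\<lambda>n. exp (- (real (Suc n) * (s - k) + \<theta>))) \<longlonglongrightarrow> 0"
      by (rule filterlim_compose[OF exp_at_bot])
    then have "(\<lambda>n. 1 / (1 + exp (- (real (Suc n) * (s - k) + \<theta>)))) \<longlonglongrightarrow> 1 / (1 + 0)"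
      by (intro tendsto_intros) auto
    then show ?thesis using 1 by (simp add: soft_step_def logistic_def del: of_nat_Suc)
  next
    case 2
    then show ?thesis by (simp add: soft_step_def)
  next
    case 3
    have "filterlim (\<lambda>n. real (Suc n) * (k - s) + (- \<theta>)) at_top sequentially" using 3 by (intro lin) auto
    then have top: "filterlim (\<lambda>n. exp (real (Suc n) * (k - s) + (- \<theta>))) at_top sequentially"
      by (rule filterlim_compose[OF exp_at_top])
    have "(\<lambda>n. 1 / (1 + exp (real (Suc n) * (k - s) + (- \<theta>)))) \<longlonglongrightarrow> 0"
      by (intro tendsto_divide_0[OF tendsto_const] filterlim_at_top_imp_at_infinity
          filterlim_tendsto_add_at_top[OF tendsto_const top])
    then show ?thesis using 3 by (simp add: soft_step_def logistic_def algebra_simps del: of_nat_Suc)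
  qed
qed

section \<open>Chain rule and positive parts in H10\<close>

context bounded_open
begin

lemma wpd_test_AE:
  assumes "test_fun \<Omega> \<phi>"
  shows "AE x in lebesgue_on \<Omega>. wpd \<Omega> i \<phi> x = partial i \<phi> x"
  using H1_test(2)[OF assms] by (rule AE_mp) (auto simp: wgrad_def tgrad_def vec_eq_iff)

text \<open>Take test functions converging to \<open>z\<close> in H1 and, along a subsequence,
  almost everywhere. The gradient error splits into F'(\<phi> n) (D \<phi> n - D z), controlled by
  the bound on F', and (F'(\<phi> n) - F'(z)) D z, which vanishes by dominated convergence since F'
  is continuous. The condition F 0 = 0 keeps F \<circ> \<phi> n a test function.\<close>

lemma H10_chain_rule:
  assumes z: "H10 \<Omega> z"
    and smooth: "\<And>\<phi>::real^'d \<Rightarrow> real. smooth_fun \<phi> \<Longrightarrow> smooth_fun (\<lambda>x. F (\<phi> x))" and F0: "F 0 = 0"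
    and deriv: "\<And>s. (F has_real_derivative F' s) (at s)"
    and F'_bound: "\<And>s. \<bar>F' s\<bar> \<le> 1" and F'_cont: "continuous_on UNIV F'"
  shows "H10 \<Omega> (\<lambda>x. F (z x))" "AE x in lebesgue_on \<Omega>. wgrad \<Omega> (\<lambda>x. F (z x)) x = F' (z x) *\<^sub>R wgrad \<Omega> z x"
proof -
  let ?M = "lebesgue_on \<Omega>"
  have Hz: "H1 \<Omega> z" using z by (rule H10_H1)
  have L2z: "L2 \<Omega> z" using Hz by (rule H1_L2)
  note [measurable] = L2_measurable[OF L2z] L2_measurable[OF H1_wpd(1)[OF Hz]]
  have [measurable]: "F' \<in> borel_measurable borel"
    using F'_cont by (rule borel_measurable_continuous_onI)
  have "continuous_on UNIV F"
    using deriv by (auto intro!: continuous_at_imp_continuous_on DERIV_isCont)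
  then have [measurable]: "F \<in> borel_measurable borel" by (rule borel_measurable_continuous_onI)
  have Lip: "\<bar>F s - F t\<bar> \<le> \<bar>s - t\<bar>" for s t
  proof -
    have "norm (F s - F t) \<le> 1 * norm (s - t)"
      by (rule field_differentiable_bound[of UNIV F F']) (use deriv F'_bound in auto)
    then show ?thesis by simp
  qed
  obtain \<phi>0 where \<phi>0: "\<And>n::nat. test_fun \<Omega> (\<phi>0 n)" "(\<lambda>n. H1norm \<Omega> (\<lambda>x. z x - \<phi>0 n x)) \<longlonglongrightarrow> 0"
    using H10_approx[OF z] by metis
  obtain r :: "nat \<Rightarrow> nat" where r: "strict_mono r" "AE x in ?M. (\<lambda>n. \<phi>0 (r n) x) \<longlonglongrightarrow> z x"
    using L2_AE_subseq[OF L2_test[OF \<phi>0(1)] L2z H10_L2_approx[OF z \<phi>0]] by blast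
  define \<phi> where "\<phi> n = \<phi>0 (r n)" for n
  have \<phi>: "test_fun \<Omega> (\<phi> n)" for n by (simp add: \<phi>_def \<phi>0)
  have lim: "(\<lambda>n. H1norm \<Omega> (\<lambda>x. z x - \<phi> n x)) \<longlonglongrightarrow> 0"
    using LIMSEQ_subseq_LIMSEQ[OF \<phi>0(2) r(1)] by (simp add: \<phi>_def o_def)
  have AE\<phi>: "AE x in ?M. (\<lambda>n. \<phi> n x) \<longlonglongrightarrow> z x" using r(2) by (simp add: \<phi>_def)
  have \<phi>m [measurable]: "\<phi> n \<in> borel_measurable ?M" for n by (rule L2_measurable[OF L2_test[OF \<phi>]])
  have sm: "smooth_fun (\<phi> n)" for n using \<phi> by (rule test_fun_smooth)
  have test: "test_fun \<Omega> (\<lambda>x. F (\<phi> n x))" for n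
    by (rule test_fun_tsupp_subset[OF \<phi>[of n] smooth[OF sm]]) (simp add: not_in_tsupp F0)
  have L2F: "L2 \<Omega> (\<lambda>x. F (z x))"
    by (rule L2_AE_bound[OF _ L2z]) (use Lip[of _ 0] F0 in auto)
  have L2g: "L2 \<Omega> (\<lambda>x. F' (z x) * wpd \<Omega> i z x)" for i
  proof (rule L2_AE_bound[OF _ H1_wpd(1)[OF Hz, of i]])
    show "AE x in ?M. \<bar>F' (z x) * wpd \<Omega> i z x\<bar> \<le> \<bar>wpd \<Omega> i z x\<bar>"
      using F'_bound by (intro AE_I2) (simp add: abs_mult mult_left_le_one_le)
  qed measurable
  have su: "(\<lambda>n. L2norm \<Omega> (\<lambda>x. F (\<phi> n x) - F (z x))) \<longlonglongrightarrow> 0"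
  proof (rule Lim_null_comparison[OF _ H10_L2_approx[OF z \<phi> lim]])
    have "L2norm \<Omega> (\<lambda>x. F (\<phi> n x) - F (z x)) \<le> L2norm \<Omega> (\<lambda>x. \<phi> n x - z x)" for n
      using Lip by (intro L2norm_AE_mono L2_diff L2_test test L2F \<phi> L2z AE_I2)
    then show "\<forall>\<^sub>F n in sequentially. norm (L2norm \<Omega> (\<lambda>x. F (\<phi> n x) - F (z x))) \<le> L2norm \<Omega> (\<lambda>x. \<phi> n x - z x)"
      by simp
  qed
  have sg: "(\<lambda>n. L2norm \<Omega> (\<lambda>x. wpd \<Omega> i (\<lambda>x. F (\<phi> n x)) x - F' (z x) * wpd \<Omega> i z x)) \<longlonglongrightarrow> 0" for i
  proof (rule Lim_null_comparison)
    let ?D = "wpd \<Omega> i z"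
    note LD = H1_wpd(1)[OF Hz, of i]
    have L2F': "L2 \<Omega> (\<lambda>x. F' (\<phi> n x) * ?D x)" for n
    proof (rule L2_AE_bound[OF _ LD])
      show "AE x in ?M. \<bar>F' (\<phi> n x) * ?D x\<bar> \<le> \<bar>?D x\<bar>"
        using F'_bound by (intro AE_I2) (simp add: abs_mult mult_left_le_one_le)
    qed measurable
    have L2d: "L2 \<Omega> (\<lambda>x. F' (\<phi> n x) * ?D x - F' (z x) * ?D x)" for n by (intro L2_diff L2F' L2g)
    have dom: "(\<lambda>n. L2norm \<Omega> (\<lambda>x. F' (\<phi> n x) * ?D x - F' (z x) * ?D x)) \<longlonglongrightarrow> 0"
    proof (rule L2_dominated_convergence[OF L2F' L2g L2_scale[OF LD, of 2]])
      fix n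
      show "AE x in ?M. \<bar>F' (\<phi> n x) * ?D x - F' (z x) * ?D x\<bar> \<le> \<bar>2 * ?D x\<bar>"
      proof (rule AE_I2)
        fix x
        have "\<bar>F' (\<phi> n x) - F' (z x)\<bar> \<le> 2" using F'_bound[of "\<phi> n x"] F'_bound[of "z x"] by linarith
        then show "\<bar>F' (\<phi> n x) * ?D x - F' (z x) * ?D x\<bar> \<le> \<bar>2 * ?D x\<bar>"
          by (simp add: left_diff_distrib[symmetric] abs_mult mult_right_mono)
      qed
    next
      show "AE x in ?M. (\<lambda>n. F' (\<phi> n x) * ?D x) \<longlonglongrightarrow> F' (z x) * ?D x"
        using AE\<phi>
      proof eventually_elim
        case (elim x)
        then show ?case using continuous_on_tendsto_compose[OF F'_cont elim] by (intro tendsto_intros) auto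
      qed
    qed
    have "L2norm \<Omega> (\<lambda>x. wpd \<Omega> i (\<lambda>x. F (\<phi> n x)) x - F' (z x) * ?D x)
        \<le> H1norm \<Omega> (\<lambda>x. z x - \<phi> n x) + L2norm \<Omega> (\<lambda>x. F' (\<phi> n x) * ?D x - F' (z x) * ?D x)" for n
    proof -
      let ?w = "\<lambda>x. wpd \<Omega> i (\<phi> n) x - ?D x"
      have Lw: "L2 \<Omega> ?w" by (intro L2_diff H1_wpd H1_test \<phi> Hz)
      have AEw: "AE x in ?M. wpd \<Omega> i (\<lambda>x. F (\<phi> n x)) x - F' (z x) * ?D x
          = F' (\<phi> n x) * ?w x + (F' (\<phi> n x) * ?D x - F' (z x) * ?D x)"
        using wpd_test_AE[OF test[of n], of i] wpd_test_AE[OF \<phi>[of n], of i]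
      proof eventually_elim
        case (elim x)
        then show ?case
          using partial_compose(2)[OF deriv smooth_fun_differentiable[OF sm[of n]], of i x]
          by (simp add: algebra_simps)
      qed
      have L1: "L2 \<Omega> (\<lambda>x. F' (\<phi> n x) * ?w x)"
      proof (rule L2_AE_bound[OF _ Lw])
        show "(\<lambda>x. F' (\<phi> n x) * ?w x) \<in> borel_measurable ?M"
          using L2_measurable[OF Lw] by measurable
        show "AE x in ?M. \<bar>F' (\<phi> n x) * ?w x\<bar> \<le> \<bar>?w x\<bar>"
          using F'_bound by (intro AE_I2) (simp add: abs_mult mult_left_le_one_le)
      qed
      have "L2norm \<Omega> (\<lambda>x. wpd \<Omega> i (\<lambda>x. F (\<phi> n x)) x - F' (z x) * ?D x)
          = L2norm \<Omega> (\<lambda>x. F' (\<phi> n x) * ?w x + (F' (\<phi> n x) * ?D x - F' (z x) * ?D x))"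
        by (intro L2norm_cong_AE L2_diff[OF _ L2g] L2_add L1 L2d H1_wpd H1_test test AEw)
      also have "\<dots> \<le> L2norm \<Omega> (\<lambda>x. F' (\<phi> n x) * ?w x) + L2norm \<Omega> (\<lambda>x. F' (\<phi> n x) * ?D x - F' (z x) * ?D x)"
        by (intro L2norm_triangle L1 L2d)
      also have "L2norm \<Omega> (\<lambda>x. F' (\<phi> n x) * ?w x) \<le> L2norm \<Omega> ?w"
        using F'_bound by (intro L2norm_AE_mono L1 Lw AE_I2) (simp add: abs_mult mult_left_le_one_le)
      also have "L2norm \<Omega> ?w \<le> H1norm \<Omega> (\<lambda>x. z x - \<phi> n x)"
        using L2norm_wpd_diff_le[OF Hz H1_test(1)[OF \<phi>[of n]], of i]
        by (simp add: L2norm_minus_commute[of \<Omega> "wpd \<Omega> i z"])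
      finally show ?thesis by simp
    qed
    then show "\<forall>\<^sub>F n in sequentially. norm (L2norm \<Omega> (\<lambda>x. wpd \<Omega> i (\<lambda>x. F (\<phi> n x)) x - F' (z x) * ?D x))
        \<le> H1norm \<Omega> (\<lambda>x. z x - \<phi> n x) + L2norm \<Omega> (\<lambda>x. F' (\<phi> n x) * ?D x - F' (z x) * ?D x)"
      by simp
    show "(\<lambda>n. H1norm \<Omega> (\<lambda>x. z x - \<phi> n x) + L2norm \<Omega> (\<lambda>x. F' (\<phi> n x) * ?D x - F' (z x) * ?D x)) \<longlonglongrightarrow> 0"
      using tendsto_add[OF lim dom] by simp
  qed
  note L = H10_limit[OF H10_test[OF test] L2F L2g su sg]
  show "H10 \<Omega> (\<lambda>x. F (z x))" by (rule L(1))
  show "AE x in ?M. wgrad \<Omega> (\<lambda>x. F (z x)) x = F' (z x) *\<^sub>R wgrad \<Omega> z x"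
    using L(2) by (rule AE_mp) (auto simp: wgrad_def vec_eq_iff)
qed

text \<open>The value \<open>logistic \<theta>\<close> at \<open>z = k\<close> depends on \<open>\<theta>\<close>, whereas the weak gradient does not;
  hence the gradient of \<open>z\<close> vanishes on the level set \<open>z = k\<close>.\<close>

lemma H10_positive_part_aux:
  assumes z: "H10 \<Omega> z" and k: "k \<ge> 0"
  shows "H10 \<Omega> (\<lambda>x. max (z x - k) 0)"
    and "AE x in lebesgue_on \<Omega>. wgrad \<Omega> (\<lambda>x. max (z x - k) 0) x
      = (if z x > k then 1 else if z x = k then logistic \<theta> else 0) *\<^sub>R wgrad \<Omega> z x"
proof -
  let ?M = "lebesgue_on \<Omega>"
  let ?c = "\<lambda>x. if z x > k then 1 else if z x = k then logistic \<theta> else 0"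
  have Hz: "H1 \<Omega> z" using z by (rule H10_H1)
  have L2z: "L2 \<Omega> z" using Hz by (rule H1_L2)
  note [measurable] = L2_measurable[OF L2z] L2_measurable[OF H1_wpd(1)[OF Hz]]
  have cont: "continuous_on UNIV (soft_step \<theta> k n)" "continuous_on UNIV (soft_trunc \<theta> k n)" for n
    using soft_step_deriv[of \<theta> k n] soft_trunc_deriv[of \<theta> k n]
    by (auto intro!: continuous_at_imp_continuous_on intro: DERIV_isCont)
  have [measurable]: "soft_step \<theta> k n \<in> borel_measurable borel" for n
    by (rule borel_measurable_continuous_onI[OF cont(1)])
  let ?s = "\<lambda>n x. soft_trunc \<theta> k n (z x)"
  have ch: "H10 \<Omega> (?s n)" "AE x in ?M. wgrad \<Omega> (?s n) x = soft_step \<theta> k n (z x) *\<^sub>R wgrad \<Omega> z x" for n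
    using H10_chain_rule[OF z smooth_fun_soft_trunc soft_trunc_0 soft_trunc_deriv soft_step_bounds cont(1)] by auto
  have L2m: "L2 \<Omega> (\<lambda>x. max (z x - k) 0)"
    by (rule L2_AE_bound[OF _ L2z]) (use k in auto)
  have c: "\<bar>?c x\<bar> \<le> 1" for x using logistic_bounds[of \<theta>] by auto
  have L2g: "L2 \<Omega> (\<lambda>x. ?c x * wpd \<Omega> i z x)" for i
  proof (rule L2_AE_bound[OF _ H1_wpd(1)[OF Hz, of i]])
    show "AE x in ?M. \<bar>?c x * wpd \<Omega> i z x\<bar> \<le> \<bar>wpd \<Omega> i z x\<bar>"
      by (intro AE_I2) (metis abs_ge_zero abs_mult c mult_left_le_one_le)
  qed measurable
  have Ls: "L2 \<Omega> (?s n)" for n by (rule H1_L2[OF H10_H1[OF ch(1)]])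
  have st: "\<bar>soft_trunc \<theta> k n t\<bar> \<le> \<bar>t\<bar>" for n t
  proof -
    have "norm (soft_trunc \<theta> k n t - soft_trunc \<theta> k n 0) \<le> 1 * norm (t - 0)"
      by (rule field_differentiable_bound[of UNIV _ "soft_step \<theta> k n"])
        (use soft_trunc_deriv soft_step_bounds in auto)
    then show ?thesis by (simp add: soft_trunc_0)
  qed
  have su: "(\<lambda>n. L2norm \<Omega> (\<lambda>x. ?s n x - max (z x - k) 0)) \<longlonglongrightarrow> 0"
  proof (rule L2_dominated_convergence[OF Ls L2m L2_scale[OF L2z, of 2]])
    show "AE x in ?M. \<bar>?s n x - max (z x - k) 0\<bar> \<le> \<bar>2 * z x\<bar>" for n
    proof (rule AE_I2)
      fix x
      show "\<bar>?s n x - max (z x - k) 0\<bar> \<le> \<bar>2 * z x\<bar>" using st[of n "z x"] k by (auto simp: max_def)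
    qed
    show "AE x in ?M. (\<lambda>n. ?s n x) \<longlonglongrightarrow> max (z x - k) 0" using tendsto_soft_trunc[OF k] by simp
  qed
  have sg: "(\<lambda>n. L2norm \<Omega> (\<lambda>x. wpd \<Omega> i (?s n) x - ?c x * wpd \<Omega> i z x)) \<longlonglongrightarrow> 0" for i
  proof (rule L2_dominated_convergence[OF H1_wpd(1)[OF H10_H1[OF ch(1)]] L2g L2_scale[OF H1_wpd(1)[OF Hz], of 2]])
    have AEn: "AE x in ?M. wpd \<Omega> i (?s n) x = soft_step \<theta> k n (z x) * wpd \<Omega> i z x" for n
      using ch(2)[of n] by (rule AE_mp) (auto simp: wgrad_def vec_eq_iff)
    show "AE x in ?M. \<bar>wpd \<Omega> i (?s n) x - ?c x * wpd \<Omega> i z x\<bar> \<le> \<bar>2 * wpd \<Omega> i z x\<bar>" for n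
      using AEn[of n]
    proof eventually_elim
      case (elim x)
      have "\<bar>soft_step \<theta> k n (z x) - ?c x\<bar> \<le> 2" using soft_step_bounds[of \<theta> k n "z x"] c[of x] by linarith
      then have "\<bar>soft_step \<theta> k n (z x) - ?c x\<bar> * \<bar>wpd \<Omega> i z x\<bar> \<le> 2 * \<bar>wpd \<Omega> i z x\<bar>" by (rule mult_right_mono) simp
      then show ?case unfolding elim left_diff_distrib[symmetric] abs_mult by simp
    qed
    have "AE x in ?M. \<forall>n. wpd \<Omega> i (?s n) x = soft_step \<theta> k n (z x) * wpd \<Omega> i z x"
      using AEn by (simp add: AE_all_countable)
    then show "AE x in ?M. (\<lambda>n. wpd \<Omega> i (?s n) x) \<longlonglongrightarrow> ?c x * wpd \<Omega> i z x"
    proof eventually_elim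
      case (elim x)
      then show ?case using tendsto_mult_right[OF tendsto_soft_step[of \<theta> k "z x"], of "wpd \<Omega> i z x"] by simp
    qed
  qed
  note L = H10_limit[OF ch(1) L2m L2g su sg]
  show "H10 \<Omega> (\<lambda>x. max (z x - k) 0)" by (rule L(1))
  show "AE x in ?M. wgrad \<Omega> (\<lambda>x. max (z x - k) 0) x = ?c x *\<^sub>R wgrad \<Omega> z x"
    using L(2) by (rule AE_mp) (auto simp: wgrad_def vec_eq_iff)
qed

lemma H10_positive_part:
  assumes z: "H10 \<Omega> z" and k: "k \<ge> 0"
  shows "H10 \<Omega> (\<lambda>x. max (z x - k) 0)"
    and "AE x in lebesgue_on \<Omega>. z x = k \<longrightarrow> wgrad \<Omega> z x = 0"
    and "AE x in lebesgue_on \<Omega>. wgrad \<Omega> (\<lambda>x. max (z x - k) 0) x = (if z x > k then wgrad \<Omega> z x else 0)"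
proof -
  show "H10 \<Omega> (\<lambda>x. max (z x - k) 0)" by (rule H10_positive_part_aux[OF z k])
  have ne: "logistic 0 \<noteq> logistic 1" by (simp add: logistic_def field_simps)
  show lev: "AE x in lebesgue_on \<Omega>. z x = k \<longrightarrow> wgrad \<Omega> z x = 0"
    using H10_positive_part_aux(2)[OF z k, of 0] H10_positive_part_aux(2)[OF z k, of 1]
    by eventually_elim (use ne in \<open>auto split: if_splits\<close>)
  show "AE x in lebesgue_on \<Omega>. wgrad \<Omega> (\<lambda>x. max (z x - k) 0) x = (if z x > k then wgrad \<Omega> z x else 0)"
    using H10_positive_part_aux(2)[OF z k, of 0] lev by eventually_elim auto
qed

end

section \<open>A gradient estimate for drift-dominated equations\<close>

text \<open>The level k' is the infimum of all levels above k whose superlevel set has measure at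
  most a. The measure of the strict superlevel set is right-continuous in the level, so k' itself
  qualifies; below k' the measure exceeds a, so at most b is left for the open slice. The level set
  f = k' belongs to neither set and may be large; this is harmless later because the gradient
  vanishes there.\<close>

lemma (in finite_measure) split_level:
  fixes f :: "'a \<Rightarrow> real"
  assumes f [measurable]: "f \<in> borel_measurable M"
    and a: "a > 0" and b: "b \<ge> 0" and k: "measure M {x \<in> space M. f x > k} \<le> a + b"
  shows "\<exists>k'\<ge>k. measure M {x \<in> space M. f x > k'} \<le> a \<and> measure M {x \<in> space M. k < f x \<and> f x < k'} \<le> b"
proof -
  define m where "m s = measure M {x \<in> space M. f x > s}" for s
  have anti: "m t \<le> m s" if "s \<le> t" for s t
    unfolding m_def using that by (intro finite_measure_mono) auto
  define S where "S = {s. s \<ge> k \<and> m s \<le> a}"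
  have "(\<lambda>j. measure M {x \<in> space M. f x > k + real j}) \<longlonglongrightarrow> measure M (\<Inter>j. {x \<in> space M. f x > k + real j})"
    by (intro finite_Lim_measure_decseq) (auto simp: decseq_def)
  moreover have "(\<Inter>j. {x \<in> space M. f x > k + real j}) = {}"
  proof -
    have False if "\<And>j. f x > k + real j" for x
      using that reals_Archimedean2[of "f x - k"] by (metis diff_less_eq add.commute less_asym)
    then show ?thesis by auto
  qed
  ultimately have "(\<lambda>j. m (k + real j)) \<longlonglongrightarrow> 0" by (simp add: m_def)
  from order_tendstoD(2)[OF this a] obtain j where "m (k + real j) < a"
    by (auto simp: eventually_sequentially)
  then have S_ne: "S \<noteq> {}" by (auto simp: S_def intro!: exI[of _ "k + real j"])
  have S_bdd: "bdd_below S" by (auto simp: S_def bdd_below_def)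
  define k' where "k' = Inf S"
  have kk': "k \<le> k'" unfolding k'_def using S_ne by (intro cInf_greatest) (auto simp: S_def)
  have above: "m s \<le> a" if s: "s > k'" for s
  proof -
    obtain t where "t \<in> S" "t < s" using s cInf_less_iff[OF S_ne S_bdd, of s] by (auto simp: k'_def)
    then show ?thesis using anti[of t s] by (auto simp: S_def)
  qed
  have below: "m s > a" if "s < k'" "k \<le> s" for s
    using that cInf_lower[OF _ S_bdd, of s] by (force simp: S_def k'_def)
  \<comment> \<open>Right-continuity: the strict superlevel sets at k' + 1 / (j + 1) increase to the
    one at k'.\<close>
  have "m k' \<le> a"
  proof -
    have "(\<lambda>j. m (k' + 1 / real (Suc j))) \<longlonglongrightarrow> measure M (\<Union>j. {x \<in> space M. f x > k' + 1 / real (Suc j)})"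
      unfolding m_def
    proof (rule finite_Lim_measure_incseq)
      show "incseq (\<lambda>j. {x \<in> space M. f x > k' + 1 / real (Suc j)})"
      proof (rule incseq_SucI, rule subsetI)
        fix j x assume "x \<in> {x \<in> space M. f x > k' + 1 / real (Suc j)}"
        moreover have "1 / real (Suc (Suc j)) \<le> 1 / real (Suc j)" by (simp add: field_simps)
        ultimately show "x \<in> {x \<in> space M. f x > k' + 1 / real (Suc (Suc j))}" by auto
      qed
    qed auto
    moreover have "(\<Union>j. {x \<in> space M. f x > k' + 1 / real (Suc j)}) = {x \<in> space M. f x > k'}"
    proof (intro equalityI subsetI)
      fix x assume x: "x \<in> {x \<in> space M. f x > k'}"
      then obtain j where "inverse (real (Suc j)) < f x - k'" using reals_Archimedean[of "f x - k'"] by auto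
      then show "x \<in> (\<Union>j. {x \<in> space M. f x > k' + 1 / real (Suc j)})"
        using x by (auto simp: inverse_eq_divide intro!: exI[of _ j])
    next
      fix x assume "x \<in> (\<Union>j. {x \<in> space M. f x > k' + 1 / real (Suc j)})"
      then obtain j where "x \<in> space M" "f x > k' + 1 / real (Suc j)" by auto
      moreover have "k' < k' + 1 / real (Suc j)" by simp
      ultimately show "x \<in> {x \<in> space M. f x > k'}" using less_trans by blast
    qed
    ultimately have "(\<lambda>j. m (k' + 1 / real (Suc j))) \<longlonglongrightarrow> m k'" by (simp add: m_def)
    then show ?thesis by (rule LIMSEQ_le_const2) (auto intro!: above)
  qed
  moreover have "measure M {x \<in> space M. k < f x \<and> f x < k'} \<le> b"
  proof (cases "k < k'")
    case False
    then have "{x \<in> space M. k < f x \<and> f x < k'} = {}" by auto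
    then show ?thesis using b by (simp only: measure_empty)
  next
    case True
    define s where "s j = max k (k' - 1 / real (Suc j))" for j
    have s: "s j < k'" "k \<le> s j" for j using True by (auto simp: s_def)
    \<comment> \<open>This is the difference of the superlevel sets at k and at s j: measure at most
      a + b minus more than a.\<close>
    have "measure M {x \<in> space M. k < f x \<and> f x \<le> s j} \<le> b" for j
    proof -
      have "{x \<in> space M. k < f x \<and> f x \<le> s j} = {x \<in> space M. f x > k} - {x \<in> space M. f x > s j}" by auto
      moreover have "measure M ({x \<in> space M. f x > k} - {x \<in> space M. f x > s j}) = m k - m (s j)"
        unfolding m_def
      proof (rule finite_measure_Diff)
        show "{x \<in> space M. f x > s j} \<subseteq> {x \<in> space M. f x > k}"
          using s(2)[of j] by (auto intro: le_less_trans)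
      qed measurable
      ultimately have "measure M {x \<in> space M. k < f x \<and> f x \<le> s j} = m k - m (s j)" by simp
      then show ?thesis using below[OF s(1) s(2), of j] k by (simp add: m_def)
    qed
    moreover have "(\<lambda>j. measure M {x \<in> space M. k < f x \<and> f x \<le> s j}) \<longlonglongrightarrow> measure M (\<Union>j. {x \<in> space M. k < f x \<and> f x \<le> s j})"
    proof (rule finite_Lim_measure_incseq)
      show "incseq (\<lambda>j. {x \<in> space M. k < f x \<and> f x \<le> s j})"
      proof (rule incseq_SucI, rule subsetI)
        fix j x assume "x \<in> {x \<in> space M. k < f x \<and> f x \<le> s j}"
        moreover have "1 / real (Suc (Suc j)) \<le> 1 / real (Suc j)" by (simp add: field_simps)
        then have "s j \<le> s (Suc j)" unfolding s_def by (intro max.mono) auto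
        ultimately show "x \<in> {x \<in> space M. k < f x \<and> f x \<le> s (Suc j)}" by auto
      qed
    qed auto
    moreover have "(\<Union>j. {x \<in> space M. k < f x \<and> f x \<le> s j}) = {x \<in> space M. k < f x \<and> f x < k'}"
    proof (intro equalityI subsetI)
      fix x assume x: "x \<in> {x \<in> space M. k < f x \<and> f x < k'}"
      then obtain j where "inverse (real (Suc j)) < k' - f x" using reals_Archimedean[of "k' - f x"] by auto
      then have "f x \<le> s j" by (auto simp: inverse_eq_divide s_def)
      then show "x \<in> (\<Union>j. {x \<in> space M. k < f x \<and> f x \<le> s j})" using x by auto
    qed (use s(1) in \<open>auto intro: le_less_trans\<close>)
    ultimately have lim: "(\<lambda>j. measure M {x \<in> space M. k < f x \<and> f x \<le> s j}) \<longlonglongrightarrow> measure M {x \<in> space M. k < f x \<and> f x < k'}"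
      and le: "\<And>j. measure M {x \<in> space M. k < f x \<and> f x \<le> s j} \<le> b" by simp_all
    show ?thesis by (rule LIMSEQ_le_const2[OF lim]) (use le in blast)
  qed
  ultimately show ?thesis using kk' by (auto simp: m_def)
qed

section \<open>Testing the equation with slices of the solution\<close>

context bounded_open
begin

definition energy :: "real \<Rightarrow> (real^'d \<Rightarrow> real) \<Rightarrow> (real^'d \<Rightarrow> real) \<Rightarrow> real" where
  "energy lam u v = integral\<^sup>L (lebesgue_on \<Omega>) (\<lambda>x. wgrad \<Omega> u x \<bullet> wgrad \<Omega> v x + lam * u x * v x)"

lemma energy_eq:
  assumes "H1 \<Omega> u" "H1 \<Omega> v"
  shows "energy lam u v = integral\<^sup>L (lebesgue_on \<Omega>) (\<lambda>x. wgrad \<Omega> u x \<bullet> wgrad \<Omega> v x) + lam * L2ip \<Omega> u v"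
  unfolding energy_def L2ip_def
  using L2_grad_inner[OF assms] L2_mult_integrable[OF H1_L2[OF assms(1)] H1_L2[OF assms(2)]]
  by (simp add: mult.assoc)

text \<open>The contribution of the set \<open>S\<close> is absorbed because \<open>\<parallel>v\<parallel>\<close> on a small set is at most
  \<open>\<delta> \<parallel>\<nabla>v\<parallel>\<close>.\<close>

lemma slice_estimate:
  assumes lam: "lam \<ge> 0" and CH: "CH \<ge> 0" and P: "P > 0" "\<And>u. H10 \<Omega> u \<Longrightarrow> L2norm \<Omega> u \<le> P * gnorm u"
    and z: "H10 \<Omega> z" and q: "L2 \<Omega> q" and g: "L2 \<Omega> g"
    and q_le: "AE x in lebesgue_on \<Omega>. \<bar>q x\<bar> \<le> CH * norm (wgrad \<Omega> z x) + \<bar>g x\<bar>"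
    and v: "H10 \<Omega> v" "\<And>x. v x \<ge> 0" "\<And>x. z x * v x \<ge> 0" and eq: "energy lam z v = L2ip \<Omega> q v"
    and grad_v: "AE x in lebesgue_on \<Omega>. wgrad \<Omega> v x = (if x \<in> S then wgrad \<Omega> z x else 0)"
    and S: "S \<in> sets lebesgue" and small: "L2norm \<Omega> (\<lambda>x. indicator S x * v x) \<le> \<delta> * gnorm v"
    and \<delta>: "CH * \<delta> \<le> 1/2"
    and t: "L2 \<Omega> t" "\<And>x. t x \<ge> 0"
    and out: "AE x in lebesgue_on \<Omega>. x \<notin> S \<longrightarrow> v x \<noteq> 0 \<longrightarrow> norm (wgrad \<Omega> z x) \<le> t x"
  shows "gnorm v \<le> 2 * P * (CH * L2norm \<Omega> t + L2norm \<Omega> g)"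
proof -
  let ?M = "lebesgue_on \<Omega>"
  have Hz: "H1 \<Omega> z" and Hv: "H1 \<Omega> v" using z v(1) H10_H1 by auto
  have Lv: "L2 \<Omega> v" and Lz: "L2 \<Omega> z" using Hz Hv H1_L2 by auto
  note Ldv = L2_norm_wgrad(1)[OF Hv]
  have Sm: "indicat_real S \<in> borel_measurable ?M"
    using S by (intro measurable_restrict_space1 borel_measurable_indicator)
  have LSv: "L2 \<Omega> (\<lambda>x. indicator S x * v x)"
    by (rule L2_AE_bound[OF borel_measurable_times[OF Sm L2_measurable[OF Lv]] Lv]) (auto simp: indicator_def)
  have gg: "(gnorm v)\<^sup>2 = (\<integral>x. wgrad \<Omega> z x \<bullet> wgrad \<Omega> v x \<partial>?M)"
    unfolding gnorm_def L2norm_sq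
  proof (rule integral_cong_AE)
    show "AE x in ?M. (norm (wgrad \<Omega> v x))\<^sup>2 = wgrad \<Omega> z x \<bullet> wgrad \<Omega> v x"
      using grad_v by eventually_elim (auto simp: power2_norm_eq_inner)
  qed (use wgrad_measurable[OF Hz] wgrad_measurable[OF Hv] in measurable)
  also have "\<dots> = L2ip \<Omega> q v - lam * L2ip \<Omega> z v"
    using eq energy_eq[OF Hz Hv, of lam] by simp
  \<comment> \<open>The zeroth-order term has a good sign, since z * v and lam are nonnegative, and
    is dropped.\<close>
  also have "\<dots> \<le> L2ip \<Omega> q v"
    using lam v(3) unfolding L2ip_def by (simp add: integral_nonneg_AE mult_nonneg_nonneg)
  \<comment> \<open>The drift is split: on S the gradients of z and v agree, and off S, where v is
    nonzero, the gradient of z is bounded by the known function t.\<close>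
  also have "\<dots> \<le> (\<integral>x. CH * (norm (wgrad \<Omega> v x) * (indicator S x * v x)) + (CH * (t x * v x) + \<bar>g x\<bar> * v x) \<partial>?M)"
    unfolding L2ip_def
  proof (rule integral_mono_AE)
    show "integrable ?M (\<lambda>x. q x * v x)" by (rule L2_mult_integrable[OF q Lv])
    show "integrable ?M (\<lambda>x. CH * (norm (wgrad \<Omega> v x) * (indicator S x * v x)) + (CH * (t x * v x) + \<bar>g x\<bar> * v x))"
      by (intro Bochner_Integration.integrable_add integrable_mult_right L2_mult_integrable Ldv LSv t Lv L2_abs g)
    show "AE x in ?M. q x * v x \<le> CH * (norm (wgrad \<Omega> v x) * (indicator S x * v x)) + (CH * (t x * v x) + \<bar>g x\<bar> * v x)"
      using q_le grad_v out
    proof eventually_elim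
      case (elim x)
      have A: "q x * v x \<le> (CH * norm (wgrad \<Omega> z x) + \<bar>g x\<bar>) * v x"
        using elim(1) v(2)[of x] by (intro mult_right_mono) auto
      have B: "CH * norm (wgrad \<Omega> z x) * v x \<le> CH * (norm (wgrad \<Omega> v x) * (indicator S x * v x)) + CH * (t x * v x)"
      proof (cases "x \<in> S \<or> v x = 0")
        case True
        then show ?thesis using elim(2) CH t(2)[of x] v(2)[of x] by auto
      next
        case False
        then have "norm (wgrad \<Omega> z x) * v x \<le> t x * v x" using elim(3) v(2)[of x] by (intro mult_right_mono) auto
        then show ?thesis using False CH by (simp add: mult.assoc mult_left_mono)
      qed
      from A B show ?case unfolding distrib_right by linarith
    qed
  qed
  also have "\<dots> = CH * L2ip \<Omega> (\<lambda>x. norm (wgrad \<Omega> v x)) (\<lambda>x. indicator S x * v x)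
      + (CH * L2ip \<Omega> t v + L2ip \<Omega> (\<lambda>x. \<bar>g x\<bar>) v)"
    unfolding L2ip_def using L2_mult_integrable[OF Ldv LSv] L2_mult_integrable[OF t(1) Lv] L2_mult_integrable[OF L2_abs[OF g] Lv]
    by simp
  also have "\<dots> \<le> CH * (gnorm v * (\<delta> * gnorm v)) + (CH * (L2norm \<Omega> t * (P * gnorm v)) + L2norm \<Omega> g * (P * gnorm v))"
  proof (intro add_mono mult_left_mono CH)
    have "L2ip \<Omega> (\<lambda>x. norm (wgrad \<Omega> v x)) (\<lambda>x. indicator S x * v x) \<le> gnorm v * L2norm \<Omega> (\<lambda>x. indicator S x * v x)"
      using L2_Cauchy_Schwarz[OF Ldv LSv] by (simp add: gnorm_def)
    also have "\<dots> \<le> gnorm v * (\<delta> * gnorm v)" using small by (intro mult_left_mono) auto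
    finally show "L2ip \<Omega> (\<lambda>x. norm (wgrad \<Omega> v x)) (\<lambda>x. indicator S x * v x) \<le> gnorm v * (\<delta> * gnorm v)" .
    have "L2ip \<Omega> t v \<le> L2norm \<Omega> t * L2norm \<Omega> v" using L2_Cauchy_Schwarz[OF t(1) Lv] by simp
    also have "\<dots> \<le> L2norm \<Omega> t * (P * gnorm v)" using P(2)[OF v(1)] by (intro mult_left_mono) auto
    finally show "L2ip \<Omega> t v \<le> L2norm \<Omega> t * (P * gnorm v)" .
    have "L2ip \<Omega> (\<lambda>x. \<bar>g x\<bar>) v \<le> L2norm \<Omega> g * L2norm \<Omega> v"
      using L2_Cauchy_Schwarz[OF L2_abs[OF g] Lv] by (simp add: L2norm_def)
    also have "\<dots> \<le> L2norm \<Omega> g * (P * gnorm v)" using P(2)[OF v(1)] by (intro mult_left_mono) auto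
    finally show "L2ip \<Omega> (\<lambda>x. \<bar>g x\<bar>) v \<le> L2norm \<Omega> g * (P * gnorm v)" .
  qed
  \<comment> \<open>The smallness of CH * \<delta> lets half of the left-hand side absorb the drift
    on S.\<close>
  also have "CH * (gnorm v * (\<delta> * gnorm v)) \<le> 1/2 * (gnorm v)\<^sup>2"
    using mult_right_mono[OF \<delta>, of "(gnorm v)\<^sup>2"] by (simp add: power2_eq_square mult_ac)
  finally have "gnorm v * gnorm v \<le> gnorm v * (2 * P * (CH * L2norm \<Omega> t + L2norm \<Omega> g))"
    by (simp add: power2_eq_square algebra_simps)
  moreover have "0 \<le> 2 * P * (CH * L2norm \<Omega> t + L2norm \<Omega> g)"
    using P(1) CH by (intro mult_nonneg_nonneg add_nonneg_nonneg) auto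
  ultimately show ?thesis using gnorm_nonneg[of v]
    by (cases "gnorm v = 0") (auto dest!: mult_left_le_imp_le)
qed

text \<open>z solves - Laplace z + lam z = q weakly, where q is known only through a bound linear in
  |Dz|. No drift field is mentioned, so one constant covers all of them, and the class is stable
  under z to -z.\<close>

definition drift_sol :: "real \<Rightarrow> real \<Rightarrow> (real^'d \<Rightarrow> real) \<Rightarrow> (real^'d \<Rightarrow> real) \<Rightarrow> bool" where
  "drift_sol lam CH z g \<longleftrightarrow> H10 \<Omega> z \<and> L2 \<Omega> g \<and> (\<exists>q. L2 \<Omega> q \<and> (\<forall>v. H10 \<Omega> v \<longrightarrow> energy lam z v = L2ip \<Omega> q v) \<and>
     (AE x in lebesgue_on \<Omega>. \<bar>q x\<bar> \<le> CH * norm (wgrad \<Omega> z x) + \<bar>g x\<bar>))"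

lemma measure_level_sets:
  assumes "z \<in> borel_measurable (lebesgue_on \<Omega>)" "Measurable.pred borel Q"
  shows "{x \<in> \<Omega>. Q (z x)} \<in> sets lebesgue"
    "emeasure lebesgue {x \<in> \<Omega>. Q (z x)} = ennreal (measure (lebesgue_on \<Omega>) {x \<in> \<Omega>. Q (z x)})"
proof -
  interpret finite_measure "lebesgue_on \<Omega>" using dom_lmeasurable by (rule finite_measure_lebesgue_on)
  note [measurable] = assms
  have s: "{x \<in> space (lebesgue_on \<Omega>). Q (z x)} \<in> sets (lebesgue_on \<Omega>)" by measurable
  then have s: "{x \<in> \<Omega>. Q (z x)} \<in> sets (lebesgue_on \<Omega>)" by simp
  then show "{x \<in> \<Omega>. Q (z x)} \<in> sets lebesgue"
    using dom_sets by (subst (asm) sets_restrict_space_iff) auto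
  have "emeasure (lebesgue_on \<Omega>) {x \<in> \<Omega>. Q (z x)} = emeasure lebesgue {x \<in> \<Omega>. Q (z x)}"
    using dom_sets by (intro emeasure_restrict_space) auto
  then show "emeasure lebesgue {x \<in> \<Omega>. Q (z x)} = ennreal (measure (lebesgue_on \<Omega>) {x \<in> \<Omega>. Q (z x)})"
    using emeasure_eq_measure by simp
qed

text \<open>Induction on the number of slices: each slice of small measure contributes one factor.\<close>

lemma truncated_estimate:
  assumes lam: "lam \<ge> 0" and CH: "CH > 0" and P: "P > 0" "\<And>u. H10 \<Omega> u \<Longrightarrow> L2norm \<Omega> u \<le> P * gnorm u"
    and \<epsilon>: "\<epsilon> > 0" "\<And>u E. H10 \<Omega> u \<Longrightarrow> E \<in> sets lebesgue \<Longrightarrow> emeasure lebesgue E \<le> ennreal \<epsilon> \<Longrightarrow>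
      L2norm \<Omega> (\<lambda>x. indicator E x * u x) \<le> 1 / (2 * CH) * gnorm u"
  shows "\<exists>C\<ge>0. \<forall>z g k. drift_sol lam CH z g \<longrightarrow> k \<ge> 0 \<longrightarrow> measure (lebesgue_on \<Omega>) {x \<in> \<Omega>. z x > k} \<le> real (Suc n) * \<epsilon> \<longrightarrow>
      gnorm (\<lambda>x. max (z x - k) 0) \<le> C * L2norm \<Omega> g"
proof (induction n)
  case 0
  \<comment> \<open>A single slice without upper end: S is the whole superlevel set and no region
    lies above it, so t = 0.\<close>
  have "gnorm (\<lambda>x. max (z x - k) 0) \<le> 2 * P * L2norm \<Omega> g"
    if sub: "drift_sol lam CH z g" and k: "k \<ge> 0" and m: "measure (lebesgue_on \<Omega>) {x \<in> \<Omega>. z x > k} \<le> real (Suc 0) * \<epsilon>" for z g k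
  proof -
    obtain q where z: "H10 \<Omega> z" and g: "L2 \<Omega> g" and q: "L2 \<Omega> q" "\<And>v. H10 \<Omega> v \<Longrightarrow> energy lam z v = L2ip \<Omega> q v"
        "AE x in lebesgue_on \<Omega>. \<bar>q x\<bar> \<le> CH * norm (wgrad \<Omega> z x) + \<bar>g x\<bar>"
      using sub unfolding drift_sol_def by blast
    note pp = H10_positive_part[OF z k]
    note ms = measure_level_sets[OF L2_measurable[OF H1_L2[OF H10_H1[OF z]]], of "\<lambda>s. s > k"]
    have S: "{x \<in> \<Omega>. z x > k} \<in> sets lebesgue" by (rule ms) measurable
    have "emeasure lebesgue {x \<in> \<Omega>. z x > k} \<le> ennreal \<epsilon>"
      using m by (subst ms(2)) (auto intro!: ennreal_leI)
    note small = \<epsilon>(2)[OF pp(1) S this]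
    have "AE x in lebesgue_on \<Omega>. x \<in> \<Omega>" by (rule AE_I2) simp
    then have gv: "AE x in lebesgue_on \<Omega>. wgrad \<Omega> (\<lambda>x. max (z x - k) 0) x
        = (if x \<in> {x \<in> \<Omega>. z x > k} then wgrad \<Omega> z x else 0)"
      using pp(3) by eventually_elim auto
    have "gnorm (\<lambda>x. max (z x - k) 0) \<le> 2 * P * (CH * L2norm \<Omega> (\<lambda>x. 0) + L2norm \<Omega> g)"
    proof (rule slice_estimate[OF lam less_imp_le[OF CH] P z q(1) g q(3) pp(1) _ _ q(2)[OF pp(1)] gv S small])
      show "CH * (1 / (2 * CH)) \<le> 1/2" using CH by simp
      show "z x * max (z x - k) 0 \<ge> 0" for x using k by (simp add: max_def)
      show "AE x in lebesgue_on \<Omega>. x \<notin> {x \<in> \<Omega>. z x > k} \<longrightarrow> max (z x - k) 0 \<noteq> 0 \<longrightarrow> norm (wgrad \<Omega> z x) \<le> 0"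
        by (rule AE_I2) (auto simp: max_def split: if_splits)
    qed auto
    then show ?thesis by (simp add: L2norm_def)
  qed
  then show ?case using P(1) by (intro exI[of _ "2 * P"]) auto
next
  case (Suc n)
  then obtain C where C: "C \<ge> 0" "\<And>z g k. drift_sol lam CH z g \<Longrightarrow> k \<ge> 0 \<Longrightarrow>
      measure (lebesgue_on \<Omega>) {x \<in> \<Omega>. z x > k} \<le> real (Suc n) * \<epsilon> \<Longrightarrow> gnorm (\<lambda>x. max (z x - k) 0) \<le> C * L2norm \<Omega> g"
    by blast
  have "gnorm (\<lambda>x. max (z x - k) 0) \<le> (C + 2 * P * (CH * C + 1)) * L2norm \<Omega> g"
    if sub: "drift_sol lam CH z g" and k: "k \<ge> 0" and m: "measure (lebesgue_on \<Omega>) {x \<in> \<Omega>. z x > k} \<le> real (Suc (Suc n)) * \<epsilon>" for z g k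
  proof -
    obtain q where z: "H10 \<Omega> z" and g: "L2 \<Omega> g" and q: "L2 \<Omega> q" "\<And>v. H10 \<Omega> v \<Longrightarrow> energy lam z v = L2ip \<Omega> q v"
        "AE x in lebesgue_on \<Omega>. \<bar>q x\<bar> \<le> CH * norm (wgrad \<Omega> z x) + \<bar>g x\<bar>"
      using sub unfolding drift_sol_def by blast
    interpret finite_measure "lebesgue_on \<Omega>" using dom_lmeasurable by (rule finite_measure_lebesgue_on)
    have zm: "z \<in> borel_measurable (lebesgue_on \<Omega>)" by (rule L2_measurable[OF H1_L2[OF H10_H1[OF z]]])
    have pos: "real (Suc n) * \<epsilon> > 0" using \<epsilon>(1) by simp
    have m': "measure (lebesgue_on \<Omega>) {x \<in> space (lebesgue_on \<Omega>). z x > k} \<le> real (Suc n) * \<epsilon> + \<epsilon>"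
      using m by (simp add: algebra_simps)
    obtain k' where k': "k' \<ge> k" "measure (lebesgue_on \<Omega>) {x \<in> \<Omega>. z x > k'} \<le> real (Suc n) * \<epsilon>"
        "measure (lebesgue_on \<Omega>) {x \<in> \<Omega>. k < z x \<and> z x < k'} \<le> \<epsilon>"
      using split_level[OF zm pos less_imp_le[OF \<epsilon>(1)] m'] by auto
    have k'0: "k' \<ge> 0" using k k' by simp
    let ?w = "\<lambda>x. max (z x - k') 0" and ?p = "\<lambda>x. max (z x - k) 0"
    let ?v = "\<lambda>x. ?p x - ?w x" and ?S = "{x \<in> \<Omega>. k < z x \<and> z x < k'}"
    note pp = H10_positive_part[OF z k] and pw = H10_positive_part[OF z k'0]
    have v: "H10 \<Omega> ?v" by (rule H10_diff[OF pp(1) pw(1)])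
    note ms = measure_level_sets[OF zm, of "\<lambda>s. k < s \<and> s < k'"]
    have S: "?S \<in> sets lebesgue" by (rule ms) measurable
    have "emeasure lebesgue ?S \<le> ennreal \<epsilon>"
      using k'(3) by (subst ms(2)) (auto intro!: ennreal_leI)
    note small = \<epsilon>(2)[OF v S this]
    have dom: "AE x in lebesgue_on \<Omega>. x \<in> \<Omega>" by (rule AE_I2) simp
    \<comment> \<open>On the level set z = k', which is not part of the slice, both sides vanish
      because the gradient of z does.\<close>
    have gv: "AE x in lebesgue_on \<Omega>. wgrad \<Omega> ?v x = (if x \<in> ?S then wgrad \<Omega> z x else 0)"
      using H1_diff(2)[OF H10_H1[OF pp(1)] H10_H1[OF pw(1)]] pp(3) pw(3) pw(2) dom
    proof eventually_elim
      case (elim x)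
      then show ?case using k'(1) by (cases "z x = k'") auto
    qed
    \<comment> \<open>The induction hypothesis applies to the same z and g, with the higher level
      k'.\<close>
    have wb: "gnorm ?w \<le> C * L2norm \<Omega> g" by (rule C(2)[OF sub k'0 k'(2)])
    \<comment> \<open>Above k' the slice function is the constant k' - k: its gradient vanishes but
      the drift tested against it does not. There Dz is the gradient of the upper truncation
      \<open>?w\<close>, which is already estimated and takes the role of t.\<close>
    have "gnorm ?v \<le> 2 * P * (CH * L2norm \<Omega> (\<lambda>x. norm (wgrad \<Omega> ?w x)) + L2norm \<Omega> g)"
    proof (rule slice_estimate[OF lam less_imp_le[OF CH] P z q(1) g q(3) v _ _ q(2)[OF v] gv S small])
      show "CH * (1 / (2 * CH)) \<le> 1/2" using CH by simp
      show "?v x \<ge> 0" for x using k'(1) by (simp add: max_def)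
      then show "z x * ?v x \<ge> 0" for x using k k' by (cases "z x \<ge> 0") (auto simp: max_def)
      show "L2 \<Omega> (\<lambda>x. norm (wgrad \<Omega> ?w x))" by (intro L2_norm_wgrad H10_H1 pw)
      show "AE x in lebesgue_on \<Omega>. x \<notin> ?S \<longrightarrow> ?v x \<noteq> 0 \<longrightarrow> norm (wgrad \<Omega> z x) \<le> norm (wgrad \<Omega> ?w x)"
        using pw(2,3) dom
      proof eventually_elim
        case (elim x)
        then show ?case by (cases "z x = k'"; cases "z x > k'") (auto simp: max_def split: if_splits)
      qed
    qed auto
    also have "\<dots> \<le> 2 * P * (CH * (C * L2norm \<Omega> g) + L2norm \<Omega> g)"
      using wb P(1) CH unfolding gnorm_def by (intro mult_left_mono add_mono) auto
    finally have vb: "gnorm ?v \<le> 2 * P * (CH * (C * L2norm \<Omega> g) + L2norm \<Omega> g)" .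
    have "gnorm ?p \<le> gnorm ?w + gnorm ?v"
      using gnorm_triangle[OF H10_H1[OF pw(1)] H10_H1[OF v]] by simp
    also have "\<dots> \<le> (C + 2 * P * (CH * C + 1)) * L2norm \<Omega> g"
      using wb vb by (simp add: algebra_simps)
    finally show ?thesis .
  qed
  then show ?case using P(1) CH C(1) by (intro exI[of _ "C + 2 * P * (CH * C + 1)"]) auto
qed

text \<open>At level 0 the superlevel set has at most the measure of the domain, so the number of
  slices depends only on that measure and on \<epsilon>, not on z. The same estimate for -z controls
  the negative part and doubles the constant.\<close>

theorem gradient_estimate:
  assumes lam: "lam \<ge> 0" and CH: "CH > 0"
  shows "\<exists>C\<ge>0. \<forall>z g. drift_sol lam CH z g \<longrightarrow> gnorm z \<le> C * L2norm \<Omega> g"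
proof -
  obtain P where P: "P > 0" "\<And>u. H10 \<Omega> u \<Longrightarrow> L2norm \<Omega> u \<le> P * gnorm u" using Poincare by blast
  have "1 / (2 * CH) > 0" using CH by simp
  then obtain \<epsilon> where \<epsilon>: "\<epsilon> > 0" "\<And>u E. H10 \<Omega> u \<Longrightarrow> E \<in> sets lebesgue \<Longrightarrow> emeasure lebesgue E \<le> ennreal \<epsilon> \<Longrightarrow>
      L2norm \<Omega> (\<lambda>x. indicator E x * u x) \<le> 1 / (2 * CH) * gnorm u"
    using small_set_estimate by blast
  interpret finite_measure "lebesgue_on \<Omega>" using dom_lmeasurable by (rule finite_measure_lebesgue_on)
  obtain n where n: "measure (lebesgue_on \<Omega>) \<Omega> / \<epsilon> \<le> real n" using real_arch_simple by blast
  have all: "measure (lebesgue_on \<Omega>) {x \<in> \<Omega>. z x > 0} \<le> real (Suc n) * \<epsilon>" for z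
  proof -
    have "measure (lebesgue_on \<Omega>) {x \<in> \<Omega>. z x > 0} \<le> measure (lebesgue_on \<Omega>) \<Omega>"
      by (intro finite_measure_mono) auto
    also have "\<dots> \<le> real n * \<epsilon>" using n \<epsilon>(1) by (simp add: field_simps)
    also have "\<dots> \<le> real (Suc n) * \<epsilon>" using \<epsilon>(1) by simp
    finally show ?thesis .
  qed
  obtain C where C: "C \<ge> 0" "\<And>z g k. drift_sol lam CH z g \<Longrightarrow> k \<ge> 0 \<Longrightarrow>
      measure (lebesgue_on \<Omega>) {x \<in> \<Omega>. z x > k} \<le> real (Suc n) * \<epsilon> \<Longrightarrow> gnorm (\<lambda>x. max (z x - k) 0) \<le> C * L2norm \<Omega> g"
    using truncated_estimate[OF lam CH P \<epsilon>, of n] by blast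
  have half: "gnorm (\<lambda>x. max (z x) 0) \<le> C * L2norm \<Omega> g" if "drift_sol lam CH z g" for z g
    using C(2)[OF that, of 0] all[of z] by simp
  have "gnorm z \<le> (2 * C) * L2norm \<Omega> g" if sub: "drift_sol lam CH z g" for z g
  proof -
    let ?z = "\<lambda>x. - 1 * z x"
    obtain q where z: "H10 \<Omega> z" and g: "L2 \<Omega> g" and q: "L2 \<Omega> q" "\<And>v. H10 \<Omega> v \<Longrightarrow> energy lam z v = L2ip \<Omega> q v"
        "AE x in lebesgue_on \<Omega>. \<bar>q x\<bar> \<le> CH * norm (wgrad \<Omega> z x) + \<bar>g x\<bar>"
      using sub unfolding drift_sol_def by blast
    have Hz: "H1 \<Omega> z" using z by (rule H10_H1)
    have mz: "H10 \<Omega> ?z" by (rule H10_scale[OF z])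
    note gm = H1_scale(2)[OF Hz, of "- 1"]
    \<comment> \<open>With -q in place of q; the drift inequality sees only absolute values.\<close>
    have "drift_sol lam CH ?z g"
      unfolding drift_sol_def
    proof (intro conjI mz g exI[of _ "\<lambda>x. - 1 * q x"] L2_scale q allI impI)
      fix v assume v: "H10 \<Omega> v"
      then have Hv: "H1 \<Omega> v" by (rule H10_H1)
      have "(\<integral>x. wgrad \<Omega> ?z x \<bullet> wgrad \<Omega> v x \<partial>lebesgue_on \<Omega>) = (\<integral>x. - (wgrad \<Omega> z x \<bullet> wgrad \<Omega> v x) \<partial>lebesgue_on \<Omega>)"
      proof (rule integral_cong_AE)
        show "AE x in lebesgue_on \<Omega>. wgrad \<Omega> ?z x \<bullet> wgrad \<Omega> v x = - (wgrad \<Omega> z x \<bullet> wgrad \<Omega> v x)"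
          using gm by eventually_elim simp
      qed (use wgrad_measurable[OF Hz] wgrad_measurable[OF Hv] wgrad_measurable[OF H10_H1[OF mz]] in measurable)
      then have "energy lam ?z v = - energy lam z v"
        using energy_eq[OF H10_H1[OF mz] Hv, of lam] energy_eq[OF Hz Hv, of lam] L2.ip_scale[of z \<Omega> v "- 1"] H1_L2[OF Hz] H1_L2[OF Hv]
        by simp
      then show "energy lam ?z v = L2ip \<Omega> (\<lambda>x. - 1 * q x) v"
        using q(2)[OF v] L2.ip_scale[of q \<Omega> v "- 1"] q(1) H1_L2[OF Hv] by simp
    next
      show "AE x in lebesgue_on \<Omega>. \<bar>- 1 * q x\<bar> \<le> CH * norm (wgrad \<Omega> ?z x) + \<bar>g x\<bar>"
        using q(3) gm by eventually_elim simp
    qed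
    then have b: "gnorm (\<lambda>x. max (?z x) 0) \<le> C * L2norm \<Omega> g" by (rule half)
    have p1: "H1 \<Omega> (\<lambda>x. max (z x) 0)" using H10_H1[OF H10_positive_part(1)[OF z, of 0]] by simp
    have p2: "H1 \<Omega> (\<lambda>x. max (?z x) 0)" using H10_H1[OF H10_positive_part(1)[OF mz, of 0]] by simp
    have eq: "(\<lambda>x. max (z x) 0 + - 1 * max (?z x) 0) = z" by (auto simp: max_def)
    have "gnorm (\<lambda>x. - 1 * max (?z x) 0) = gnorm (\<lambda>x. max (?z x) 0)"
      using gnorm_minus_commute[OF H1_zero p2] by simp
    then have "gnorm z \<le> gnorm (\<lambda>x. max (z x) 0) + gnorm (\<lambda>x. max (?z x) 0)"
      using gnorm_triangle[OF p1 H1_scale(1)[OF p2, of "- 1"]] unfolding eq by simp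
    then show ?thesis using half[OF sub] b by simp
  qed
  then show ?thesis using C(1) by (intro exI[of _ "2 * C"]) auto
qed

end

section \<open>The discrete Hamilton-Jacobi problem\<close>

lemma le_if_sq_le_mult:
  fixes x A :: real
  assumes "x\<^sup>2 \<le> A * x" "x \<ge> 0" "A \<ge> 0"
  shows "x \<le> A"
  using assms by (cases "x = 0") (auto simp: power2_eq_square)

context bounded_open
begin

lemma energy_add:
  assumes "H1 \<Omega> u" "H1 \<Omega> v" "H1 \<Omega> w"
  shows "energy lam (\<lambda>x. u x + v x) w = energy lam u w + energy lam v w"
proof -
  have "(\<integral>x. wgrad \<Omega> (\<lambda>x. u x + v x) x \<bullet> wgrad \<Omega> w x \<partial>lebesgue_on \<Omega>)
      = (\<integral>x. wgrad \<Omega> u x \<bullet> wgrad \<Omega> w x + wgrad \<Omega> v x \<bullet> wgrad \<Omega> w x \<partial>lebesgue_on \<Omega>)"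
  proof (rule integral_cong_AE)
    show "AE x in lebesgue_on \<Omega>. wgrad \<Omega> (\<lambda>x. u x + v x) x \<bullet> wgrad \<Omega> w x
        = wgrad \<Omega> u x \<bullet> wgrad \<Omega> w x + wgrad \<Omega> v x \<bullet> wgrad \<Omega> w x"
      using H1_add(2)[OF assms(1,2)] by eventually_elim (simp add: inner_add_left)
  qed (use wgrad_measurable[OF H1_add(1)[OF assms(1,2)]] wgrad_measurable[OF assms(1)]
      wgrad_measurable[OF assms(2)] wgrad_measurable[OF assms(3)] in measurable)
  then show ?thesis
    using L2_grad_inner[OF assms(1,3)] L2_grad_inner[OF assms(2,3)] L2.ip_add[of u \<Omega> v w] assms[THEN H1_L2]
    by (simp add: energy_eq H1_add(1) assms distrib_left)
qed

lemma energy_scale: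
  assumes "H1 \<Omega> u" "H1 \<Omega> w"
  shows "energy lam (\<lambda>x. c * u x) w = c * energy lam u w"
proof -
  have "(\<integral>x. wgrad \<Omega> (\<lambda>x. c * u x) x \<bullet> wgrad \<Omega> w x \<partial>lebesgue_on \<Omega>)
      = (\<integral>x. c * (wgrad \<Omega> u x \<bullet> wgrad \<Omega> w x) \<partial>lebesgue_on \<Omega>)"
  proof (rule integral_cong_AE)
    show "AE x in lebesgue_on \<Omega>. wgrad \<Omega> (\<lambda>x. c * u x) x \<bullet> wgrad \<Omega> w x = c * (wgrad \<Omega> u x \<bullet> wgrad \<Omega> w x)"
      using H1_scale(2)[OF assms(1), of c] by eventually_elim simp
  qed (use wgrad_measurable[OF H1_scale(1)[OF assms(1)]] wgrad_measurable[OF assms(1)]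
      wgrad_measurable[OF assms(2)] in measurable)
  then show ?thesis
    using L2.ip_scale[of u \<Omega> w c] assms[THEN H1_L2] by (simp add: energy_eq H1_scale(1) assms distrib_left mult.left_commute)
qed

lemma energy_self: "H1 \<Omega> u \<Longrightarrow> energy lam u u = (gnorm u)\<^sup>2 + lam * (L2norm \<Omega> u)\<^sup>2"
  unfolding gnorm_def L2norm_sq energy_eq L2ip_def power2_norm_eq_inner by (simp add: power2_eq_square)

lemma semi_inner_space_energy:
  assumes "lam \<ge> 0"
  shows "semi_inner_space {u. H10 \<Omega> u} (energy lam)"
proof
  fix u v w :: "real^'d \<Rightarrow> real" and c :: real
  show "(\<lambda>x. 0) \<in> {u. H10 \<Omega> u}" by (simp add: H10_zero)
  show "u \<in> {u. H10 \<Omega> u} \<Longrightarrow> v \<in> {u. H10 \<Omega> u} \<Longrightarrow> (\<lambda>x. u x + v x) \<in> {u. H10 \<Omega> u}" by (simp add: H10_add)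
  show "u \<in> {u. H10 \<Omega> u} \<Longrightarrow> (\<lambda>x. c * u x) \<in> {u. H10 \<Omega> u}" by (simp add: H10_scale)
  show "energy lam u v = energy lam v u" by (simp add: energy_def inner_commute mult_ac)
  show "u \<in> {u. H10 \<Omega> u} \<Longrightarrow> v \<in> {u. H10 \<Omega> u} \<Longrightarrow> w \<in> {u. H10 \<Omega> u} \<Longrightarrow>
      energy lam (\<lambda>x. u x + v x) w = energy lam u w + energy lam v w"
    by (simp add: energy_add H10_H1)
  show "u \<in> {u. H10 \<Omega> u} \<Longrightarrow> w \<in> {u. H10 \<Omega> u} \<Longrightarrow> energy lam (\<lambda>x. c * u x) w = c * energy lam u w"
    by (simp add: energy_scale H10_H1)
  show "u \<in> {u. H10 \<Omega> u} \<Longrightarrow> energy lam u u \<ge> 0"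
    using assms by (simp add: energy_self H10_H1)
qed

end

locale hamilton_jacobi = bounded_open \<Omega> for \<Omega> :: "(real^'d::finite) set" +
  fixes lam CH K :: real and f :: "real^'d \<Rightarrow> real" and H :: "real^'d \<Rightarrow> real^'d \<Rightarrow> real"
  assumes lam: "lam \<ge> 0" and f: "L2 \<Omega> f"
    and H_cont: "continuous_on (closure \<Omega> \<times> UNIV) (\<lambda>(x, z). H x z)"
    and CH: "CH > 0" and H_Lip: "\<And>x z1 z2. x \<in> \<Omega> \<Longrightarrow> \<bar>H x z1 - H x z2\<bar> \<le> CH * norm (z1 - z2)"
    and K: "K > 0" and regularity: "\<And>g v. L2 \<Omega> g \<Longrightarrow> weak_sol_lin \<Omega> lam g v \<Longrightarrow> H2 \<Omega> v \<and> H2norm \<Omega> v \<le> K * L2norm \<Omega> g"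
begin

sublocale E: semi_inner_space "{u. H10 \<Omega> u}" "energy lam"
  using lam by (rule semi_inner_space_energy)

section \<open>Comparison of the energy norm with the H1 norm on H10\<close>

lemma gnorm_le_nrm: "H10 \<Omega> u \<Longrightarrow> gnorm u \<le> E.nrm u"
  using lam by (intro power2_le_imp_le[of "gnorm u"]) (simp_all add: E.nrm_sq energy_self H10_H1)

lemma nrm_le_H1norm:
  assumes "H10 \<Omega> u"
  shows "E.nrm u \<le> sqrt (1 + lam) * H1norm \<Omega> u"
proof (rule power2_le_imp_le)
  have "(gnorm u)\<^sup>2 + lam * (L2norm \<Omega> u)\<^sup>2 \<le> (1 + lam) * ((L2norm \<Omega> u)\<^sup>2 + (gnorm u)\<^sup>2)"
    using lam by (simp add: algebra_simps)
  then show "(E.nrm u)\<^sup>2 \<le> (sqrt (1 + lam) * H1norm \<Omega> u)\<^sup>2"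
    using assms lam by (simp add: E.nrm_sq energy_self H10_H1 power_mult_distrib H1norm_sq)
  show "0 \<le> sqrt (1 + lam) * H1norm \<Omega> u" using lam by simp
qed

lemma H1norm_le_gnorm:
  assumes "L2norm \<Omega> u \<le> P * gnorm u" "H10 \<Omega> u"
  shows "H1norm \<Omega> u \<le> (1 + P) * gnorm u"
  using H1norm_le_sum[OF H10_H1[OF assms(2)]] assms(1) by (simp add: distrib_right)

text \<open>By Poincare the energy norm and the H1 norm are equivalent on \<open>H10\<close>, so
  completeness is inherited from H1.\<close>

lemma complete_energy: "E.complete_on {u. H10 \<Omega> u}"
  unfolding E.complete_on_def
proof (intro allI impI, elim conjE)
  fix s :: "nat \<Rightarrow> real^'d \<Rightarrow> real"
  assume s: "\<forall>n. s n \<in> {u. H10 \<Omega> u}" and Cau: "\<forall>e>0. \<exists>N. \<forall>m\<ge>N. \<forall>n\<ge>N. E.nrm (\<lambda>x. s m x - s n x) < e"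
  obtain P where P: "P > 0" "\<And>u. H10 \<Omega> u \<Longrightarrow> L2norm \<Omega> u \<le> P * gnorm u" using Poincare by blast
  have sH: "H10 \<Omega> (s n)" for n using s by simp
  have le: "H1norm \<Omega> (\<lambda>x. s m x - s n x) \<le> (1 + P) * E.nrm (\<lambda>x. s m x - s n x)" for m n
  proof -
    have d: "H10 \<Omega> (\<lambda>x. s m x - s n x)" by (intro H10_diff sH)
    have "H1norm \<Omega> (\<lambda>x. s m x - s n x) \<le> (1 + P) * gnorm (\<lambda>x. s m x - s n x)"
      by (rule H1norm_le_gnorm[OF P(2)[OF d] d])
    also have "\<dots> \<le> (1 + P) * E.nrm (\<lambda>x. s m x - s n x)"
      using P(1) gnorm_le_nrm[OF d] by (intro mult_left_mono) auto
    finally show ?thesis .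
  qed
  have "\<exists>u. H10 \<Omega> u \<and> (\<lambda>n. H1norm \<Omega> (\<lambda>x. u x - s n x)) \<longlonglongrightarrow> 0"
  proof (rule H10_complete[OF sH])
    fix e :: real assume "e > 0"
    then have "e / (1 + P) > 0" using P(1) by simp
    then obtain N where N: "\<forall>m\<ge>N. \<forall>n\<ge>N. E.nrm (\<lambda>x. s m x - s n x) < e / (1 + P)" using Cau by blast
    have "H1norm \<Omega> (\<lambda>x. s m x - s n x) < e" if "m \<ge> N" "n \<ge> N" for m n
    proof -
      have "E.nrm (\<lambda>x. s m x - s n x) < e / (1 + P)" using N that by blast
      then have "(1 + P) * E.nrm (\<lambda>x. s m x - s n x) < e" using P(1) by (simp add: pos_less_divide_eq mult.commute)
      then show ?thesis using le[of m n] by linarith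
    qed
    then show "\<exists>N. \<forall>m\<ge>N. \<forall>n\<ge>N. H1norm \<Omega> (\<lambda>x. s m x - s n x) < e" by blast
  qed
  then obtain u where u: "H10 \<Omega> u" "(\<lambda>n. H1norm \<Omega> (\<lambda>x. u x - s n x)) \<longlonglongrightarrow> 0" by blast
  have "(\<lambda>n. E.nrm (\<lambda>x. s n x - u x)) \<longlonglongrightarrow> 0"
  proof (rule Lim_null_comparison)
    have "norm (E.nrm (\<lambda>x. s n x - u x)) \<le> sqrt (1 + lam) * H1norm \<Omega> (\<lambda>x. u x - s n x)" for n
    proof -
      have d: "H10 \<Omega> (\<lambda>x. s n x - u x)" by (intro H10_diff sH u)
      have "E.nrm (\<lambda>x. s n x - u x) \<ge> 0" using d by simp
      then show ?thesis using nrm_le_H1norm[OF d] H1norm_minus_commute[OF H10_H1[OF u(1)] H10_H1[OF sH[of n]]] by simp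
    qed
    then show "\<forall>\<^sub>F n in sequentially. norm (E.nrm (\<lambda>x. s n x - u x)) \<le> sqrt (1 + lam) * H1norm \<Omega> (\<lambda>x. u x - s n x)"
      by simp
    show "(\<lambda>n. sqrt (1 + lam) * H1norm \<Omega> (\<lambda>x. u x - s n x)) \<longlonglongrightarrow> 0"
      using tendsto_mult_left[OF u(2), of "sqrt (1 + lam)"] by simp
  qed
  then show "\<exists>l\<in>{u. H10 \<Omega> u}. (\<lambda>n. E.nrm (\<lambda>x. s n x - l x)) \<longlonglongrightarrow> 0"
    using u(1) by (intro bexI[of _ u]) auto
qed

section \<open>The Hamiltonian term as a square integrable function\<close>

definition hterm :: "(real^'d \<Rightarrow> real) \<Rightarrow> real^'d \<Rightarrow> real" where
  "hterm u x = H x (wgrad \<Omega> u x)"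

text \<open>H is continuous only over the closure of the domain, so it is cut off by the indicator
  of that closed set to become Borel before being composed with the gradient. The size follows from
  the bound on H(x, 0) over the compact closure and from the Lipschitz condition in the
  gradient.\<close>

lemma hterm_L2:
  assumes "H1 \<Omega> u"
  shows "L2 \<Omega> (hterm u)"
proof -
  let ?A = "closure \<Omega> \<times> (UNIV :: (real^'d) set)"
  have "closed ?A" by (intro closed_Times) auto
  then have A: "(\<lambda>p. indicator ?A p *\<^sub>R (case p of (x, z) \<Rightarrow> H x z)) \<in> borel_measurable borel"
    using H_cont by (intro borel_measurable_continuous_on_indicator) auto
  have B: "(\<lambda>x. (x, wgrad \<Omega> u x)) \<in> borel_measurable (lebesgue_on \<Omega>)"
    using wgrad_measurable[OF assms] id_borel_measurable_lebesgue_on[of \<Omega>] by (intro borel_measurable_Pair) (simp_all add: id_def)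
  have M1: "(\<lambda>x. indicator ?A (x, wgrad \<Omega> u x) *\<^sub>R H x (wgrad \<Omega> u x)) \<in> borel_measurable (lebesgue_on \<Omega>)"
    using measurable_compose[OF B A] by (simp only: prod.case)
  have eqx: "hterm u x = indicator ?A (x, wgrad \<Omega> u x) *\<^sub>R H x (wgrad \<Omega> u x)" if "x \<in> \<Omega>" for x
    using that closure_subset[of \<Omega>] by (auto simp: hterm_def indicator_def)
  have meas: "hterm u \<in> borel_measurable (lebesgue_on \<Omega>)"
    by (rule iffD2[OF measurable_lebesgue_cong[OF eqx] M1])
  have "compact ((\<lambda>x. H x 0) ` closure \<Omega>)"
  proof (rule compact_continuous_image)
    have "continuous_on (closure \<Omega>) (\<lambda>x. (case (x, 0) of (x, z) \<Rightarrow> H x z))"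
      by (rule continuous_on_compose2[OF H_cont]) (auto intro!: continuous_intros)
    then show "continuous_on (closure \<Omega>) (\<lambda>x. H x 0)" by simp
    show "compact (closure \<Omega>)" using bounded_dom by (simp add: compact_closure)
  qed
  then obtain B where B: "B > 0" "\<And>x. x \<in> closure \<Omega> \<Longrightarrow> \<bar>H x 0\<bar> \<le> B"
    using compact_imp_bounded bounded_pos by (metis imageI real_norm_def)
  show ?thesis
  proof (rule L2_AE_bound[OF meas])
    show "L2 \<Omega> (\<lambda>x. B + CH * norm (wgrad \<Omega> u x))"
      by (intro L2_add L2_const dom_lmeasurable L2_scale L2_norm_wgrad assms)
    show "AE x in lebesgue_on \<Omega>. \<bar>hterm u x\<bar> \<le> \<bar>B + CH * norm (wgrad \<Omega> u x)\<bar>"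
    proof (rule AE_I2)
      fix x assume "x \<in> space (lebesgue_on \<Omega>)"
      then have x: "x \<in> \<Omega>" "x \<in> closure \<Omega>" using closure_subset by auto
      show "\<bar>hterm u x\<bar> \<le> \<bar>B + CH * norm (wgrad \<Omega> u x)\<bar>"
        using B(2)[OF x(2)] H_Lip[OF x(1), of "wgrad \<Omega> u x" 0] by (simp add: hterm_def)
    qed
  qed
qed

lemma hterm_diff_AE:
  assumes "H1 \<Omega> u" "H1 \<Omega> v"
  shows "AE x in lebesgue_on \<Omega>. \<bar>hterm u x - hterm v x\<bar> \<le> CH * norm (wgrad \<Omega> (\<lambda>x. u x - v x) x)"
proof -
  have "AE x in lebesgue_on \<Omega>. x \<in> \<Omega>" by (rule AE_I2) simp
  with H1_diff(2)[OF assms] show ?thesis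
  proof eventually_elim
    case (elim x)
    then show ?case using H_Lip[of x "wgrad \<Omega> u x" "wgrad \<Omega> v x"] by (simp add: hterm_def)
  qed
qed

lemma hterm_diff_L2norm:
  assumes "H1 \<Omega> u" "H1 \<Omega> v"
  shows "L2norm \<Omega> (\<lambda>x. hterm u x - hterm v x) \<le> CH * gnorm (\<lambda>x. u x - v x)"
proof -
  have "L2norm \<Omega> (\<lambda>x. hterm u x - hterm v x) \<le> L2norm \<Omega> (\<lambda>x. CH * norm (wgrad \<Omega> (\<lambda>x. u x - v x) x))"
  proof (rule L2norm_AE_mono)
    show "AE x in lebesgue_on \<Omega>. \<bar>hterm u x - hterm v x\<bar> \<le> \<bar>CH * norm (wgrad \<Omega> (\<lambda>x. u x - v x) x)\<bar>"
      using hterm_diff_AE[OF assms] by eventually_elim linarith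
  qed (intro L2_diff hterm_L2 assms L2_scale L2_norm_wgrad H1_diff)+
  also have "\<dots> = CH * gnorm (\<lambda>x. u x - v x)" using CH by (simp add: L2norm_scale gnorm_def)
  finally show ?thesis .
qed

lemma HJ_form_iff:
  assumes "H1 \<Omega> u" "H1 \<Omega> \<phi>"
  shows "HJ_form \<Omega> H lam f u \<phi> \<longleftrightarrow> energy lam u \<phi> + L2ip \<Omega> (hterm u) \<phi> = L2ip \<Omega> f \<phi>"
proof -
  note i1 = L2_grad_inner[OF assms] and i2 = L2_mult_integrable[OF hterm_L2[OF assms(1)] H1_L2[OF assms(2)]]
    and i3 = L2_mult_integrable[OF L2_scale[OF H1_L2[OF assms(1)], of lam] H1_L2[OF assms(2)]]
  have "(\<integral>x. wgrad \<Omega> u x \<bullet> wgrad \<Omega> \<phi> x + H x (wgrad \<Omega> u x) * \<phi> x + lam * u x * \<phi> x \<partial>lebesgue_on \<Omega>)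
      = (\<integral>x. wgrad \<Omega> u x \<bullet> wgrad \<Omega> \<phi> x \<partial>lebesgue_on \<Omega>) + (\<integral>x. hterm u x * \<phi> x \<partial>lebesgue_on \<Omega>)
        + (\<integral>x. lam * u x * \<phi> x \<partial>lebesgue_on \<Omega>)"
    unfolding hterm_def[symmetric] using i1 i2 i3 by simp
  moreover have "energy lam u \<phi> = (\<integral>x. wgrad \<Omega> u x \<bullet> wgrad \<Omega> \<phi> x \<partial>lebesgue_on \<Omega>) + (\<integral>x. lam * u x * \<phi> x \<partial>lebesgue_on \<Omega>)"
    unfolding energy_def using i1 i3 by simp
  ultimately show ?thesis by (simp add: HJ_form_def L2ip_def algebra_simps)
qed

lemma L2ip_le_nrm:
  assumes P: "P > 0" "\<And>u. H10 \<Omega> u \<Longrightarrow> L2norm \<Omega> u \<le> P * gnorm u" and "L2 \<Omega> g" "H10 \<Omega> \<phi>"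
  shows "\<bar>L2ip \<Omega> g \<phi>\<bar> \<le> L2norm \<Omega> g * P * E.nrm \<phi>"
proof -
  have "\<bar>L2ip \<Omega> g \<phi>\<bar> \<le> L2norm \<Omega> g * L2norm \<Omega> \<phi>"
    by (rule L2_Cauchy_Schwarz[OF assms(3) H1_L2[OF H10_H1[OF assms(4)]]])
  also have "\<dots> \<le> L2norm \<Omega> g * (P * E.nrm \<phi>)"
  proof (rule mult_left_mono)
    have "P * gnorm \<phi> \<le> P * E.nrm \<phi>" using P(1) gnorm_le_nrm[OF assms(4)] by simp
    then show "L2norm \<Omega> \<phi> \<le> P * E.nrm \<phi>" using P(2)[OF assms(4)] by linarith
  qed simp
  finally show ?thesis by (simp add: mult.assoc)
qed

text \<open>Let \<open>z\<close> solve the linear problem with right-hand side \<open>-\<beta>\<close>. Then \<open>w - r\<close> is the Galerkin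
  projection of \<open>z\<close>, so regularity makes \<open>z - w\<close> small relative to \<open>w\<close>, while \<open>gradient_estimate\<close>
  bounds \<open>z\<close> by \<open>z - w\<close>.\<close>

lemma discrete_stability:
  assumes P: "P > 0" "\<And>u. H10 \<Omega> u \<Longrightarrow> L2norm \<Omega> u \<le> P * gnorm u"
    and C: "C \<ge> 0" "\<And>z g. drift_sol lam CH z g \<Longrightarrow> gnorm z \<le> C * L2norm \<Omega> g"
    and V: "fun_subspace V" "\<And>v. v \<in> V \<Longrightarrow> H10 \<Omega> v"
    and approx: "\<And>v. H2 \<Omega> v \<Longrightarrow> H10 \<Omega> v \<Longrightarrow> best_approx \<Omega> V v \<le> e * H2norm \<Omega> v"
    and e: "(1 + C * CH) * (sqrt (1 + lam) * (\<bar>e\<bar> * (K * CH))) \<le> 1/2"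
    and w: "w \<in> V" and r: "r \<in> V" and \<beta>: "L2 \<Omega> \<beta>"
    and \<beta>_le: "AE x in lebesgue_on \<Omega>. \<bar>\<beta> x\<bar> \<le> CH * norm (wgrad \<Omega> w x)"
    and eq: "\<And>\<phi>. \<phi> \<in> V \<Longrightarrow> energy lam w \<phi> + L2ip \<Omega> \<beta> \<phi> = energy lam r \<phi>"
  shows "gnorm w \<le> 2 * (1 + C * CH) * E.nrm r"
proof -
  have Hw: "H10 \<Omega> w" and Hr: "H10 \<Omega> r" using V(2) w r by auto
  have V_diff: "(\<lambda>x. u x - v x) \<in> V" if "u \<in> V" "v \<in> V" for u v
  proof -
    have "(\<lambda>x. - 1 * v x) \<in> V" using V(1) that(2) unfolding fun_subspace_def by blast
    then have "(\<lambda>x. u x + - 1 * v x) \<in> V" using V(1) that(1) unfolding fun_subspace_def by fast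
    then show ?thesis by simp
  qed
  define g where "g = (\<lambda>x. - 1 * \<beta> x)"
  have g: "L2 \<Omega> g" unfolding g_def by (rule L2_scale[OF \<beta>])
  have ip_g: "L2ip \<Omega> g \<phi> = - L2ip \<Omega> \<beta> \<phi>" if "L2 \<Omega> \<phi>" for \<phi>
    using L2.ip_scale[of \<beta> \<Omega> \<phi> "- 1"] \<beta> that by (simp add: g_def)
  obtain z where z: "H10 \<Omega> z" "\<And>\<phi>. H10 \<Omega> \<phi> \<Longrightarrow> energy lam z \<phi> = L2ip \<Omega> g \<phi>"
  proof (rule E.Riesz_representation[of "L2ip \<Omega> g" "L2norm \<Omega> g * P"])
    show "E.complete_on {u. H10 \<Omega> u}" by (rule complete_energy)
    show "\<bar>L2ip \<Omega> g u\<bar> \<le> L2norm \<Omega> g * P * E.nrm u" if "u \<in> {u. H10 \<Omega> u}" for u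
      using L2ip_le_nrm[OF P g, of u] that by simp
    show "L2ip \<Omega> g (\<lambda>x. u x + v x) = L2ip \<Omega> g u + L2ip \<Omega> g v" if "u \<in> {u. H10 \<Omega> u}" "v \<in> {u. H10 \<Omega> u}" for u v
      using that g H1_L2[OF H10_H1] by (intro L2.ip_add2) auto
    show "L2ip \<Omega> g (\<lambda>x. c * u x) = c * L2ip \<Omega> g u" if "u \<in> {u. H10 \<Omega> u}" for c u
      using that g H1_L2[OF H10_H1] by (intro L2.ip_scale2) auto
  qed auto
  have "weak_sol_lin \<Omega> lam g z"
    unfolding weak_sol_lin_def using z by (simp add: energy_def L2ip_def)
  then have H2z: "H2 \<Omega> z" "H2norm \<Omega> z \<le> K * L2norm \<Omega> g" using regularity[OF g] by auto
  have "L2norm \<Omega> g \<le> L2norm \<Omega> (\<lambda>x. CH * norm (wgrad \<Omega> w x))"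
  proof (rule L2norm_AE_mono[OF g L2_scale[OF L2_norm_wgrad(1)[OF H10_H1[OF Hw]]]])
    show "AE x in lebesgue_on \<Omega>. \<bar>g x\<bar> \<le> \<bar>CH * norm (wgrad \<Omega> w x)\<bar>"
      using \<beta>_le by eventually_elim (simp add: g_def)
  qed
  also have "\<dots> = CH * gnorm w" using CH by (simp add: L2norm_scale gnorm_def)
  finally have gb: "L2norm \<Omega> g \<le> CH * gnorm w" .
  define p where "p = (\<lambda>x. w x - r x)"
  define d where "d = (\<lambda>x. z x - p x)"
  have pV: "p \<in> V" unfolding p_def by (rule V_diff[OF w r])
  have Hp: "H10 \<Omega> p" using pV by (rule V(2))
  have Hd: "H10 \<Omega> d" unfolding d_def by (rule H10_diff[OF z(1) Hp])
  \<comment> \<open>Galerkin orthogonality: the equation for w says that w - r and z have the same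
    energy products with all of V.\<close>
  have orth: "energy lam d \<phi> = 0" if "\<phi> \<in> V" for \<phi>
  proof -
    have "H10 \<Omega> \<phi>" using that by (rule V(2))
    then have "energy lam d \<phi> = energy lam z \<phi> - (energy lam w \<phi> - energy lam r \<phi>)"
      unfolding d_def p_def using z(1) Hw Hr H10_diff[OF Hw Hr] by (simp add: E.ip_diff)
    then show ?thesis using eq[OF that] z(2)[OF V(2)[OF that]] ip_g[OF H1_L2[OF H10_H1[OF V(2)[OF that]]]] by simp
  qed
  \<comment> \<open>Cea's lemma with constant 1, because the linear part is symmetric and its own
    form defines the norm.\<close>
  have best: "E.nrm d \<le> E.nrm (\<lambda>x. z x - v x)" if v: "v \<in> V" for v
  proof -
    have Hv: "H10 \<Omega> v" using v by (rule V(2))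
    have Hzv: "H10 \<Omega> (\<lambda>x. z x - v x)" by (rule H10_diff[OF z(1) Hv])
    have vp: "(\<lambda>x. v x - p x) \<in> V" by (rule V_diff[OF v pV])
    have eqd: "(\<lambda>x. (z x - v x) + (v x - p x)) = d" by (simp add: d_def)
    have "(E.nrm d)\<^sup>2 = energy lam d (\<lambda>x. (z x - v x) + (v x - p x))" unfolding eqd using Hd by (simp add: E.nrm_sq)
    also have "\<dots> = energy lam d (\<lambda>x. z x - v x)"
      using E.ip_add2[of "\<lambda>x. z x - v x" "\<lambda>x. v x - p x" d] Hzv Hd V(2)[OF vp] orth[OF vp] by simp
    also have "\<dots> \<le> E.nrm (\<lambda>x. z x - v x) * E.nrm d"
      using E.Cauchy_Schwarz[of d "\<lambda>x. z x - v x"] Hd Hzv by (simp add: mult.commute)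
    finally show ?thesis by (rule le_if_sq_le_mult) (use Hd Hzv in auto)
  qed
  have sl: "sqrt (1 + lam) > 0" using lam by simp
  have "E.nrm d / sqrt (1 + lam) \<le> best_approx \<Omega> V z"
    unfolding best_approx_def
  proof (rule cINF_greatest)
    show "V \<noteq> {}" using w by auto
    fix v assume v: "v \<in> V"
    have "E.nrm d \<le> sqrt (1 + lam) * H1norm \<Omega> (\<lambda>x. z x - v x)"
      using best[OF v] nrm_le_H1norm[OF H10_diff[OF z(1) V(2)[OF v]]] by linarith
    then show "E.nrm d / sqrt (1 + lam) \<le> H1norm \<Omega> (\<lambda>x. z x - v x)" using sl by (simp add: field_simps)
  qed
  also have "\<dots> \<le> e * H2norm \<Omega> z" by (rule approx[OF H2z(1) z(1)])
  \<comment> \<open>The absolute value appears since no sign of e is assumed and the product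
    estimate wants a nonnegative factor.\<close>
  also have "\<dots> \<le> \<bar>e\<bar> * (K * (CH * gnorm w))"
  proof (rule mult_mono)
    have "K * L2norm \<Omega> g \<le> K * (CH * gnorm w)" using gb K by simp
    then show "H2norm \<Omega> z \<le> K * (CH * gnorm w)" using H2z(2) by linarith
    show "0 \<le> H2norm \<Omega> z" by (simp add: H2norm_def sum_nonneg)
  qed auto
  finally have db: "E.nrm d \<le> sqrt (1 + lam) * (\<bar>e\<bar> * (K * CH)) * gnorm w"
    using sl by (simp add: field_simps)
  have Hzw: "H10 \<Omega> (\<lambda>x. z x - w x)" by (rule H10_diff[OF z(1) Hw])
  have eqzw: "(\<lambda>x. d x + - 1 * r x) = (\<lambda>x. z x - w x)" by (simp add: d_def p_def)
  have "gnorm (\<lambda>x. z x - w x) \<le> E.nrm (\<lambda>x. z x - w x)" by (rule gnorm_le_nrm[OF Hzw])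
  also have "\<dots> \<le> E.nrm d + E.nrm r"
    using E.nrm_triangle[of d "\<lambda>x. - 1 * r x"] E.nrm_scale[of r "- 1"] H10_scale[OF Hr, of "- 1"] Hd Hr
    unfolding eqzw by simp
  finally have zw: "gnorm (\<lambda>x. z x - w x) \<le> E.nrm r + sqrt (1 + lam) * (\<bar>e\<bar> * (K * CH)) * gnorm w"
    using db by linarith
  \<comment> \<open>The bound on \<beta> involves Dw, not Dz. Replacing one by the other costs CH
    |D(z - w)|, which becomes the inhomogeneity g of \<open>drift_sol\<close>.\<close>
  have "drift_sol lam CH z (\<lambda>x. CH * norm (wgrad \<Omega> (\<lambda>x. z x - w x) x))"
    unfolding drift_sol_def
  proof (intro conjI z(1) exI[of _ g] g L2_scale L2_norm_wgrad H10_H1[OF Hzw] allI impI z(2))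
    show "AE x in lebesgue_on \<Omega>. \<bar>g x\<bar> \<le> CH * norm (wgrad \<Omega> z x) + \<bar>CH * norm (wgrad \<Omega> (\<lambda>x. z x - w x) x)\<bar>"
      using \<beta>_le H1_diff(2)[OF H10_H1[OF z(1)] H10_H1[OF Hw]]
    proof eventually_elim
      case (elim x)
      have "norm (wgrad \<Omega> w x) \<le> norm (wgrad \<Omega> z x) + norm (wgrad \<Omega> (\<lambda>x. z x - w x) x)"
        using norm_triangle_ineq4[of "wgrad \<Omega> z x" "wgrad \<Omega> (\<lambda>x. z x - w x) x"] elim(2) by simp
      then have "CH * norm (wgrad \<Omega> w x) \<le> CH * norm (wgrad \<Omega> z x) + CH * norm (wgrad \<Omega> (\<lambda>x. z x - w x) x)"
        using CH by (simp flip: distrib_left)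
      then show ?case using elim(1) CH by (simp add: g_def abs_mult)
    qed
  qed
  then have "gnorm z \<le> C * L2norm \<Omega> (\<lambda>x. CH * norm (wgrad \<Omega> (\<lambda>x. z x - w x) x))" by (rule C(2))
  also have "\<dots> = C * CH * gnorm (\<lambda>x. z x - w x)" using CH by (simp add: L2norm_scale gnorm_def)
  finally have zb: "gnorm z \<le> C * CH * gnorm (\<lambda>x. z x - w x)" .
  have "gnorm w \<le> gnorm z + gnorm (\<lambda>x. z x - w x)"
    using gnorm_triangle[OF H10_H1[OF z(1)] H1_diff(1)[OF H10_H1[OF Hw] H10_H1[OF z(1)]]]
      gnorm_minus_commute[OF H10_H1[OF Hw] H10_H1[OF z(1)]] by simp
  also have "\<dots> \<le> (1 + C * CH) * gnorm (\<lambda>x. z x - w x)" using zb by (simp add: algebra_simps)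
  also have "\<dots> \<le> (1 + C * CH) * (E.nrm r + sqrt (1 + lam) * (\<bar>e\<bar> * (K * CH)) * gnorm w)"
    using zw C(1) CH by (intro mult_left_mono) auto
  also have "\<dots> = (1 + C * CH) * E.nrm r + ((1 + C * CH) * (sqrt (1 + lam) * (\<bar>e\<bar> * (K * CH)))) * gnorm w"
    by (simp add: algebra_simps)
  \<comment> \<open>The smallness condition on e is exactly that the approximation error of z
    absorbs half of the gradient norm of w.\<close>
  also have "\<dots> \<le> (1 + C * CH) * E.nrm r + 1/2 * gnorm w"
    using e by (intro add_left_mono mult_right_mono) auto
  finally have "gnorm w \<le> 2 * ((1 + C * CH) * E.nrm r)" by simp
  then show ?thesis by (simp only: mult.assoc)
qed

text \<open>Let \<open>R v\<close> in V represent hterm v - f in the energy form; the discrete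
  equation becomes v + R v = 0 up to seminorm zero, and the continuity method applies with stability
  constant A. A converts the gradient bound of \<open>discrete_stability\<close> into an energy
  bound, by 1 + P for Poincare and sqrt (1 + lam) for the norms. In B the summand 1 belongs to u -
  v; the rest bounds v - uh by the residual of v. Both are fixed from outside and depend neither on
  V nor on e.\<close>

lemma discrete_problem:
  assumes P: "P > 0" "\<And>u. H10 \<Omega> u \<Longrightarrow> L2norm \<Omega> u \<le> P * gnorm u"
    and C: "C \<ge> 0" "\<And>z g. drift_sol lam CH z g \<Longrightarrow> gnorm z \<le> C * L2norm \<Omega> g"
    and V: "fin_dim_fun_space V" "\<And>v. v \<in> V \<Longrightarrow> H10 \<Omega> v"
    and approx: "\<And>v. H2 \<Omega> v \<Longrightarrow> H10 \<Omega> v \<Longrightarrow> best_approx \<Omega> V v \<le> e * H2norm \<Omega> v"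
    and e: "(1 + C * CH) * (sqrt (1 + lam) * (\<bar>e\<bar> * (K * CH))) \<le> 1/2"
    and u: "weak_sol_HJ \<Omega> H lam f u"
    and A: "A = sqrt (1 + lam) * (1 + P) * (2 * (1 + C * CH))"
    and B: "B = 1 + (1 + P) * (A * ((1 + CH * P) * sqrt (1 + lam)))"
  shows "\<exists>uh\<in>V. (\<forall>\<phi>\<in>V. HJ_form \<Omega> H lam f uh \<phi>) \<and>
    (\<forall>w\<in>V. (\<forall>\<phi>\<in>V. HJ_form \<Omega> H lam f w \<phi>) \<longrightarrow> H1norm \<Omega> (\<lambda>x. w x - uh x) = 0) \<and>
    H1norm \<Omega> (\<lambda>x. u x - uh x) \<le> B * best_approx \<Omega> V u"
proof -
  have sub: "fun_subspace V" using V(1) by (simp add: fin_dim_fun_space_def)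
  have Hu: "H10 \<Omega> u" using u by (simp add: weak_sol_HJ_def)
  interpret V: semi_inner_space V "energy lam"
    by (rule E.subspace_semi_inner_space) (use V(2) sub in \<open>auto simp: fun_subspace_def\<close>)
  obtain b where b: "finite b" "b \<subseteq> V" "\<And>v. v \<in> V \<Longrightarrow> \<exists>c. v = (\<lambda>x. \<Sum>w\<in>b. c w * w x)"
    using V(1) unfolding fin_dim_fun_space_def by blast
  have "V \<subseteq> V.fspan b" using b(3) unfolding V.fspan_def by blast
  then have "V = V.fspan b" using V.fspan_subset[OF b(1,2)] by auto
  then have complete: "V.complete_on V" using V.complete_on_fspan[OF b(1,2)] by simp
  have A0: "A \<ge> 0" unfolding A using lam P(1) C(1) CH by (intro mult_nonneg_nonneg) auto
  note HV = V(2)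
  have LV: "L2 \<Omega> v" if "v \<in> V" for v using H1_L2[OF H10_H1[OF HV[OF that]]] .
  have Lh: "L2 \<Omega> (hterm v)" if "H10 \<Omega> v" for v by (rule hterm_L2[OF H10_H1[OF that]])
  have "\<exists>r\<in>V. \<forall>\<phi>\<in>V. energy lam r \<phi> = L2ip \<Omega> (\<lambda>x. hterm v x - f x) \<phi>" if v: "v \<in> V" for v
  proof -
    let ?g = "\<lambda>x. hterm v x - f x"
    have g: "L2 \<Omega> ?g" by (intro L2_diff Lh HV v f)
    obtain r where "r \<in> V" "\<And>\<phi>. \<phi> \<in> V \<Longrightarrow> energy lam r \<phi> = L2ip \<Omega> ?g \<phi>"
    proof (rule V.Riesz_representation[of "L2ip \<Omega> ?g" "L2norm \<Omega> ?g * P"])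
      show "V.complete_on V" by (rule complete)
      show "\<bar>L2ip \<Omega> ?g w\<bar> \<le> L2norm \<Omega> ?g * P * V.nrm w" if "w \<in> V" for w
        by (rule L2ip_le_nrm[OF P g HV[OF that]])
      show "L2ip \<Omega> ?g (\<lambda>x. w x + w' x) = L2ip \<Omega> ?g w + L2ip \<Omega> ?g w'" if "w \<in> V" "w' \<in> V" for w w'
        using that g LV by (intro L2.ip_add2) auto
      show "L2ip \<Omega> ?g (\<lambda>x. c * w x) = c * L2ip \<Omega> ?g w" if "w \<in> V" for c w
        using that g LV by (intro L2.ip_scale2) auto
    qed auto
    then show ?thesis by blast
  qed
  then obtain R where R: "\<And>v. v \<in> V \<Longrightarrow> R v \<in> V"
      "\<And>v \<phi>. v \<in> V \<Longrightarrow> \<phi> \<in> V \<Longrightarrow> energy lam (R v) \<phi> = L2ip \<Omega> (\<lambda>x. hterm v x - f x) \<phi>"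
    by metis
  have R_diff: "energy lam (\<lambda>x. R v x - R w x) \<phi> = L2ip \<Omega> (\<lambda>x. hterm v x - hterm w x) \<phi>"
    if "v \<in> V" "w \<in> V" "\<phi> \<in> V" for v w \<phi>
  proof -
    have "energy lam (\<lambda>x. R v x - R w x) \<phi>
        = L2ip \<Omega> (\<lambda>x. hterm v x - f x) \<phi> - L2ip \<Omega> (\<lambda>x. hterm w x - f x) \<phi>"
      using that R by (simp add: V.ip_diff)
    also have "\<dots> = L2ip \<Omega> (\<lambda>x. (hterm v x - f x) - (hterm w x - f x)) \<phi>"
      using that Lh HV f LV by (intro L2.ip_diff[symmetric]) (auto intro!: L2_diff)
    finally show ?thesis by simp
  qed
  have hdiff: "\<bar>L2ip \<Omega> (\<lambda>x. hterm v x - hterm w x) \<phi>\<bar> \<le> CH * P * E.nrm (\<lambda>x. v x - w x) * E.nrm \<phi>"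
    if v: "H10 \<Omega> v" and w: "H10 \<Omega> w" and \<phi>: "H10 \<Omega> \<phi>" for v w \<phi>
  proof -
    have d: "H10 \<Omega> (\<lambda>x. v x - w x)" by (rule H10_diff[OF v w])
    have "L2norm \<Omega> (\<lambda>x. hterm v x - hterm w x) \<le> CH * gnorm (\<lambda>x. v x - w x)"
      by (rule hterm_diff_L2norm[OF H10_H1[OF v] H10_H1[OF w]])
    also have "\<dots> \<le> CH * E.nrm (\<lambda>x. v x - w x)" using CH gnorm_le_nrm[OF d] by simp
    finally have "L2norm \<Omega> (\<lambda>x. hterm v x - hterm w x) * P * E.nrm \<phi> \<le> CH * E.nrm (\<lambda>x. v x - w x) * P * E.nrm \<phi>"
      using P(1) \<phi> by (intro mult_right_mono) auto
    then show ?thesis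
      using L2ip_le_nrm[OF P L2_diff[OF Lh[OF v] Lh[OF w]] \<phi>] by (simp add: mult_ac)
  qed
  have Lip: "V.nrm (\<lambda>x. R v x - R w x) \<le> (CH * P) * V.nrm (\<lambda>x. v x - w x)" if v: "v \<in> V" and w: "w \<in> V" for v w
  proof -
    let ?r = "\<lambda>x. R v x - R w x"
    have r: "?r \<in> V" by (intro V.diff_closed R v w)
    have "(E.nrm ?r)\<^sup>2 = L2ip \<Omega> (\<lambda>x. hterm v x - hterm w x) ?r"
      using R_diff[OF v w r] HV[OF r] by (simp add: E.nrm_sq)
    also have "\<dots> \<le> CH * P * E.nrm (\<lambda>x. v x - w x) * E.nrm ?r"
      using hdiff[OF HV[OF v] HV[OF w] HV[OF r]] by simp
    finally show ?thesis
      by (rule le_if_sq_le_mult) (use HV[OF r] HV[OF V.diff_closed[OF v w]] CH P(1) in \<open>auto intro!: mult_nonneg_nonneg\<close>)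
  qed
  \<comment> \<open>For t between 0 and 1 the scaled difference of the Hamiltonian terms obeys the
    same bound with \<open>CH\<close>, so one application of \<open>discrete_stability\<close>
    covers all t with one constant.\<close>
  have stab: "E.nrm (\<lambda>x. v x - w x) \<le> A * E.nrm (\<lambda>x. (v x + t * R v x) - (w x + t * R w x))"
    if t: "0 \<le> t" "t \<le> 1" and v: "v \<in> V" and w: "w \<in> V" for t v w
  proof -
    let ?d = "\<lambda>x. v x - w x" and ?r = "\<lambda>x. (v x + t * R v x) - (w x + t * R w x)"
    let ?\<beta> = "\<lambda>x. t * (hterm v x - hterm w x)"
    have d: "?d \<in> V" by (rule V.diff_closed[OF v w])
    have r: "?r \<in> V" by (intro V.diff_closed V.add_closed V.scale_closed R v w)
    have \<beta>: "L2 \<Omega> ?\<beta>" by (intro L2_scale L2_diff Lh HV v w)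
    have "AE x in lebesgue_on \<Omega>. \<bar>?\<beta> x\<bar> \<le> CH * norm (wgrad \<Omega> ?d x)"
      using hterm_diff_AE[OF H10_H1[OF HV[OF v]] H10_H1[OF HV[OF w]]]
    proof eventually_elim
      case (elim x)
      have "\<bar>?\<beta> x\<bar> \<le> \<bar>hterm v x - hterm w x\<bar>" using t by (simp add: abs_mult mult_left_le_one_le)
      then show ?case using elim by linarith
    qed
    moreover have "energy lam ?d \<phi> + L2ip \<Omega> ?\<beta> \<phi> = energy lam ?r \<phi>" if \<phi>: "\<phi> \<in> V" for \<phi>
    proof -
      have dR: "(\<lambda>x. R v x - R w x) \<in> V" by (intro V.diff_closed R v w)
      have "energy lam ?r \<phi> = energy lam (\<lambda>x. (v x - w x) + t * (R v x - R w x)) \<phi>"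
        by (rule arg_cong[of _ _ "\<lambda>h. energy lam h \<phi>"]) (simp add: algebra_simps)
      also have "\<dots> = energy lam ?d \<phi> + t * energy lam (\<lambda>x. R v x - R w x) \<phi>"
        using V.ip_add[OF d V.scale_closed[OF dR, of t] \<phi>] V.ip_scale[OF dR \<phi>, of t] by simp
      also have "t * energy lam (\<lambda>x. R v x - R w x) \<phi> = L2ip \<Omega> ?\<beta> \<phi>"
        using R_diff[OF v w \<phi>] L2.ip_scale[of "\<lambda>x. hterm v x - hterm w x" \<Omega> \<phi> t] L2_diff[OF Lh[OF HV[OF v]] Lh[OF HV[OF w]]] LV[OF \<phi>]
        by simp
      finally show ?thesis by simp
    qed
    ultimately have gb: "gnorm ?d \<le> 2 * (1 + C * CH) * E.nrm ?r"
      by (intro discrete_stability[OF P C sub HV approx e d r \<beta>]) auto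
    have "E.nrm ?d \<le> sqrt (1 + lam) * H1norm \<Omega> ?d" by (rule nrm_le_H1norm[OF HV[OF d]])
    also have "\<dots> \<le> sqrt (1 + lam) * ((1 + P) * gnorm ?d)"
      using lam by (intro mult_left_mono H1norm_le_gnorm P HV d) auto
    also have "\<dots> \<le> sqrt (1 + lam) * ((1 + P) * (2 * (1 + C * CH) * E.nrm ?r))"
      using lam P(1) gb by (intro mult_left_mono) auto
    finally show ?thesis by (simp add: A mult_ac)
  qed
  \<comment> \<open>The data f is already contained in \<open>R\<close>, so the target of the
    continuation is 0.\<close>
  have "\<exists>v\<in>V. V.nrm (\<lambda>x. (v x + R v x) - 0) = 0"
    using P(1) CH A0 by (intro V.continuity_method[OF complete R(1) Lip stab _ A0 V.zero_closed]) auto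
  then obtain uh where uh: "uh \<in> V" "V.nrm (\<lambda>x. uh x + R uh x) = 0" by auto
  have HJ_V: "HJ_form \<Omega> H lam f v \<phi> \<longleftrightarrow> energy lam (\<lambda>x. v x + R v x) \<phi> = 0" if v: "v \<in> V" and \<phi>: "\<phi> \<in> V" for v \<phi>
  proof -
    have "energy lam (\<lambda>x. v x + R v x) \<phi> = energy lam v \<phi> + (L2ip \<Omega> (hterm v) \<phi> - L2ip \<Omega> f \<phi>)"
      using V.ip_add[OF v R(1)[OF v] \<phi>] R(2)[OF v \<phi>] L2.ip_diff[of "hterm v" \<Omega> f \<phi>] Lh[OF HV[OF v]] f LV[OF \<phi>] by simp
    then show ?thesis using HJ_form_iff[OF H10_H1[OF HV[OF v]] H10_H1[OF HV[OF \<phi>]]] by auto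
  qed
  have uR: "(\<lambda>x. uh x + R uh x) \<in> V" by (intro V.add_closed R uh)
  \<comment> \<open>A function of seminorm zero is orthogonal to everything by Cauchy-Schwarz, so
    solving up to seminorm zero gives the equation exactly.\<close>
  have orth: "energy lam (\<lambda>x. uh x + R uh x) \<phi> = 0" if "\<phi> \<in> V" for \<phi>
    using V.Cauchy_Schwarz[OF uR that] uh(2) by simp
  have sol: "HJ_form \<Omega> H lam f uh \<phi>" if "\<phi> \<in> V" for \<phi>
    using HJ_V[OF uh(1) that] orth[OF that] by simp
  have stab1: "E.nrm (\<lambda>x. v x - uh x) \<le> A * E.nrm (\<lambda>x. (v x + R v x) - (uh x + R uh x))" if "v \<in> V" for v
    using stab[of 1 v uh] that uh(1) by simp
  have H1_le: "H1norm \<Omega> (\<lambda>x. v x - uh x) \<le> (1 + P) * E.nrm (\<lambda>x. v x - uh x)" if v: "v \<in> V" for v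
  proof -
    have d: "H10 \<Omega> (\<lambda>x. v x - uh x)" by (intro H10_diff HV v uh)
    have "H1norm \<Omega> (\<lambda>x. v x - uh x) \<le> (1 + P) * gnorm (\<lambda>x. v x - uh x)" by (rule H1norm_le_gnorm[OF P(2)[OF d] d])
    also have "\<dots> \<le> (1 + P) * E.nrm (\<lambda>x. v x - uh x)" using P(1) gnorm_le_nrm[OF d] by (intro mult_left_mono) auto
    finally show ?thesis .
  qed
  have uniq: "H1norm \<Omega> (\<lambda>x. w x - uh x) = 0" if w: "w \<in> V" and wsol: "\<forall>\<phi>\<in>V. HJ_form \<Omega> H lam f w \<phi>" for w
  proof -
    let ?r = "\<lambda>x. (w x + R w x) - (uh x + R uh x)"
    have wR: "(\<lambda>x. w x + R w x) \<in> V" by (intro V.add_closed R w)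
    have r: "?r \<in> V" by (rule V.diff_closed[OF wR uR])
    have "energy lam ?r ?r = 0"
      using V.ip_diff[OF wR uR r] orth[OF r] HJ_V[OF w r] wsol r by simp
    then have "E.nrm ?r = 0" by (simp add: E.nrm_def)
    then have "E.nrm (\<lambda>x. w x - uh x) \<le> 0" using stab1[OF w] by simp
    then have "(1 + P) * E.nrm (\<lambda>x. w x - uh x) \<le> 0" using P(1) by (intro mult_nonneg_nonpos) auto
    then show ?thesis using H1_le[OF w] H1norm_nonneg[of "\<lambda>x. w x - uh x"] by linarith
  qed
  have B0: "B > 0" unfolding B using lam P(1) CH A0 by (intro add_pos_nonneg mult_nonneg_nonneg) auto
  have quasi: "H1norm \<Omega> (\<lambda>x. u x - uh x) \<le> B * H1norm \<Omega> (\<lambda>x. u x - v x)" if v: "v \<in> V" for v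
  proof -
    let ?r = "\<lambda>x. (v x + R v x) - (uh x + R uh x)" and ?d = "\<lambda>x. v x - u x"
    have vR: "(\<lambda>x. v x + R v x) \<in> V" by (intro V.add_closed R v)
    have r: "?r \<in> V" by (rule V.diff_closed[OF vR uR])
    have Hd: "H10 \<Omega> ?d" by (intro H10_diff HV v Hu)
    \<comment> \<open>Consistency: the residual \<open>?r\<close> is an admissible test function for
      the exact equation of u. Testing the residual with itself then leaves only differences between
      v and u.\<close>
    have "energy lam u ?r + L2ip \<Omega> (hterm u) ?r = L2ip \<Omega> f ?r"
      using u HV[OF r] HJ_form_iff[OF H10_H1[OF Hu] H10_H1[OF HV[OF r]]] by (simp add: weak_sol_HJ_def)
    then have "energy lam ?r ?r = energy lam v ?r - energy lam u ?r + (L2ip \<Omega> (hterm v) ?r - L2ip \<Omega> (hterm u) ?r)"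
      using V.ip_diff[OF vR uR r] orth[OF r] V.ip_add[OF v R(1)[OF v] r] R(2)[OF v r]
        L2.ip_diff[of "hterm v" \<Omega> f ?r] Lh[OF HV[OF v]] f LV[OF r] by simp
    also have "\<dots> = energy lam ?d ?r + L2ip \<Omega> (\<lambda>x. hterm v x - hterm u x) ?r"
      using E.ip_diff[of v u ?r] HV[OF v] HV[OF r] Hu L2.ip_diff[of "hterm v" \<Omega> "hterm u" ?r] Lh[OF HV[OF v]] Lh[OF Hu] LV[OF r]
      by simp
    also have "\<dots> \<le> E.nrm ?d * E.nrm ?r + CH * P * E.nrm ?d * E.nrm ?r"
      using E.Cauchy_Schwarz[of ?d ?r] Hd HV[OF r] hdiff[OF HV[OF v] Hu HV[OF r]] by simp
    finally have "(E.nrm ?r)\<^sup>2 \<le> ((1 + CH * P) * E.nrm ?d) * E.nrm ?r"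
      using HV[OF r] by (simp add: E.nrm_sq algebra_simps)
    then have rb: "E.nrm ?r \<le> (1 + CH * P) * E.nrm ?d"
      by (rule le_if_sq_le_mult) (use HV[OF r] Hd CH P(1) in \<open>auto intro!: mult_nonneg_nonneg\<close>)
    have db: "E.nrm ?d \<le> sqrt (1 + lam) * H1norm \<Omega> (\<lambda>x. u x - v x)"
      using nrm_le_H1norm[OF Hd] H1norm_minus_commute[OF H10_H1[OF Hu] H10_H1[OF HV[OF v]]] by simp
    have "H1norm \<Omega> (\<lambda>x. v x - uh x) \<le> (1 + P) * E.nrm (\<lambda>x. v x - uh x)" by (rule H1_le[OF v])
    also have "\<dots> \<le> (1 + P) * (A * ((1 + CH * P) * (sqrt (1 + lam) * H1norm \<Omega> (\<lambda>x. u x - v x))))"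
    proof (rule mult_left_mono)
      have "A * E.nrm ?r \<le> A * ((1 + CH * P) * (sqrt (1 + lam) * H1norm \<Omega> (\<lambda>x. u x - v x)))"
      proof (rule mult_left_mono[OF _ A0])
        have "(1 + CH * P) * E.nrm ?d \<le> (1 + CH * P) * (sqrt (1 + lam) * H1norm \<Omega> (\<lambda>x. u x - v x))"
          using db CH P(1) by (intro mult_left_mono) auto
        then show "E.nrm ?r \<le> (1 + CH * P) * (sqrt (1 + lam) * H1norm \<Omega> (\<lambda>x. u x - v x))" using rb by linarith
      qed
      then show "E.nrm (\<lambda>x. v x - uh x) \<le> A * ((1 + CH * P) * (sqrt (1 + lam) * H1norm \<Omega> (\<lambda>x. u x - v x)))"
        using stab1[OF v] by linarith
    qed (use P(1) in simp)
    finally show ?thesis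
      using H1norm_triangle_diff[OF H10_H1[OF Hu] H10_H1[OF HV[OF v]] H10_H1[OF HV[OF uh(1)]]]
      by (simp add: B distrib_right mult.assoc)
  qed
  \<comment> \<open>Dividing by B turns the estimate for every v into a lower bound for the infimum,
    which need not be attained.\<close>
  have "H1norm \<Omega> (\<lambda>x. u x - uh x) / B \<le> best_approx \<Omega> V u"
    unfolding best_approx_def
  proof (rule cINF_greatest)
    show "V \<noteq> {}" using uh(1) by auto
    show "H1norm \<Omega> (\<lambda>x. u x - uh x) / B \<le> H1norm \<Omega> (\<lambda>x. u x - v x)" if "v \<in> V" for v
      using quasi[OF that] B0 by (simp add: field_simps)
  qed
  then have "H1norm \<Omega> (\<lambda>x. u x - uh x) \<le> B * best_approx \<Omega> V u" using B0 by (simp add: field_simps)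
  then show ?thesis using uh(1) sol uniq by blast
qed

end

theorem mainTheorem14:
  fixes \<Omega> :: "(real^'d::finite) set"
    and lam :: real and f :: "real^'d \<Rightarrow> real"
    and H :: "real^'d \<Rightarrow> real^'d \<Rightarrow> real"
    and CH K :: real
    and V :: "real \<Rightarrow> (real^'d \<Rightarrow> real) set"
    and \<eta> :: "real \<Rightarrow> real"
    and u :: "real^'d \<Rightarrow> real"
  assumes dom: "lipschitz_domain \<Omega>" "bounded \<Omega>"
    and HJ1: "lam \<ge> 0" "L2 \<Omega> f"
      "continuous_on (closure \<Omega> \<times> UNIV) (\<lambda>(x, z). H x z)"
      "CH > 0" "\<forall>x\<in>\<Omega>. \<forall>z1 z2. \<bar>H x z1 - H x z2\<bar> \<le> CH * norm (z1 - z2)"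
    and HJ2: "K > 0"
      "\<forall>g v. L2 \<Omega> g \<and> weak_sol_lin \<Omega> lam g v \<longrightarrow> H2 \<Omega> v \<and> H2norm \<Omega> v \<le> K * L2norm \<Omega> g"
    and Vh: "\<forall>h>0. fin_dim_fun_space (V h) \<and> (\<forall>v\<in>V h. H10 \<Omega> v)"
    and approx1: "\<forall>v. H10 \<Omega> v \<longrightarrow> ((\<lambda>h. best_approx \<Omega> (V h) v) \<longlongrightarrow> 0) (at_right 0)"
    and approx2: "\<forall>v. H2 \<Omega> v \<and> H10 \<Omega> v \<longrightarrow> (\<forall>h>0. best_approx \<Omega> (V h) v \<le> \<eta> h * H2norm \<Omega> v)"
    and eta: "mono_on {0<..} \<eta>" "(\<eta> \<longlongrightarrow> 0) (at_right 0)"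
    and sol: "H2 \<Omega> u" "weak_sol_HJ \<Omega> H lam f u"
  shows "\<exists>h0>0. \<exists>Nb::(real^'d \<Rightarrow> real) set. (\<forall>w\<in>Nb. H10 \<Omega> w) \<and>
           (\<exists>r>0. \<forall>w. H10 \<Omega> w \<and> H1norm \<Omega> (\<lambda>x. w x - u x) < r \<longrightarrow> w \<in> Nb) \<and>
           (\<exists>C C'. \<forall>h. 0 < h \<and> h \<le> h0 \<longrightarrow>
              (\<exists>uh. uh \<in> Nb \<inter> V h \<and> (\<forall>\<phi>\<in>V h. HJ_form \<Omega> H lam f uh \<phi>) \<and>
                 (\<forall>w\<in>Nb \<inter> V h. (\<forall>\<phi>\<in>V h. HJ_form \<Omega> H lam f w \<phi>) \<longrightarrow> H1norm \<Omega> (\<lambda>x. w x - uh x) = 0) \<and>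
                 H1norm \<Omega> (\<lambda>x. u x - uh x) \<le> C * best_approx \<Omega> (V h) u \<and>
                 H1norm \<Omega> (\<lambda>x. u x - uh x) \<le> C' * \<eta> h))"
proof -
  interpret hamilton_jacobi \<Omega> lam CH K f H
    using dom HJ1 HJ2 by unfold_locales (auto simp: lipschitz_domain_def)
  obtain P where P: "P > 0" "\<And>u. H10 \<Omega> u \<Longrightarrow> L2norm \<Omega> u \<le> P * gnorm u" using Poincare by blast
  obtain C where C: "C \<ge> 0" "\<And>z g. drift_sol lam CH z g \<Longrightarrow> gnorm z \<le> C * L2norm \<Omega> g"
    using gradient_estimate[OF lam CH] by blast
  \<comment> \<open>Fixed before any h is chosen, hence the same for all discrete spaces.\<close>
  define A where "A = sqrt (1 + lam) * (1 + P) * (2 * (1 + C * CH))"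
  define B where "B = 1 + (1 + P) * (A * ((1 + CH * P) * sqrt (1 + lam)))"
  have B0: "B \<ge> 0" unfolding B_def A_def using lam P(1) C(1) CH
    by (intro add_nonneg_nonneg mult_nonneg_nonneg) auto
  have Hu: "H10 \<Omega> u" using sol(2) by (simp add: weak_sol_HJ_def)
  \<comment> \<open>The left-hand side of the smallness condition in
    \<open>discrete_stability\<close> with e = \<eta> h; its convergence to 0 determines h0.\<close>
  have "((\<lambda>h. (1 + C * CH) * (sqrt (1 + lam) * (\<bar>\<eta> h\<bar> * (K * CH)))) \<longlongrightarrow> (1 + C * CH) * (sqrt (1 + lam) * (\<bar>0\<bar> * (K * CH)))) (at_right 0)"
    by (intro tendsto_intros eta)
  then have "eventually (\<lambda>h. (1 + C * CH) * (sqrt (1 + lam) * (\<bar>\<eta> h\<bar> * (K * CH))) < 1/2) (at_right 0)"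
    by (rule order_tendstoD) simp
  then obtain b where b: "b > 0" "\<And>h. 0 < h \<Longrightarrow> h < b \<Longrightarrow> (1 + C * CH) * (sqrt (1 + lam) * (\<bar>\<eta> h\<bar> * (K * CH))) < 1/2"
    unfolding eventually_at_right_field by auto
  have main: "\<exists>uh. uh \<in> {w. H10 \<Omega> w} \<inter> V h \<and> (\<forall>\<phi>\<in>V h. HJ_form \<Omega> H lam f uh \<phi>) \<and>
      (\<forall>w\<in>{w. H10 \<Omega> w} \<inter> V h. (\<forall>\<phi>\<in>V h. HJ_form \<Omega> H lam f w \<phi>) \<longrightarrow> H1norm \<Omega> (\<lambda>x. w x - uh x) = 0) \<and>
      H1norm \<Omega> (\<lambda>x. u x - uh x) \<le> B * best_approx \<Omega> (V h) u \<and>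
      H1norm \<Omega> (\<lambda>x. u x - uh x) \<le> (B * H2norm \<Omega> u) * \<eta> h" if h: "0 < h \<and> h \<le> b / 2" for h
  proof -
    have hb: "0 < h" "h < b" using h b(1) by auto
    have Vh': "fin_dim_fun_space (V h)" "\<And>v. v \<in> V h \<Longrightarrow> H10 \<Omega> v" using Vh hb(1) by auto
    have ap: "best_approx \<Omega> (V h) v \<le> \<eta> h * H2norm \<Omega> v" if "H2 \<Omega> v" "H10 \<Omega> v" for v
      using approx2 that hb(1) by blast
    obtain uh where uh: "uh \<in> V h" "\<forall>\<phi>\<in>V h. HJ_form \<Omega> H lam f uh \<phi>"
        "\<forall>w\<in>V h. (\<forall>\<phi>\<in>V h. HJ_form \<Omega> H lam f w \<phi>) \<longrightarrow> H1norm \<Omega> (\<lambda>x. w x - uh x) = 0"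
        "H1norm \<Omega> (\<lambda>x. u x - uh x) \<le> B * best_approx \<Omega> (V h) u"
      using discrete_problem[OF P C Vh' ap less_imp_le[OF b(2)[OF hb]] sol(2) A_def B_def] by blast
    \<comment> \<open>The H2 regularity of u turns quasi-optimality into the rate \<eta> h.\<close>
    have "B * best_approx \<Omega> (V h) u \<le> B * (\<eta> h * H2norm \<Omega> u)"
      by (intro mult_left_mono ap sol Hu B0)
    then have "H1norm \<Omega> (\<lambda>x. u x - uh x) \<le> (B * H2norm \<Omega> u) * \<eta> h" using uh(4) by (simp add: mult_ac)
    then show ?thesis using uh Vh'(2)[OF uh(1)] by (intro exI[of _ uh]) auto
  qed
  show ?thesis
  \<comment> \<open>The eventual statement covers h < b strictly; halving b admits h = h0.\<close>
  proof (rule exI[of _ "b / 2"], rule conjI)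
    show "b / 2 > 0" using b(1) by simp
    show "\<exists>Nb::(real^'d \<Rightarrow> real) set. (\<forall>w\<in>Nb. H10 \<Omega> w) \<and>
        (\<exists>r>0. \<forall>w. H10 \<Omega> w \<and> H1norm \<Omega> (\<lambda>x. w x - u x) < r \<longrightarrow> w \<in> Nb) \<and>
        (\<exists>C C'. \<forall>h. 0 < h \<and> h \<le> b / 2 \<longrightarrow>
          (\<exists>uh. uh \<in> Nb \<inter> V h \<and> (\<forall>\<phi>\<in>V h. HJ_form \<Omega> H lam f uh \<phi>) \<and>
            (\<forall>w\<in>Nb \<inter> V h. (\<forall>\<phi>\<in>V h. HJ_form \<Omega> H lam f w \<phi>) \<longrightarrow> H1norm \<Omega> (\<lambda>x. w x - uh x) = 0) \<and>
            H1norm \<Omega> (\<lambda>x. u x - uh x) \<le> C * best_approx \<Omega> (V h) u \<and>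
            H1norm \<Omega> (\<lambda>x. u x - uh x) \<le> C' * \<eta> h))"
    proof (rule exI[of _ "{w. H10 \<Omega> w}"], intro conjI)
      show "\<exists>r>0. \<forall>w. H10 \<Omega> w \<and> H1norm \<Omega> (\<lambda>x. w x - u x) < r \<longrightarrow> w \<in> {w. H10 \<Omega> w}"
        by (rule exI[of _ 1]) simp
    qed (use main in blast)+
  qed
qed

end
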